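(* For any positive integers $p$ and $\Delta$, the \textsc{Directed Anchored $k$-Core} problem can be solved in time $2^{O(\Delta p)}\cdot n^2\log n$ on $n$-vertex directed acyclic graphs of maximum degree at most $\Delta$.
   Context: Directed graphs are finite, without loops or multiple arcs; $d^-_G(v)$, $d^+_G(v)$ denote in- and out-degree, the degree of $v$ is $d^-_G(v)+d^+_G(v)$, and the maximum degree of $G$ is the maximum degree of its vertices; $G[U]$ is the induced subgraph. \textsc{Directed Anchored $k$-Core}: given a directed graph $G$ and integers $b,k,p$, decide whether there exist sets $A\subseteq H\subseteq V(G)$ with $|A|\leq b$, $|H|\geq p$ and $d^-_{G[H]}(v)\geq k$ for every $v\in H\setminus A$. *)

theory Defs
  imports Complex_Main "Graph_Theory.Graph_Theory"
begin

definition directed_anchored_k_core ::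
  "('a, 'b) pre_digraph \<Rightarrow> int \<Rightarrow> int \<Rightarrow> int \<Rightarrow> bool" where
  "directed_anchored_k_core G b k p \<longleftrightarrow>
     (\<exists>A H. A \<subseteq> H \<and> H \<subseteq> verts G \<and> int (card A) \<le> b \<and> int (card H) \<ge> p \<and>
        (\<forall>v \<in> H - A. int (in_degree (G \<restriction> H) v) \<ge> k))"

definition degree :: "('a, 'b) pre_digraph \<Rightarrow> 'a \<Rightarrow> nat" where
  "degree G v = in_degree G v + out_degree G v"

text \<open>The inserted 0 only matters for the null graph, which thereby has maximum degree 0.\<close>

definition max_degree :: "('a, 'b) pre_digraph \<Rightarrow> nat" where
  "max_degree G = Max (insert 0 (degree G ` verts G))"

definition dag :: "('a, 'b) pre_digraph \<Rightarrow> bool" where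
  "dag G \<longleftrightarrow> digraph G \<and> (\<nexists>c. pre_digraph.cycle G c)"

text \<open>
  A unit-cost random access machine whose cells hold integers, with addition and subtraction as
  its only arithmetic (there is no unit-cost multiplication, division or bit operation) and with
  indirect addressing, presented as a structured programming language. Cells are addressed by
  integers; the input is stored from address 0 on and all other cells are initially 0.

  Every node of an expression costs one step, as does every store and every test, so that
  one step corresponds to boundedly many instructions of the usual register machine.
  Tests ask whether the value of an expression is positive.
\<close>

type_synonym memory = "int \<Rightarrow> int"

datatype aexp = Const int | Cell aexp | Add aexp aexp | Sub aexp aexp

fun aval :: "aexp \<Rightarrow> memory \<Rightarrow> int" where
  "aval (Const i) s = i"
| "aval (Cell a) s = s (aval a s)"
| "aval (Add a1 a2) s = aval a1 s + aval a2 s"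
| "aval (Sub a1 a2) s = aval a1 s - aval a2 s"

fun acost :: "aexp \<Rightarrow> nat" where
  "acost (Const i) = 1"
| "acost (Cell a) = 1 + acost a"
| "acost (Add a1 a2) = 1 + acost a1 + acost a2"
| "acost (Sub a1 a2) = 1 + acost a1 + acost a2"

datatype com =
    Skip
  | Store aexp aexp  \<comment> \<open>address, value\<close>
  | Seq com com
  | IfPos aexp com com
  | WhilePos aexp com

text \<open>\<open>exec c s t s'\<close>: started in memory \<open>s\<close>, \<open>c\<close> halts after \<open>t\<close> steps with memory \<open>s'\<close>.\<close>

inductive exec :: "com \<Rightarrow> memory \<Rightarrow> nat \<Rightarrow> memory \<Rightarrow> bool" where
  Skip: "exec Skip s 1 s"
| Store: "exec (Store a e) s (1 + acost a + acost e) (s(aval a s := aval e s))"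
| Seq: "exec c1 s t1 s1 \<Longrightarrow> exec c2 s1 t2 s2 \<Longrightarrow> exec (Seq c1 c2) s (t1 + t2) s2"
| IfTrue: "aval e s > 0 \<Longrightarrow> exec c1 s t s' \<Longrightarrow> exec (IfPos e c1 c2) s (1 + acost e + t) s'"
| IfFalse: "\<not> aval e s > 0 \<Longrightarrow> exec c2 s t s' \<Longrightarrow> exec (IfPos e c1 c2) s (1 + acost e + t) s'"
| WhileFalse: "\<not> aval e s > 0 \<Longrightarrow> exec (WhilePos e c) s (1 + acost e) s"
| WhileTrue: "aval e s > 0 \<Longrightarrow> exec c s t1 s1 \<Longrightarrow> exec (WhilePos e c) s1 t2 s2 \<Longrightarrow>
    exec (WhilePos e c) s (1 + acost e + t1 + t2) s2"

inductive_cases SkipE: "exec Skip s t s'"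
inductive_cases StoreE: "exec (Store a e) s t s'"
inductive_cases SeqE: "exec (Seq c1 c2) s t s'"
inductive_cases IfPosE: "exec (IfPos e c1 c2) s t s'"
inductive_cases WhilePosE: "exec (WhilePos e c) s t s'"

lemma exec_deterministic:
  "exec c s t s' \<Longrightarrow> exec c s u s'' \<Longrightarrow> u = t \<and> s'' = s'"
proof (induction arbitrary: u s'' rule: exec.induct)
  case (Skip s)
  from Skip.prems show ?case by (rule SkipE) simp
next
  case (Store a e s)
  from Store.prems show ?case by (rule StoreE) simp
next
  case (Seq c1 s t1 s1 c2 t2 s2)
  from Seq.prems obtain u1 r1 u2 where u: "u = u1 + u2"
    and first: "exec c1 s u1 r1" and second: "exec c2 r1 u2 s''"
    by (rule SeqE)
  from Seq.IH(1)[OF first] have "u1 = t1" and "r1 = s1" by auto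
  with second have "exec c2 s1 u2 s''" by simp
  from Seq.IH(2)[OF this] u \<open>u1 = t1\<close> show ?case by simp
next
  case (IfTrue e s c1 t s' c2)
  from IfTrue.prems show ?case
  proof (rule IfPosE)
    fix u1
    assume "u = Suc (acost e + u1)" and "exec c1 s u1 s''"
    with IfTrue.IH[of u1 s''] show ?thesis by simp
  qed (use IfTrue.hyps(1) in simp)
next
  case (IfFalse e s c2 t s' c1)
  from IfFalse.prems show ?case
  proof (rule IfPosE)
    fix u1
    assume "u = Suc (acost e + u1)" and "exec c2 s u1 s''"
    with IfFalse.IH[of u1 s''] show ?thesis by simp
  qed (use IfFalse.hyps(1) in simp)
next
  case (WhileFalse e s c)
  from WhileFalse.prems show ?case
    by (rule WhilePosE) (use WhileFalse.hyps in simp_all)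
next
  case (WhileTrue e s c t1 s1 t2 s2)
  from WhileTrue.prems show ?case
  proof (rule WhilePosE)
    fix u1 r1 u2
    assume u: "u = Suc (acost e + u1 + u2)"
      and body: "exec c s u1 r1" and rest: "exec (WhilePos e c) r1 u2 s''"
    from WhileTrue.IH(1)[OF body] have "u1 = t1" and "r1 = s1" by auto
    with rest have "exec (WhilePos e c) s1 u2 s''" by simp
    from WhileTrue.IH(2)[OF this] u \<open>u1 = t1\<close> show ?thesis by simp
  qed (use WhileTrue.hyps(1) in simp)
qed

definition initial_memory :: "int list \<Rightarrow> memory" where
  "initial_memory xs a = (if 0 \<le> a \<and> a < int (length xs) then xs ! nat a else 0)"

text \<open>The answer is read off cell 0.\<close>

definition decides_within :: "com \<Rightarrow> int list \<Rightarrow> bool \<Rightarrow> real \<Rightarrow> bool" where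
  "decides_within prog input answer T \<longleftrightarrow>
     (\<exists>t s. exec prog (initial_memory input) t s \<and> s 0 = (if answer then 1 else 0) \<and> real t \<le> T)"

text \<open>
  The vertices of an \<open>n\<close>-vertex graph are the numbers below \<open>n\<close>; the arcs are given
  by a list without repetitions, in any order.
\<close>

definition graph_listing :: "nat pair_pre_digraph \<Rightarrow> nat \<Rightarrow> (nat \<times> nat) list \<Rightarrow> bool" where
  "graph_listing G n es \<longleftrightarrow> pverts G = {..<n} \<and> parcs G = set es \<and> distinct es"

definition encode_instance ::
  "nat \<Rightarrow> (nat \<times> nat) list \<Rightarrow> int \<Rightarrow> int \<Rightarrow> int \<Rightarrow> int list" where
  "encode_instance n es b k p =
     [int n, int (length es), b, k, p] @ concat (map (\<lambda>(u, v). [int u, int v]) es)"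

end

theory Submission
  imports Defs
begin

text \<open>
  Deleting a sink of \<open>G[H]\<close> affects no other vertex, so in an acyclic graph a solution can be
  trimmed to \<open>|H| = p\<close>. Hence one looks for a set \<open>H\<close> of at most \<open>p \<le> n\<close> vertices in which at least
  \<open>p - b\<close> vertices have in-degree at least \<open>k\<close>; this number, the gain, is monotone in \<open>H\<close> and
  additive over components.

  \<open>H\<close> is built component by component by a search guided by a bit string of length
  \<open>N = 3 (D + 1) p\<close>, where \<open>D\<close> is the maximum degree, and all \<open>2 ^ N\<close> strings are tried. Since a
  breadth-first search asks one bit per arc end, a component of size \<open>t\<close> is described by \<open>D t\<close> bits
  and its start vertex. The start vertex must not cost \<open>log n\<close> bits: one guesses the least size
  \<open>s\<close> of a remaining component and computes, by trying all start vertices and bit strings, a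
  connected set \<open>C\<close> of size \<open>s\<close> with the largest gain. Some optimal \<open>H\<close> meets \<open>C\<close>, because otherwise
  a component of size \<open>s\<close> could be exchanged for \<open>C\<close>, and the start vertex is given by its position
  in \<open>C\<close>.
\<close>

section \<open>Guided search in the underlying graph\<close>

text \<open>Whatever set a bit string leads to is a genuine vertex set, and its size and gain are
  then checked directly, so wrong guesses cannot cause a wrong acceptance. The difficulty is
  completeness: \<open>C\<close> is chosen from \<open>Q\<close> and \<open>s\<close> alone, without
  knowledge of \<open>H\<close>, and may have arcs to \<open>Q\<close> and to \<open>H\<close>. Such
  arcs do no harm, because they only raise in-degrees, provided that the quantity maximised is the
  gain of \<open>Q\<close> and \<open>C\<close> together. What has to be maintained is that no arc
  joins \<open>Q\<close> to the rest of \<open>H\<close>. An exchange may break this, but the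
  component taken next contains all of \<open>C\<close> and so repairs it.

  The time is quadratic in \<open>n\<close> because only the loops over the vertices and the passes
  over the arc list, whose length is at most \<open>D * n\<close>, depend on \<open>n\<close>.
  Everything else, from membership tests to the \<open>2 ^ N\<close> guesses tried inside each of
  the \<open>2 ^ N\<close> strings, is bounded by a fixed power of \<open>2 ^ N\<close>.\<close>

definition other_end :: "nat \<Rightarrow> nat \<times> nat \<Rightarrow> nat" where
  "other_end u e = (if snd e = u then fst e else if fst e = u then snd e else u)"

text \<open>
  A search state is a pair of the list of vertices found so far and the remaining guess bits;
  an exhausted tape supplies zeros.
\<close>

definition offer :: "nat \<Rightarrow> nat list \<times> bool list \<Rightarrow> nat list \<times> bool list" where
  "offer x st = (if x \<in> set (fst st) then st
     else (if snd st \<noteq> [] \<and> hd (snd st) then fst st @ [x] else fst st, tl (snd st)))"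

text \<open>An arc that misses \<open>u\<close> has \<open>u\<close> itself as its
  \<open>other_end\<close>. Since \<open>u\<close> is already found whenever it is explored,
  \<open>offer\<close> passes over such an arc and reads no bit.\<close>

definition explore :: "(nat \<times> nat) list \<Rightarrow> nat \<Rightarrow> nat list \<times> bool list \<Rightarrow> nat list \<times> bool list" where
  "explore es u = fold (\<lambda>e. offer (other_end u e)) es"

text \<open>A vertex is appended only in exchange for a bit. This potential makes \<open>bfs\<close>
  terminate and later bounds the length of the queue in the machine.\<close>

lemma offer_length: "length (fst (offer x st)) + length (snd (offer x st)) \<le> length (fst st) + length (snd st)"
  by (cases "snd st") (auto simp: offer_def)

lemma explore_length:
  "length (fst (explore es u st)) + length (snd (explore es u st)) \<le> length (fst st) + length (snd st)"
  unfolding explore_def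
proof (induction es arbitrary: st)
  case (Cons e es)
  show ?case using Cons[of "offer (other_end u e) st"] offer_length[of "other_end u e" st] by simp
qed simp

function bfs :: "(nat \<times> nat) list \<Rightarrow> nat \<Rightarrow> nat list \<times> bool list \<Rightarrow> nat list \<times> bool list" where
  "bfs es i st =
     (if i < length (fst st) then bfs es (Suc i) (explore es (fst st ! i) st) else st)"
  by auto
termination
proof (relation "measure (\<lambda>(es, i, st). length (fst st) + length (snd st) - i)", goal_cases)
  case (2 es i st)
  then show ?case using explore_length[of es "fst st ! i" st] by simp
qed simp

declare bfs.simps [simp del]

lemma bfs_length:
  "length (fst (bfs es i st)) + length (snd (bfs es i st)) \<le> length (fst st) + length (snd st)"
proof (induction es i st rule: bfs.induct)
  case (1 es i st)
  then show ?case using explore_length[of es "fst st ! i" st] by (subst (1 2) bfs.simps) fastforce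
qed

lemma offer_invariant:
  assumes "distinct (fst st)" "set (fst st) \<subseteq> V" "x \<in> set (fst st) \<or> x \<in> V"
  shows "distinct (fst (offer x st)) \<and> set (fst (offer x st)) \<subseteq> V \<and> (\<exists>E. fst (offer x st) = fst st @ E)"
  using assms by (auto simp: offer_def)

lemma explore_invariant:
  assumes "distinct (fst st)" "set (fst st) \<subseteq> V" "u \<in> V" "set es \<subseteq> V \<times> V"
  shows "distinct (fst (explore es u st)) \<and> set (fst (explore es u st)) \<subseteq> V \<and>
    (\<exists>E. fst (explore es u st) = fst st @ E)"
  using assms unfolding explore_def
proof (induction es arbitrary: st)
  case (Cons e es)
  have inv: "distinct (fst (offer (other_end u e) st)) \<and> set (fst (offer (other_end u e) st)) \<subseteq> V \<and>
    (\<exists>E. fst (offer (other_end u e) st) = fst st @ E)"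
    using Cons.prems by (intro offer_invariant) (auto simp: other_end_def)
  then show ?case using Cons.IH[of "offer (other_end u e) st"] Cons.prems by force
qed simp

lemma bfs_invariant:
  assumes "distinct (fst st)" "set (fst st) \<subseteq> V" "set es \<subseteq> V \<times> V"
  shows "distinct (fst (bfs es i st)) \<and> set (fst (bfs es i st)) \<subseteq> V \<and>
    (\<exists>E. fst (bfs es i st) = fst st @ E)"
  using assms
proof (induction es i st rule: bfs.induct)
  case (1 es i st)
  show ?case
  proof (cases "i < length (fst st)")
    case True
    let ?st = "explore es (fst st ! i) st"
    have "fst st ! i \<in> V" using True "1.prems" nth_mem by blast
    then have inv: "distinct (fst ?st) \<and> set (fst ?st) \<subseteq> V \<and> (\<exists>E. fst ?st = fst st @ E)"
      using "1.prems" by (intro explore_invariant) auto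
    then show ?thesis using "1.IH"[OF True] "1.prems"(3) True
      by (subst (1 2 3) bfs.simps) force
  qed (use "1.prems" in \<open>simp add: bfs.simps\<close>)
qed

definition adjacent :: "(nat \<times> nat) list \<Rightarrow> nat \<Rightarrow> nat \<Rightarrow> bool" where
  "adjacent es u v \<longleftrightarrow> (u, v) \<in> set es \<or> (v, u) \<in> set es"

lemma adjacent_other_end:
  "adjacent es u y \<Longrightarrow> \<exists>e\<in>set es. other_end u e = y \<or> y = u"
  by (force simp: adjacent_def other_end_def)

lemma other_end_adjacent: "e \<in> set es \<Longrightarrow> other_end u e = u \<or> adjacent es u (other_end u e)"
  by (cases e) (auto simp: adjacent_def other_end_def)

lemma explore_connected:
  assumes "u \<in> set (fst st)"
  shows "\<forall>y\<in>set (fst (explore es u st)) - set (fst st). adjacent es u y"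
proof -
  have "\<forall>y\<in>set (fst (fold (\<lambda>e. offer (other_end u e)) fs st)) - set (fst st). adjacent es u y"
    if "set fs \<subseteq> set es" "u \<in> set (fst st)" for fs st
    using that
  proof (induction fs arbitrary: st)
    case (Cons e fs)
    let ?st = "offer (other_end u e) st"
    have "\<forall>y\<in>set (fst ?st) - set (fst st). adjacent es u y"
      using Cons.prems other_end_adjacent[of e es u] by (auto simp: offer_def split: if_splits)
    moreover have "u \<in> set (fst ?st)" using Cons.prems by (auto simp: offer_def)
    ultimately show ?case using Cons.IH[of ?st] Cons.prems by auto
  qed simp
  then show ?thesis using assms unfolding explore_def by blast
qed

text \<open>\<open>K\<close> has to be closed only towards vertices that the search itself finds,
  because it will be a component of an induced subgraph and not of the whole graph. The lemma serves
  to place the greedily chosen set inside the component of its start vertex.\<close>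

lemma bfs_connected:
  assumes "distinct (fst st)" "set (drop i0 (fst st)) \<subseteq> K" "i0 \<le> i" "i0 \<le> length (fst st)"
    "\<And>u y. u \<in> K \<Longrightarrow> y \<in> set (drop i0 (fst (bfs es i st))) \<Longrightarrow> adjacent es u y \<Longrightarrow> y \<in> K"
  shows "set (drop i0 (fst (bfs es i st))) \<subseteq> K"
  using assms
proof (induction es i st rule: bfs.induct)
  case (1 es i st)
  show ?case
  proof (cases "i < length (fst st)")
    case True
    let ?u = "fst st ! i"
    let ?st = "explore es ?u st"
    have eq: "bfs es i st = bfs es (Suc i) ?st" using True by (simp add: bfs.simps)
    let ?V = "UNIV :: nat set"
    have inv: "distinct (fst ?st) \<and> (\<exists>E. fst ?st = fst st @ E)"
      using explore_invariant[of st ?V ?u es] "1.prems" by auto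
    then obtain E where E: "fst ?st = fst st @ E" by auto
    have inv2: "\<exists>E. fst (bfs es i st) = fst ?st @ E"
      using bfs_invariant[of ?st ?V es "Suc i"] inv eq by auto
    have "drop i0 (fst st) ! (i - i0) = ?u" using "1.prems"(3,4) by simp
    then have uK: "?u \<in> K" using "1.prems"(2,3) True
      by (metis diff_less_mono length_drop nth_mem subsetD)
    have "set (drop i0 (fst ?st)) \<subseteq> K"
    proof
      fix y assume y: "y \<in> set (drop i0 (fst ?st))"
      show "y \<in> K"
      proof (cases "y \<in> set (drop i0 (fst st))")
        case False
        then have "y \<in> set E" using y E by (auto dest: in_set_dropD)
        then have "y \<notin> set (fst st)" using inv E by auto
        then have "adjacent es ?u y"
          using explore_connected[of ?u st es] True E \<open>y \<in> set E\<close> by auto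
        moreover have "y \<in> set (drop i0 (fst (bfs es i st)))" using inv2 y "1.prems"(4) E by auto
        ultimately show ?thesis using "1.prems"(5)[OF uK] by blast
      qed (use "1.prems" in auto)
    qed
    then show ?thesis unfolding eq
      by (intro "1.IH"[OF True]) (use inv E "1.prems" eq in auto)
  qed (use "1.prems" in \<open>simp add: bfs.simps\<close>)
qed

definition incidences :: "(nat \<times> nat) list \<Rightarrow> nat \<Rightarrow> nat" where
  "incidences es u = count_list (map fst es) u + count_list (map snd es) u"

text \<open>The bits answer whether the vertex just offered lies in \<open>H\<close>. Quantifying
  over \<open>rest\<close> says that the search stops reading by itself, so that descriptions can
  simply be concatenated.\<close>

lemma explore_complete_aux:
  "\<exists>bs E. length bs \<le> incidences es u \<and>
    (\<forall>rest. fold (\<lambda>e. offer (other_end u e)) es (Q, bs @ rest) = (Q @ E, rest)) \<and>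
    set E \<subseteq> H \<and> (\<forall>e\<in>set es. other_end u e \<in> H \<longrightarrow> other_end u e \<in> set (Q @ E))"
  if "u \<in> set Q"
  using that
proof (induction es arbitrary: Q)
  case Nil
  show ?case by (intro exI[of _ "[]"]) auto
next
  case (Cons e es)
  let ?x = "other_end u e"
  show ?case
  proof (cases "?x \<in> set Q")
    case True
    from Cons.IH[OF Cons.prems] obtain bs E where IH: "length bs \<le> incidences es u"
      "\<And>rest. fold (\<lambda>e. offer (other_end u e)) es (Q, bs @ rest) = (Q @ E, rest)"
      "set E \<subseteq> H" "\<forall>e\<in>set es. other_end u e \<in> H \<longrightarrow> other_end u e \<in> set (Q @ E)" by blast
    show ?thesis
      by (intro exI[of _ bs] exI[of _ E]) (use IH True in \<open>auto simp: offer_def[of "other_end u e"] incidences_def\<close>)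
  next
    case False
    define Q' where "Q' = (if ?x \<in> H then Q @ [?x] else Q)"
    have "u \<in> set Q'" using Cons.prems by (auto simp: Q'_def)
    from Cons.IH[OF this] obtain bs E where IH: "length bs \<le> incidences es u"
      "\<And>rest. fold (\<lambda>e. offer (other_end u e)) es (Q', bs @ rest) = (Q' @ E, rest)"
      "set E \<subseteq> H" "\<forall>e\<in>set es. other_end u e \<in> H \<longrightarrow> other_end u e \<in> set (Q' @ E)" by blast
    \<comment> \<open>The other end is new and hence different from \<open>u\<close>, so the arc is
      incident with \<open>u\<close> and pays for the bit.\<close>
    have "?x \<noteq> u" using False Cons.prems by auto
    then have "fst e = u \<or> snd e = u" by (auto simp: other_end_def split: if_splits)
    then have "Suc (incidences es u) \<le> incidences (e # es) u" by (auto simp: incidences_def)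
    then show ?thesis
      by (intro exI[of _ "(?x \<in> H) # bs"] exI[of _ "(if ?x \<in> H then [?x] else []) @ E"])
        (use IH False in \<open>auto simp: offer_def[of "other_end u e"] Q'_def split: if_splits\<close>)
  qed
qed

text \<open>The measure counts the positions still to be expanded: a vertex that is found leaves
  \<open>H - set Q\<close> and enters the queue, so only the advance of \<open>i\<close> changes the
  sum. Each expanded position costs at most \<open>\<Delta>\<close> bits.\<close>

lemma bfs_complete_aux:
  assumes "finite H" "distinct Q" "i \<le> length Q" "\<And>u. incidences es u \<le> \<Delta>"
  shows "\<exists>bs E. length bs \<le> \<Delta> * (length Q + length E - i) \<and>
    (\<forall>rest. bfs es i (Q, bs @ rest) = (Q @ E, rest)) \<and> set E \<subseteq> H \<and> distinct (Q @ E) \<and>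
    (\<forall>u\<in>set (drop i (Q @ E)). \<forall>e\<in>set es. other_end u e \<in> H \<longrightarrow> other_end u e \<in> set (Q @ E))"
  using assms(2,3)
proof (induction "card (H - set Q) + length Q - i" arbitrary: Q i rule: less_induct)
  case less
  show ?case
  proof (cases "i < length Q")
    case False
    then show ?thesis using less.prems
      by (intro exI[of _ "[]"]) (auto simp: bfs.simps)
  next
    case True
    let ?u = "Q ! i"
    obtain bs E where E: "length bs \<le> incidences es ?u"
      "\<And>rest. explore es ?u (Q, bs @ rest) = (Q @ E, rest)" "set E \<subseteq> H"
      "\<forall>e\<in>set es. other_end ?u e \<in> H \<longrightarrow> other_end ?u e \<in> set (Q @ E)"
      using explore_complete_aux[of ?u Q es H] True unfolding explore_def by auto
    have dist: "distinct (Q @ E)"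
      using explore_invariant[of "(Q, bs @ [])" UNIV ?u es] less.prems by (simp only: E(2)) auto
    have "card (H - set (Q @ E)) + length E = card (H - set Q)"
    proof -
      have "H - set Q = (H - set (Q @ E)) \<union> set E" using E(3) dist by auto
      moreover have "card (set E) = length E" using dist distinct_card by auto
      ultimately show ?thesis using assms(1)
        by (simp, subst card_Un_disjoint) auto
    qed
    then have "card (H - set (Q @ E)) + length (Q @ E) - Suc i < card (H - set Q) + length Q - i"
      using True by simp
    from less.hyps[OF this dist] obtain bs' E' where E': "length bs' \<le> \<Delta> * (length (Q @ E) + length E' - Suc i)"
      "\<And>rest. bfs es (Suc i) (Q @ E, bs' @ rest) = ((Q @ E) @ E', rest)" "set E' \<subseteq> H" "distinct ((Q @ E) @ E')"
      "\<forall>u\<in>set (drop (Suc i) ((Q @ E) @ E')). \<forall>e\<in>set es. other_end u e \<in> H \<longrightarrow> other_end u e \<in> set ((Q @ E) @ E')"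
      using True by auto
    have dr: "drop i ((Q @ E) @ E') = ?u # drop (Suc i) ((Q @ E) @ E')"
      using True by (metis Cons_nth_drop_Suc append.assoc length_append nth_append trans_less_add1)
    have "length (bs @ bs') \<le> \<Delta> + \<Delta> * (length (Q @ E) + length E' - Suc i)"
      using E(1) E'(1) assms(4)[of ?u] by simp
    also have "\<dots> = \<Delta> * Suc (length (Q @ E) + length E' - Suc i)" by simp
    also have "\<dots> = \<Delta> * (length Q + length (E @ E') - i)" using True
      by (intro arg_cong[where f="\<lambda>x. \<Delta> * x"]) simp
    finally have len: "length (bs @ bs') \<le> \<Delta> * (length Q + length (E @ E') - i)" .
    have run: "bfs es i (Q, (bs @ bs') @ rest) = (Q @ (E @ E'), rest)" for rest
      using True E(2)[of "bs' @ rest"] E'(2)[of rest] by (subst bfs.simps) simp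
    have closed: "\<forall>u\<in>set (drop i (Q @ (E @ E'))). \<forall>e\<in>set es. other_end u e \<in> H \<longrightarrow> other_end u e \<in> set (Q @ (E @ E'))"
      using E(4) E'(5) dr by auto
    show ?thesis
      by (rule exI[of _ "bs @ bs'"], rule exI[of _ "E @ E'"])
        (use len run closed E(3) E'(3,4) in auto)
  qed
qed

text \<open>Starting at position \<open>length Q\<close>, the search treats the old vertices as
  found but never expands them. Thus \<open>E\<close> plays the role of the component of
  \<open>x\<close> in \<open>H - set Q\<close>.\<close>

lemma bfs_complete:
  assumes "finite H" "distinct Q" "x \<notin> set Q" "x \<in> H" "\<And>u. incidences es u \<le> \<Delta>"
  obtains bs E where "length bs \<le> \<Delta> * length E"
    "\<And>rest. bfs es (length Q) (Q @ [x], bs @ rest) = (Q @ E, rest)" "x \<in> set E" "set E \<subseteq> H"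
    "distinct (Q @ E)" "\<And>u y. u \<in> set E \<Longrightarrow> y \<in> H \<Longrightarrow> adjacent es u y \<Longrightarrow> y \<in> set (Q @ E)"
proof -
  have "distinct (Q @ [x])" "length Q \<le> length (Q @ [x])" using assms(2,3) by auto
  from bfs_complete_aux[OF assms(1) this assms(5)] obtain bs E where
    *: "length bs \<le> \<Delta> * (length (Q @ [x]) + length E - length Q)"
    "\<And>rest. bfs es (length Q) (Q @ [x], bs @ rest) = ((Q @ [x]) @ E, rest)" "set E \<subseteq> H" "distinct ((Q @ [x]) @ E)"
    "\<forall>u\<in>set (drop (length Q) ((Q @ [x]) @ E)). \<forall>e\<in>set es. other_end u e \<in> H \<longrightarrow> other_end u e \<in> set ((Q @ [x]) @ E)"
    by blast
  show ?thesis
  proof (rule that[of bs "x # E"])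
    fix u y assume uy: "u \<in> set (x # E)" "y \<in> H" "adjacent es u y"
    from adjacent_other_end[OF uy(3)] show "y \<in> set (Q @ x # E)"
      using *(5) uy by auto
  qed (use * assms in auto)
qed

section \<open>Satisfied vertices and the gain of a set\<close>

definition satisfied :: "(nat \<times> nat) list \<Rightarrow> int \<Rightarrow> nat set \<Rightarrow> nat set" where
  "satisfied es k S = {v \<in> S. k \<le> int (card {u \<in> S. (u, v) \<in> set es})}"

lemma satisfied_mono: "finite T \<Longrightarrow> S \<subseteq> T \<Longrightarrow> satisfied es k S \<subseteq> satisfied es k T"
proof
  fix v assume T: "finite T" "S \<subseteq> T" "v \<in> satisfied es k S"
  have "card {u \<in> S. (u, v) \<in> set es} \<le> card {u \<in> T. (u, v) \<in> set es}"
    using T by (intro card_mono) auto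
  then show "v \<in> satisfied es k T" using T by (auto simp: satisfied_def)
qed

abbreviation gain :: "(nat \<times> nat) list \<Rightarrow> int \<Rightarrow> nat set \<Rightarrow> nat" where
  "gain es k S \<equiv> card (satisfied es k S)"

lemma finite_satisfied: "finite S \<Longrightarrow> finite (satisfied es k S)"
  by (simp add: satisfied_def)

text \<open>Without arcs across, all in-neighbours of a vertex lie on its own side.\<close>

lemma gain_split:
  assumes "finite X" "finite Y" "X \<inter> Y = {}" "\<And>x y. x \<in> X \<Longrightarrow> y \<in> Y \<Longrightarrow> \<not> adjacent es x y"
  shows "gain es k (X \<union> Y) \<le> gain es k X + gain es k Y"
proof -
  have "satisfied es k (X \<union> Y) \<subseteq> satisfied es k X \<union> satisfied es k Y"
  proof
    fix v assume v: "v \<in> satisfied es k (X \<union> Y)"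
    have "{u \<in> X \<union> Y. (u, v) \<in> set es} = {u \<in> (if v \<in> X then X else Y). (u, v) \<in> set es}"
      using assms(3,4) v by (auto simp: adjacent_def satisfied_def)
    then show "v \<in> satisfied es k X \<union> satisfied es k Y" using v
      by (cases "v \<in> X") (auto simp: satisfied_def)
  qed
  then have "gain es k (X \<union> Y) \<le> card (satisfied es k X \<union> satisfied es k Y)"
    using assms by (intro card_mono) (auto simp: finite_satisfied)
  also have "\<dots> \<le> gain es k X + gain es k Y" by (rule card_Un_le)
  finally show ?thesis .
qed

text \<open>Arcs between \<open>X\<close> and \<open>Y\<close> are allowed here, as they only raise
  in-degrees. This is why a set exchanged into \<open>H\<close> may touch what remains of
  \<open>H\<close>.\<close>

lemma gain_superadditive:
  assumes "finite X" "finite Y" "X \<inter> Y = {}"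
  shows "gain es k X + gain es k Y \<le> gain es k (X \<union> Y)"
proof -
  have "gain es k X + gain es k Y = card (satisfied es k X \<union> satisfied es k Y)"
    using assms by (subst card_Un_disjoint) (auto simp: finite_satisfied satisfied_def)
  also have "\<dots> \<le> gain es k (X \<union> Y)"
    using assms by (intro card_mono finite_satisfied Un_least satisfied_mono) auto
  finally show ?thesis .
qed

section \<open>Unary numbers and bit strings\<close>

fun unary :: "bool list \<Rightarrow> nat \<times> bool list" where
  "unary [] = (0, [])"
| "unary (b # bs) = (if b then (Suc (fst (unary bs)), snd (unary bs)) else (0, bs))"

lemma unary_length: "fst (unary bs) + length (snd (unary bs)) \<le> length bs"
  by (induction bs) auto

lemma unary_replicate_False: "fst (unary (replicate r False)) = 0"
  by (cases r) auto

fun bits :: "nat \<Rightarrow> nat \<Rightarrow> bool list" where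
  "bits 0 w = []"
| "bits (Suc N) w = (2 ^ N \<le> w) # bits N (if 2 ^ N \<le> w then w - 2 ^ N else w)"

lemma length_bits [simp]: "length (bits N w) = N"
  by (induction N arbitrary: w) auto

lemma bits_surj: "\<exists>w < 2 ^ length bs. bits (length bs) w = bs"
proof (induction bs)
  case (Cons b bs)
  then obtain w where w: "w < 2 ^ length bs" "bits (length bs) w = bs" by auto
  show ?case
    by (rule exI[of _ "w + (if b then 2 ^ length bs else 0)"]) (use w in auto)
qed simp

lemma bits_prefix:
  assumes "length bs \<le> N"
  obtains w where "w < 2 ^ N" "bits N w = bs @ replicate (N - length bs) False"
  using bits_surj[of "bs @ replicate (N - length bs) False"] assms by auto

section \<open>The best connected extension of a given size\<close>

definition decode :: "(nat \<times> nat) list \<Rightarrow> nat \<Rightarrow> nat list \<Rightarrow> nat \<Rightarrow> nat \<Rightarrow> nat list" where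
  "decode es N Q v w = fst (bfs es (length Q) (Q @ [v], bits N w))"

text \<open>The gain is that of the whole list, old vertices included, because the new vertices may
  have arcs to and from them. Gains are nonnegative, so the initial value -1 survives only if no
  candidate has the required size.\<close>

definition improve ::
  "(nat \<times> nat) list \<Rightarrow> int \<Rightarrow> nat \<Rightarrow> nat list \<Rightarrow> nat \<Rightarrow> nat \<times> nat \<Rightarrow> int \<times> nat \<times> nat \<Rightarrow> int \<times> nat \<times> nat" where
  "improve es k N Q s c acc =
    (let R = decode es N Q (fst c) (snd c)
     in if length R = length Q + s \<and> fst acc < int (gain es k (set R))
        then (int (gain es k (set R)), c) else acc)"

text \<open>A list and not a set, so that the fold breaks ties exactly as the two nested loops of
  the program do.\<close>

definition candidates :: "nat \<Rightarrow> nat list \<Rightarrow> nat \<Rightarrow> (nat \<times> nat) list" where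
  "candidates N Q n = concat (map (\<lambda>v. if v \<in> set Q then [] else map (Pair v) [0..<2 ^ N]) [0..<n])"

definition best :: "(nat \<times> nat) list \<Rightarrow> int \<Rightarrow> nat \<Rightarrow> nat \<Rightarrow> nat list \<Rightarrow> nat \<Rightarrow> int \<times> nat \<times> nat" where
  "best es k N n Q s = fold (improve es k N Q s) (candidates N Q n) (-1, 0, 0)"

lemma fold_improve:
  fixes es k N Q s cs
  defines "acc \<equiv> fold (improve es k N Q s) cs (-1, 0, 0)"
  defines "R \<equiv> \<lambda>c. decode es N Q (fst c) (snd c)"
  shows "(fst acc = -1 \<or> snd acc \<in> set cs \<and> length (R (snd acc)) = length Q + s
      \<and> fst acc = int (gain es k (set (R (snd acc))))) \<and>
    -1 \<le> fst acc \<and>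
    (\<forall>c\<in>set cs. length (R c) = length Q + s \<longrightarrow> int (gain es k (set (R c))) \<le> fst acc)"
  unfolding acc_def R_def
proof (induction cs rule: rev_induct)
  case (snoc c cs)
  then show ?case
    by (auto simp: improve_def Let_def)
qed simp

lemma set_candidates: "set (candidates N Q n) = ({..<n} - set Q) \<times> {..<2 ^ N}"
proof -
  have "c \<in> set (candidates N Q n) \<longleftrightarrow> fst c < n \<and> fst c \<notin> set Q \<and> snd c < 2 ^ N" for c
    by (cases c) (force simp: candidates_def)
  then show ?thesis by auto
qed

lemma best_cases:
  assumes "best es k N n Q s = (g, v, w)"
  shows "g = -1 \<or> v < n \<and> v \<notin> set Q \<and> w < 2 ^ N \<and> length (decode es N Q v w) = length Q + s
    \<and> g = int (gain es k (set (decode es N Q v w)))"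
  using fold_improve[of es k N Q s "candidates N Q n"] assms
  by (auto simp: best_def set_candidates)

lemma best_upper:
  assumes "best es k N n Q s = (g, v, w)" "v' < n" "v' \<notin> set Q" "w' < 2 ^ N"
    "length (decode es N Q v' w') = length Q + s"
  shows "int (gain es k (set (decode es N Q v' w'))) \<le> g"
  using fold_improve[of es k N Q s "candidates N Q n"] assms
  by (auto simp: best_def set_candidates)

text \<open>A position that is too large falls back to 0. Hence every bit string names a vertex of
  the chosen set and none has to be rejected.\<close>

definition "next_vertex es N Q s v w i = decode es N Q v w ! (length Q + (if i < s then i else 0))"

lemma explore_tape: "length (snd (explore es u st)) \<le> length (snd st)"
  unfolding explore_def
proof (induction es arbitrary: st)
  case (Cons e es)
  have "length (snd (offer (other_end u e) st)) \<le> length (snd st)" by (simp add: offer_def)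
  then show ?case using Cons[of "offer (other_end u e) st"] by simp
qed simp

lemma bfs_tape: "length (snd (bfs es i st)) \<le> length (snd st)"
proof (induction es i st rule: bfs.induct)
  case (1 es i st)
  then show ?case using explore_tape[of es "fst st ! i" st] by (subst bfs.simps) fastforce
qed

section \<open>The construction in rounds\<close>

function rounds :: "(nat \<times> nat) list \<Rightarrow> int \<Rightarrow> nat \<Rightarrow> nat \<Rightarrow> nat \<Rightarrow> nat list \<times> bool list \<Rightarrow> nat list" where
  "rounds es k N n s st =
    (case best es k N n (fst st) s of (g, v, w) \<Rightarrow>
     if s = 0 \<or> g < 0 then fst st
     else (case unary (snd st) of (i, bs1) \<Rightarrow>
       (case bfs es (length (fst st)) (fst st @ [next_vertex es N (fst st) s v w i], bs1) of (Q', bs2) \<Rightarrow>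
       (case unary bs2 of (s', bs3) \<Rightarrow> rounds es k N n s' (Q', bs3)))))"
  by auto
termination
\<comment> \<open>If \<open>s'\<close> is positive, at least one bit was consumed in reading it. If
  \<open>s'\<close> is 0, no further round follows and the measure is 0.\<close>
proof (relation "measure (\<lambda>(es, k, N, n, s, st). if s = 0 then 0 else Suc (length (snd st)))", goal_cases)
  case (2 es k N n s st g c v w i bs1 Q' bs2 s' bs3)
  have "length bs1 \<le> length (snd st)" using unary_length[of "snd st"] 2
    by (metis add_leD2 snd_conv)
  moreover have "length bs2 \<le> length bs1"
    using bfs_tape[of es "length (fst st)" "(fst st @ [next_vertex es N (fst st) s v w i], bs1)"] 2
    by (metis snd_conv)
  moreover have "s' + length bs3 \<le> length bs2" using unary_length[of bs2] 2
    by (metis fst_conv snd_conv)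
  ultimately show ?case using 2 by auto
qed simp

declare rounds.simps [simp del]

text \<open>The search only appends, so \<open>Q\<close> is a prefix of the list and the start
  vertex \<open>v\<close> comes right after it. That \<open>v\<close> is position 0 of
  \<open>C\<close> is used when an exchange has to name it.\<close>

lemma decode_best:
  assumes "best es k N n Q s = (g, v, w)" "0 \<le> g" "set es \<subseteq> {..<n} \<times> {..<n}"
    "distinct Q" "set Q \<subseteq> {..<n}" "0 < s"
  obtains C where "decode es N Q v w = Q @ C" "length C = s" "distinct (Q @ C)" "set C \<subseteq> {..<n}"
    "v \<in> set C" "\<And>i. next_vertex es N Q s v w i = C ! (if i < s then i else 0)"
    "g = int (gain es k (set Q \<union> set C))" "v = C ! 0" "w < 2 ^ N"
proof -
  have b: "v < n" "v \<notin> set Q" "w < 2 ^ N" "length (decode es N Q v w) = length Q + s"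
     "g = int (gain es k (set (decode es N Q v w)))"
    using best_cases[OF assms(1)] assms(2) by auto
  have "distinct (decode es N Q v w) \<and> set (decode es N Q v w) \<subseteq> {..<n} \<and>
    (\<exists>E. decode es N Q v w = (Q @ [v]) @ E)"
    using bfs_invariant[of "(Q @ [v], bits N w)" "{..<n}" es "length Q"] assms(3-5) b(1,2)
    by (simp add: decode_def)
  then obtain E where E: "decode es N Q v w = Q @ (v # E)" "distinct (Q @ v # E)" "set (v # E) \<subseteq> {..<n}"
    by auto
  show ?thesis
    by (rule that[of "v # E"]) (use E b assms(6) in \<open>auto simp: next_vertex_def\<close>)
qed

text \<open>This holds for every tape, however badly guessed, so that a test of size and gain is
  enough to certify the outcome.\<close>

lemma rounds_sound:
  assumes "set es \<subseteq> {..<n} \<times> {..<n}" "distinct (fst st)" "set (fst st) \<subseteq> {..<n}"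
  shows "distinct (rounds es k N n s st) \<and> set (rounds es k N n s st) \<subseteq> {..<n}"
  using assms
proof (induction es k N n s st rule: rounds.induct)
  case (1 es k N n s st)
  obtain Q bs where st: "st = (Q, bs)" by (cases st)
  obtain g v w where b: "best es k N n Q s = (g, v, w)" by (cases "best es k N n Q s")
  show ?case
  proof (cases "s = 0 \<or> g < 0")
    case True
    then show ?thesis using b st "1.prems" by (simp add: rounds.simps)
  next
    case False
    obtain i bs1 where u1: "unary bs = (i, bs1)" by (cases "unary bs")
    let ?x = "next_vertex es N Q s v w i"
    obtain Q' bs2 where b2: "bfs es (length Q) (Q @ [?x], bs1) = (Q', bs2)"
      by (cases "bfs es (length Q) (Q @ [?x], bs1)")
    obtain s' bs3 where u2: "unary bs2 = (s', bs3)" by (cases "unary bs2")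
    have "0 \<le> g" "0 < s" using False by auto
    then obtain C where C: "length C = s" "distinct (Q @ C)" "set C \<subseteq> {..<n}"
      "\<And>i. next_vertex es N Q s v w i = C ! (if i < s then i else 0)"
      using decode_best[OF b] "1.prems" st by (metis fst_conv)
    have x: "?x \<in> set C" using C False by simp
    then have "?x \<notin> set Q" "?x < n" using C by auto
    then have "distinct Q' \<and> set Q' \<subseteq> {..<n}"
      using bfs_invariant[of "(Q @ [?x], bs1)" "{..<n}" es "length Q"] "1.prems" st b2
      by simp
    then have "distinct (rounds es k N n s' (Q', bs3)) \<and> set (rounds es k N n s' (Q', bs3)) \<subseteq> {..<n}"
      using "1.IH"[of g "(v, w)" v w i bs1 Q' bs2 s' bs3] b b2 u1 u2 st False "1.prems" by simp
    then show ?thesis using b b2 u1 u2 st False by (subst (1 2) rounds.simps) simp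
  qed
qed

lemma unary_append:
  "unary (replicate i True @ False # bs) = (i, bs)"
  by (induction i) auto

text \<open>
  The exchange step. Let \<open>s\<close> be the least size of a component \<open>D\<close> of \<open>H - Q\<close>, and \<open>C\<close> a set of
  size \<open>s\<close> with the largest gain. If \<open>C\<close> avoids \<open>H\<close>, replacing \<open>D\<close> by \<open>C\<close> loses nothing, so one may
  assume that some vertex of \<open>C\<close> lies in \<open>H\<close>. Naming \<open>s\<close> and this vertex in unary takes at most
  \<open>2 s + 1\<close> bits, which the component of that vertex, of size \<open>t \<ge> s\<close>, pays for together with
  its own \<open>\<Delta> t\<close> search bits.
\<close>

lemma rounds_complete:
  assumes V: "set es \<subseteq> {..<n} \<times> {..<n}" and deg: "\<And>u. incidences es u \<le> \<Delta>" and N: "\<Delta> * p \<le> N"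
  shows "distinct Q \<Longrightarrow> set Q \<subseteq> H \<Longrightarrow> H \<subseteq> {..<n} \<Longrightarrow> card H \<le> p \<Longrightarrow>
    (\<And>x y. x \<in> set Q \<Longrightarrow> y \<in> H - set Q \<Longrightarrow> \<not> adjacent es x y) \<Longrightarrow>
    \<exists>bs. length bs \<le> (\<Delta> + 3) * (card H - length Q) \<and>
      (\<forall>r s bs'. unary (bs @ replicate r False) = (s, bs') \<longrightarrow>
        gain es k H \<le> gain es k (set (rounds es k N n s (Q, bs'))) \<and>
        length (rounds es k N n s (Q, bs')) \<le> card H)"
proof (induction "card H - length Q" arbitrary: Q H rule: less_induct)
  case less
  have finH: "finite H" using less.prems finite_subset by blast
  show ?case
  proof (cases "H = set Q")
    case True
    \<comment> \<open>A tape of zeros reads as size 0, which ends the rounds; the empty description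
      therefore suffices once \<open>Q\<close> exhausts \<open>H\<close>.\<close>
    have "rounds es k N n 0 (Q, bs') = Q" for bs'
      by (cases "best es k N n Q 0") (simp add: rounds.simps)
    moreover have "unary (replicate r False) = (s, bs') \<Longrightarrow> s = 0" for r s bs'
      using unary_replicate_False[of r] by simp
    ultimately have "gain es k H \<le> gain es k (set (rounds es k N n s (Q, bs'))) \<and>
        length (rounds es k N n s (Q, bs')) \<le> card H"
      if "unary ([] @ replicate r False) = (s, bs')" for r s bs'
      using that True less.prems(1) by (metis append_Nil distinct_card order_refl)
    then show ?thesis by (intro exI[of _ "[]"]) auto
  next
    case False
    \<comment> \<open>A pair with \<open>comp v\<close> consists of search bits and of the component
      of \<open>v\<close> in \<open>H - set Q\<close> that these bits make the search find.\<close>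
    define comp where "comp v = (\<lambda>(bs, E). length bs \<le> \<Delta> * length E \<and>
      (\<forall>rest. bfs es (length Q) (Q @ [v], bs @ rest) = (Q @ E, rest)) \<and> v \<in> set E \<and> set E \<subseteq> H \<and>
      distinct (Q @ E) \<and> (\<forall>u\<in>set E. \<forall>y\<in>H. adjacent es u y \<longrightarrow> y \<in> set (Q @ E)))" for v
    have ex_comp: "\<exists>c. comp v c" if v: "v \<in> H - set Q" for v
    proof -
      obtain bs E where "length bs \<le> \<Delta> * length E"
        "\<And>rest. bfs es (length Q) (Q @ [v], bs @ rest) = (Q @ E, rest)" "v \<in> set E" "set E \<subseteq> H"
        "distinct (Q @ E)" "\<And>u y. u \<in> set E \<Longrightarrow> y \<in> H \<Longrightarrow> adjacent es u y \<Longrightarrow> y \<in> set (Q @ E)"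
        using bfs_complete[of H Q v es \<Delta>] finH less.prems(1) deg v by blast
      then show ?thesis by (intro exI[of _ "(bs, E)"]) (auto simp: comp_def)
    qed
    define P where "P t \<longleftrightarrow> (\<exists>v bs E. v \<in> H - set Q \<and> comp v (bs, E) \<and> length E = t)" for t
    define s where "s = (LEAST t. P t)"
    obtain v0 where "v0 \<in> H - set Q" using False less.prems(2) by auto
    then have "\<exists>t. P t" using ex_comp unfolding P_def by (metis surj_pair)
    then have "P s" unfolding s_def by (rule LeastI_ex)
    have s_le: "s \<le> length E" if "v \<in> H - set Q" "comp v (bs, E)" for v bs E
      unfolding s_def by (rule Least_le) (use that in \<open>auto simp: P_def\<close>)
    from \<open>P s\<close> obtain vD bsD D where vD: "vD \<in> H - set Q" "comp vD (bsD, D)" "length D = s"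
      by (auto simp: P_def)
    note D = vD(2)[unfolded comp_def prod.case]
    have s0: "0 < s" using D vD(3) by auto
    have cardQ: "card (set Q) = length Q" using less.prems(1) distinct_card by blast
    have cardD: "card (set D) = s" using D vD(3) distinct_card by auto
    \<comment> \<open>This is where \<open>N\<close> must be at least \<open>\<Delta> * p\<close>:
      the bits describing the smallest component, padded with zeros, are among the strings tried by
      \<open>best\<close>.\<close>
    have "s \<le> p" using card_mono[OF finH, of "set D"] D cardD less.prems(4) by simp
    then have "length bsD \<le> N" using D vD(3) N by (meson le_trans mult_le_mono2)
    then obtain wD where wD: "wD < 2 ^ N" "bits N wD = bsD @ replicate (N - length bsD) False"
      by (rule bits_prefix)
    have decD: "decode es N Q vD wD = Q @ D" using D wD by (simp add: decode_def)
    obtain g v w where best: "best es k N n Q s = (g, v, w)" by (cases "best es k N n Q s")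
    have gD: "int (gain es k (set Q \<union> set D)) \<le> g"
      using best_upper[OF best, of vD wD] vD less.prems wD decD by auto
    then have "0 \<le> g" by linarith
    from decode_best[OF best this V less.prems(1) _ s0] less.prems obtain C where
      C: "decode es N Q v w = Q @ C" "length C = s" "distinct (Q @ C)" "set C \<subseteq> {..<n}"
      "\<And>i. next_vertex es N Q s v w i = C ! (if i < s then i else 0)"
      "g = int (gain es k (set Q \<union> set C))" "v = C ! 0" "w < 2 ^ N"
      by (metis subset_trans)
    have gC: "gain es k (set Q \<union> set D) \<le> gain es k (set Q \<union> set C)" using gD C(6) by linarith
    \<comment> \<open>Both cases end alike. Some \<open>H'\<close> of the same size as
      \<open>H\<close> and of no smaller gain has a component \<open>E\<close> described by a search
      from position \<open>i\<close> of \<open>C\<close>, and the induction hypothesis is applied to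
      \<open>Q @ E\<close>. If \<open>C\<close> meets \<open>H\<close>, then \<open>H'\<close> is
      \<open>H\<close> itself.\<close>
    have fin: "\<exists>bs. length bs \<le> (\<Delta> + 3) * (card H - length Q) \<and>
      (\<forall>r s bs'. unary (bs @ replicate r False) = (s, bs') \<longrightarrow>
        gain es k H \<le> gain es k (set (rounds es k N n s (Q, bs'))) \<and>
        length (rounds es k N n s (Q, bs')) \<le> card H)"
      if H': "set Q \<subseteq> H'" "H' \<subseteq> {..<n}" "card H' = card H" "gain es k H \<le> gain es k H'"
        and i: "i < s" and E: "length bsE \<le> \<Delta> * length E"
          "\<And>rest. bfs es (length Q) (Q @ [C ! i], bsE @ rest) = (Q @ E, rest)"
          "set E \<subseteq> H'" "distinct (Q @ E)" "s \<le> length E"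
        and nonadj: "\<And>x y. x \<in> set (Q @ E) \<Longrightarrow> y \<in> H' - set (Q @ E) \<Longrightarrow> \<not> adjacent es x y"
      for H' i bsE E
    proof -
      have finH': "finite H'" using H' finite_subset by blast
      have le: "length Q + length E \<le> card H"
        using card_mono[OF finH', of "set (Q @ E)"] E H' distinct_card[OF E(4)] by simp
      have "card H' - length (Q @ E) < card H - length Q"
        using le E s0 H'(3) by simp
      from less.hyps[OF this E(4) _ H'(2) _ nonadj] H' E(3) less.prems(4)
      obtain bs where bs: "length bs \<le> (\<Delta> + 3) * (card H - length (Q @ E))"
        "\<And>r s bs'. unary (bs @ replicate r False) = (s, bs') \<Longrightarrow>
          gain es k H' \<le> gain es k (set (rounds es k N n s (Q @ E, bs'))) \<and>
          length (rounds es k N n s (Q @ E, bs')) \<le> card H"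
        by auto
      \<comment> \<open>The parts appear in the order of reading: size, position, search bits, later
        rounds. As \<open>i < s\<close> and \<open>s \<le> length E\<close>, the two numbers and
        their end marks take \<open>s + i + 2 \<le> 3 * length E\<close> bits, which explains the 3
        in \<open>\<Delta> + 3\<close>.\<close>
      define w' where "w' = replicate s True @ False # replicate i True @ False # bsE @ bs"
      have "length w' \<le> (\<Delta> + 3) * length E + (\<Delta> + 3) * (card H - length (Q @ E))"
        using bs(1) E(1,5) i s0 by (simp add: w'_def algebra_simps)
      also have "\<dots> = (\<Delta> + 3) * (length E + (card H - length (Q @ E)))" by (simp add: algebra_simps)
      also have "length E + (card H - length (Q @ E)) = card H - length Q" using le by simp
      finally have len: "length w' \<le> (\<Delta> + 3) * (card H - length Q)" .
      have "gain es k H \<le> gain es k (set (rounds es k N n s' (Q, bs'))) \<and>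
          length (rounds es k N n s' (Q, bs')) \<le> card H"
        if u: "unary (w' @ replicate r False) = (s', bs')" for r s' bs'
      proof -
        have "s' = s" and bs': "bs' = replicate i True @ False # (bsE @ (bs @ replicate r False))"
          using u unary_append[of s "replicate i True @ False # (bsE @ (bs @ replicate r False))"]
          by (auto simp: w'_def)
        obtain s2 bs2 where u2: "unary (bs @ replicate r False) = (s2, bs2)"
          by (cases "unary (bs @ replicate r False)")
        have "rounds es k N n s (Q, bs') = rounds es k N n s2 (Q @ E, bs2)"
          using best \<open>0 \<le> g\<close> s0 i C(5)
          by (subst rounds.simps) (simp add: bs' unary_append E(2) u2)
        then show ?thesis using bs(2)[OF u2] H'(4) \<open>s' = s\<close> by simp
      qed
      then show ?thesis using len by blast
    qed
    show ?thesis
    proof (cases "set C \<inter> H = {}")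
      case False
      then obtain i where i: "i < s" "C ! i \<in> H" using C(2) by (metis disjoint_iff in_set_conv_nth)
      then have "C ! i \<in> H - set Q" using C(2,3) by auto
      with ex_comp obtain bsE E where cE: "comp (C ! i) (bsE, E)" by (metis surj_pair)
      note E = cE[unfolded comp_def prod.case]
      show ?thesis
      proof (rule fin[of H i bsE E])
        fix x y assume "x \<in> set (Q @ E)" "y \<in> H - set (Q @ E)"
        then show "\<not> adjacent es x y" using less.prems(5)[of x y] E by auto
      qed (use less.prems i E s_le[OF \<open>C ! i \<in> H - set Q\<close> cE] in auto)
    next
      case True
      define H' where "H' = (H - set D) \<union> set C"
      have finH': "finite H'" using finH by (simp add: H'_def)
      have QD: "set Q \<inter> set D = {}" and QC: "set Q \<inter> set C = {}" using D C(3) by auto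
      have cardH': "card H' = card H"
      proof -
        have "card H' = card (H - set D) + card (set C)"
          unfolding H'_def using True finH by (intro card_Un_disjoint) auto
        also have "card (set C) = card (set D)" using C(2,3) cardD distinct_card by auto
        also have "card (H - set D) + card (set D) = card H"
          using D finH by (metis List.finite_set card_Diff_subset card_mono le_add_diff_inverse2)
        finally show ?thesis .
      qed
      \<comment> \<open>\<open>R\<close> is what \<open>H\<close> keeps outside \<open>Q\<close> and
        \<open>D\<close>. No arc joins it to \<open>Q\<close> or \<open>D\<close>, so the gain of
        \<open>H\<close> splits. Once \<open>C\<close> has replaced \<open>D\<close> there may be
        arcs to \<open>R\<close>, and then superadditivity is the inequality that is
        required.\<close>
      define R where "R = H - set D - set Q"
      have "gain es k H \<le> gain es k (set Q \<union> set D) + gain es k R"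
      proof -
        have "H = (set Q \<union> set D) \<union> R" using less.prems(2) D by (auto simp: R_def)
        moreover have "gain es k ((set Q \<union> set D) \<union> R) \<le> gain es k (set Q \<union> set D) + gain es k R"
        proof (rule gain_split)
          fix x y assume "x \<in> set Q \<union> set D" "y \<in> R"
          then show "\<not> adjacent es x y" using less.prems(5)[of x y] D by (auto simp: R_def)
        qed (use finH in \<open>auto simp: R_def\<close>)
        ultimately show ?thesis by simp
      qed
      also have "\<dots> \<le> gain es k (set Q \<union> set C) + gain es k R" using gC by simp
      also have "\<dots> \<le> gain es k ((set Q \<union> set C) \<union> R)"
        by (rule gain_superadditive) (use finH True in \<open>auto simp: R_def\<close>)
      also have "(set Q \<union> set C) \<union> R = H'" using less.prems(2) QD by (auto simp: R_def H'_def)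
      finally have gH': "gain es k H \<le> gain es k H'" .
      have vC: "v \<in> set C" using C(2,7) s0 by simp
      then have "v \<notin> set Q" "v \<in> H'" using QC by (auto simp: H'_def)
      then obtain bsE E where E: "length bsE \<le> \<Delta> * length E"
        "\<And>rest. bfs es (length Q) (Q @ [v], bsE @ rest) = (Q @ E, rest)" "v \<in> set E" "set E \<subseteq> H'"
        "distinct (Q @ E)" "\<And>u y. u \<in> set E \<Longrightarrow> y \<in> H' \<Longrightarrow> adjacent es u y \<Longrightarrow> y \<in> set (Q @ E)"
        using bfs_complete[OF finH' less.prems(1) _ _ deg, of v] by blast
      \<comment> \<open>\<open>C\<close> may be adjacent to \<open>Q\<close>, which is forbidden for
        the part of the target set still to be built. Since \<open>C\<close> is reached from
        \<open>v\<close> without leaving \<open>C\<close>, the component \<open>E\<close> of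
        \<open>v\<close> in \<open>H' - set Q\<close> swallows it, and the separation holds again
        for \<open>Q @ E\<close>. The inclusion also yields \<open>s \<le> length E\<close>, which
        pays for the two numbers.\<close>
      have "set C \<subseteq> set E"
      proof -
        let ?B = "bfs es (length Q) (Q @ [v], bits N w)"
        have B: "fst ?B = Q @ C" using C(1) by (simp add: decode_def)
        have "set (drop (length Q) (fst ?B)) \<subseteq> set E"
        proof (rule bfs_connected)
          fix u y assume "u \<in> set E" "y \<in> set (drop (length Q) (fst ?B))" "adjacent es u y"
          then have "y \<in> set (Q @ E)" "y \<in> set C" using E(6)[of u y] B by (auto simp: H'_def)
          then show "y \<in> set E" using QC by auto
        qed (use E \<open>v \<notin> set Q\<close> less.prems(1) in auto)
        then show ?thesis using B by simp
      qed
      then have "s \<le> length E" using C(2,3) E(5)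
        by (metis List.finite_set card_mono distinct_append distinct_card)
      show ?thesis
      proof (rule fin[of H' 0 bsE E])
        fix x y assume xy: "x \<in> set (Q @ E)" "y \<in> H' - set (Q @ E)"
        then have "y \<in> H - set Q" using \<open>set C \<subseteq> set E\<close> by (auto simp: H'_def)
        then show "\<not> adjacent es x y" using xy less.prems(5)[of x y] E(6)[of x y] by auto
      next
        show "set Q \<subseteq> H'" using less.prems(2) QD by (auto simp: H'_def)
      next
        show "H' \<subseteq> {..<n}" using less.prems(3) C(4) by (auto simp: H'_def)
      qed (use cardH' gH' s0 E \<open>s \<le> length E\<close> C(7) in auto)
    qed
  qed
qed

section \<open>Timed execution and the program\<close>

text \<open>A total correctness triple with a time bound. As \<open>exec\<close> is deterministic,
  the run that it provides is the only one.\<close>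

definition runs :: "com \<Rightarrow> memory \<Rightarrow> nat \<Rightarrow> (memory \<Rightarrow> bool) \<Rightarrow> bool" where
  "runs c s T P \<longleftrightarrow> (\<exists>t s'. exec c s t s' \<and> t \<le> T \<and> P s')"

text \<open>Loop-free code is executed symbolically by the simplifier through \<open>effect\<close>
  and \<open>cost\<close>, so that invariants are needed only for loops.\<close>

fun straight :: "com \<Rightarrow> bool" where
  "straight (WhilePos e c) = False"
| "straight (Seq c1 c2) = (straight c1 \<and> straight c2)"
| "straight (IfPos e c1 c2) = (straight c1 \<and> straight c2)"
| "straight _ = True"

primrec effect :: "com \<Rightarrow> memory \<Rightarrow> memory" where
  "effect Skip = (\<lambda>s. s)"
| "effect (Store a e) = (\<lambda>s. s(aval a s := aval e s))"
| "effect (Seq c1 c2) = (\<lambda>s. effect c2 (effect c1 s))"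
| "effect (IfPos e c1 c2) = (\<lambda>s. if 0 < aval e s then effect c1 s else effect c2 s)"
| "effect (WhilePos e c) = (\<lambda>s. s)"

text \<open>Both branches of a conditional are added up instead of compared; the result is still a
  constant bound, and it simplifies to a numeral.\<close>

fun cost :: "com \<Rightarrow> nat" where
  "cost Skip = 1"
| "cost (Store a e) = 1 + acost a + acost e"
| "cost (Seq c1 c2) = cost c1 + cost c2"
| "cost (IfPos e c1 c2) = 1 + acost e + cost c1 + cost c2"
| "cost (WhilePos e c) = 0"

lemma exec_straight: "straight c \<Longrightarrow> \<exists>t\<le>cost c. exec c s t (effect c s)"
proof (induction c arbitrary: s)
  case (Seq c1 c2)
  then obtain t1 t2 where "t1 \<le> cost c1" "exec c1 s t1 (effect c1 s)"
    "t2 \<le> cost c2" "exec c2 (effect c1 s) t2 (effect c2 (effect c1 s))" by fastforce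
  then show ?case by (intro exI[of _ "t1 + t2"]) (auto intro: exec.Seq)
next
  case (IfPos e c1 c2)
  show ?case
  proof (cases "0 < aval e s")
    case True
    from IfPos obtain t where "t \<le> cost c1" "exec c1 s t (effect c1 s)" by fastforce
    then show ?thesis using True exec.IfTrue[of e s c1 t "effect c1 s" c2]
      by (intro exI[of _ "1 + acost e + t"]) auto
  next
    case False
    from IfPos obtain t where "t \<le> cost c2" "exec c2 s t (effect c2 s)" by fastforce
    then show ?thesis using False exec.IfFalse[of e s c2 t "effect c2 s" c1]
      by (intro exI[of _ "1 + acost e + t"]) auto
  qed
next
  case (Store a e)
  have "effect (Store a e) s = s(aval a s := aval e s)" by simp
  then show ?case using exec.Store[of a e s] by (metis cost.simps(2) order_refl)
next
  case Skip
  show ?case using exec.Skip[of s] by auto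
qed simp

lemma runs_straight: "straight c \<Longrightarrow> cost c \<le> T \<Longrightarrow> P (effect c s) \<Longrightarrow> runs c s T P"
  using exec_straight[of c s] unfolding runs_def by (meson le_trans)

lemma runs_mono: "runs c s T P \<Longrightarrow> T \<le> T' \<Longrightarrow> (\<And>s'. P s' \<Longrightarrow> P' s') \<Longrightarrow> runs c s T' P'"
  unfolding runs_def by (meson le_trans)

lemma runs_Seq:
  "runs c1 s S M \<Longrightarrow> (\<And>s1. M s1 \<Longrightarrow> runs c2 s1 U P) \<Longrightarrow> S + U \<le> T \<Longrightarrow> runs (Seq c1 c2) s T P"
  unfolding runs_def by (meson Seq add_le_mono le_trans)

lemma runs_straight_Seq:
  assumes "straight c1" "runs c2 (effect c1 s) U P" "cost c1 + U \<le> T"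
  shows "runs (Seq c1 c2) s T P"
  by (rule runs_Seq[OF runs_straight[where P="\<lambda>s'. s' = effect c1 s"]]) (use assms in auto)

lemma runs_If:
  assumes "0 < aval e s \<Longrightarrow> runs c1 s T' P" "\<not> 0 < aval e s \<Longrightarrow> runs c2 s T' P" "1 + acost e + T' \<le> T"
  shows "runs (IfPos e c1 c2) s T P"
proof (cases "0 < aval e s")
  case True
  with assms(1) obtain t s' where "exec c1 s t s'" "t \<le> T'" "P s'" by (auto simp: runs_def)
  with exec.IfTrue[OF True this(1)] assms(3) show ?thesis unfolding runs_def
    by (meson add_le_mono le_refl le_trans)
next
  case False
  with assms(2) obtain t s' where "exec c2 s t s'" "t \<le> T'" "P s'" by (auto simp: runs_def)
  with exec.IfFalse[OF False this(1)] assms(3) show ?thesis unfolding runs_def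
    by (meson add_le_mono le_refl le_trans)
qed

text \<open>\<open>f\<close> is fuel, an upper bound on the iterations left. This suits loops whose
  number of iterations depends on the tape.\<close>

lemma runs_While:
  assumes "I f s"
    and step: "\<And>f s. I f s \<Longrightarrow> 0 < aval e s \<Longrightarrow> 0 < f \<and> runs c s B (I (f - 1))"
    and final: "\<And>f s. I f s \<Longrightarrow> \<not> 0 < aval e s \<Longrightarrow> P s"
    and T: "(f + 1) * (1 + acost e + B) \<le> T"
  shows "runs (WhilePos e c) s T P"
proof -
  have "\<exists>t s'. exec (WhilePos e c) s t s' \<and> t \<le> f * (1 + acost e + B) + 1 + acost e \<and> P s'"
    using assms(1)
  proof (induction f arbitrary: s)
    case 0
    then have "\<not> 0 < aval e s" using step by blast
    with 0 show ?case using exec.WhileFalse[of e s c]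
      by (intro exI[of _ "1 + acost e"] exI[of _ s]) (auto intro: final)
  next
    case (Suc f)
    show ?case
    proof (cases "0 < aval e s")
      case True
      with step[OF Suc.prems True] obtain t1 s1 where 1: "exec c s t1 s1" "t1 \<le> B" "I f s1"
        by (auto simp: runs_def)
      from Suc.IH[OF 1(3)] obtain t2 s2 where 2: "exec (WhilePos e c) s1 t2 s2"
        "t2 \<le> f * (1 + acost e + B) + 1 + acost e" "P s2" by blast
      show ?thesis
        by (intro exI[of _ "1 + acost e + t1 + t2"] exI[of _ s2] conjI exec.WhileTrue[OF True 1(1) 2(1)])
          (use 1 2 in auto)
    next
      case False
      with Suc.prems show ?thesis using exec.WhileFalse[of e s c]
        by (intro exI[of _ "1 + acost e"] exI[of _ s]) (auto intro: final)
    qed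
  qed
  then obtain t s' where "exec (WhilePos e c) s t s'" "t \<le> f * (1 + acost e + B) + 1 + acost e" "P s'"
    by blast
  moreover have "f * (1 + acost e + B) + 1 + acost e \<le> T" using T by simp
  ultimately show ?thesis unfolding runs_def by (meson le_trans)
qed

text \<open>For loops with a known number of iterations: the fuel is \<open>n - i\<close> for a
  counter \<open>i\<close> running upwards.\<close>

lemma runs_for:
  assumes "I 0 s"
    and step: "\<And>i s. i < n \<Longrightarrow> I i s \<Longrightarrow> 0 < aval e s \<and> runs c s B (I (Suc i))"
    and final: "\<And>s. I n s \<Longrightarrow> \<not> 0 < aval e s" "\<And>s. I n s \<Longrightarrow> P s"
    and T: "(n + 1) * (1 + acost e + B) \<le> T"
  shows "runs (WhilePos e c) s T P"
proof (rule runs_While[where I="\<lambda>f s. f \<le> n \<and> I (n - f) s" and f=n and B=B])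
  fix f s assume I: "f \<le> n \<and> I (n - f) s" and e: "0 < aval e s"
  then have "f > 0" using final(1)[of s] by (cases f) auto
  moreover have "runs c s B (I (Suc (n - f)))" using step[of "n - f" s] I \<open>f > 0\<close> by auto
  ultimately show "0 < f \<and> runs c s B (\<lambda>s. f - 1 \<le> n \<and> I (n - (f - 1)) s)"
    using I by (auto simp: Suc_diff_le elim!: runs_mono)
next
  fix f s assume I: "f \<le> n \<and> I (n - f) s" and e: "\<not> 0 < aval e s"
  then have "f = 0" using step[of "n - f" s] by (cases f) auto
  then show "P s" using I final by simp
qed (use assms in auto)

text \<open>
  Program variables live at small negative addresses, and the array of found vertices grows
  downwards from address \<open>-100\<close>; the input cells stay untouched until the answer is written.
\<close>

abbreviation "vQ \<equiv> -1 :: int"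
abbreviation "vW \<equiv> -2 :: int"
abbreviation "vM \<equiv> -3 :: int"
abbreviation "vB \<equiv> -4 :: int"
abbreviation "vF \<equiv> -5 :: int"
abbreviation "vR \<equiv> -6 :: int"
abbreviation "vX \<equiv> -7 :: int"
abbreviation "vI \<equiv> -8 :: int"
abbreviation "vJ \<equiv> -9 :: int"
abbreviation "vU \<equiv> -10 :: int"
abbreviation "vG \<equiv> -11 :: int"
abbreviation "vC \<equiv> -12 :: int"
abbreviation "vH \<equiv> -13 :: int"
abbreviation "vK \<equiv> -14 :: int"
abbreviation "vS \<equiv> -15 :: int"
abbreviation "vO \<equiv> -16 :: int"
abbreviation "vV \<equiv> -17 :: int"
abbreviation "vT \<equiv> -18 :: int"
abbreviation "vBG \<equiv> -19 :: int"
abbreviation "vBV \<equiv> -20 :: int"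
abbreviation "vBT \<equiv> -21 :: int"
abbreviation "vMW \<equiv> -22 :: int"
abbreviation "vWW \<equiv> -23 :: int"
abbreviation "vA \<equiv> -24 :: int"
abbreviation "vD \<equiv> -25 :: int"

abbreviation val :: "int \<Rightarrow> aexp" where "val x \<equiv> Cell (Const x)"
abbreviation assign :: "int \<Rightarrow> aexp \<Rightarrow> com" (infix "::=" 61) where "x ::= e \<equiv> Store (Const x) e"
abbreviation seq_com :: "com \<Rightarrow> com \<Rightarrow> com" (infixr ";;" 60) where "c ;; d \<equiv> Seq c d"
abbreviation incr :: "int \<Rightarrow> com" where "incr x \<equiv> x ::= Add (val x) (Const 1)"
text \<open>The machine tests only for positivity, so equality takes two tests.\<close>

abbreviation if_eq :: "aexp \<Rightarrow> aexp \<Rightarrow> com \<Rightarrow> com" where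
  "if_eq e1 e2 c \<equiv> IfPos (Sub e1 e2) Skip (IfPos (Sub e2 e1) Skip c)"
abbreviation slot :: "aexp \<Rightarrow> aexp" where "slot e \<equiv> Sub (Const (-100)) e"
abbreviation arc_tail :: aexp where "arc_tail \<equiv> Cell (Add (Const 5) (Add (val vJ) (val vJ)))"
abbreviation arc_head :: aexp where "arc_head \<equiv> Cell (Add (Const 6) (Add (val vJ) (val vJ)))"

text \<open>
  A tape of at most \<open>N\<close> bits is the binary fraction \<open>vW / vM\<close> with \<open>vM = 2 ^ N\<close>, so that the next
  bit is the carry of a doubling and no division is needed.
\<close>

definition read_prog :: com where
  "read_prog = (vW ::= Add (val vW) (val vW) ;;
     IfPos (Add (Sub (val vW) (val vM)) (Const 1))
       (vW ::= Sub (val vW) (val vM) ;; vB ::= Const 1) (vB ::= Const 0))"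

definition unary_prog :: com where
  "unary_prog = (vK ::= Const 0 ;; read_prog ;; WhilePos (val vB) (incr vK ;; read_prog))"

definition mem_prog :: com where
  "mem_prog = (vF ::= Const 0 ;; vR ::= Const 0 ;;
     WhilePos (Sub (val vQ) (val vR))
       (if_eq (Cell (slot (val vR))) (val vX) (vF ::= Const 1) ;; incr vR))"

definition push_prog :: "aexp \<Rightarrow> com" where
  "push_prog e = (Store (slot (val vQ)) e ;; incr vQ)"

definition offer_prog :: com where
  "offer_prog = (mem_prog ;;
     IfPos (val vF) Skip (read_prog ;; IfPos (val vB) (push_prog (val vX)) Skip))"

definition explore_prog :: com where
  "explore_prog = (vJ ::= Const 0 ;;
     WhilePos (Sub (val 1) (val vJ))
       ((vX ::= val vU ;; if_eq arc_tail (val vU) (vX ::= arc_head) ;;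
         if_eq arc_head (val vU) (vX ::= arc_tail)) ;; offer_prog ;; incr vJ))"

definition bfs_prog :: com where
  "bfs_prog = WhilePos (Sub (val vQ) (val vI))
     (vU ::= Cell (slot (val vI)) ;; explore_prog ;; incr vI)"

definition gain_prog :: com where
  "gain_prog = ((vG ::= Const 0 ;; vH ::= Const 0) ;;
     WhilePos (Sub (val vQ) (val vH))
       ((vU ::= Cell (slot (val vH)) ;; vC ::= Const 0 ;; vJ ::= Const 0) ;;
        WhilePos (Sub (val 1) (val vJ))
          (vX ::= arc_tail ;; mem_prog ;;
           if_eq arc_head (val vU) (IfPos (val vF) (incr vC) Skip) ;; incr vJ) ;;
        IfPos (Add (Sub (val vC) (val 3)) (Const 1)) (incr vG) Skip ;; incr vH))"

definition start_prog :: "aexp \<Rightarrow> com" where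
  "start_prog e = (vQ ::= val vO ;; push_prog e ;; vI ::= val vO)"

definition try_prog :: com where
  "try_prog = ((start_prog (val vV) ;; vW ::= val vT) ;; bfs_prog ;; 
     if_eq (val vQ) (Add (val vO) (val vS))
       (gain_prog ;; IfPos (Sub (val vG) (val vBG))
          (vBG ::= val vG ;; vBV ::= val vV ;; vBT ::= val vT) Skip) ;; incr vT)"

text \<open>Every trial overwrites the array beyond \<open>Q\<close>; the cell \<open>vO\<close>
  keeps the length of \<open>Q\<close>, to which each trial returns.\<close>

definition search_prog :: com where
  "search_prog = ((vBG ::= Const (-1) ;; vBV ::= Const 0 ;; vBT ::= Const 0 ;;
       vV ::= Const 0 ;; vO ::= val vQ) ;;
     WhilePos (Sub (val 0) (val vV))
       ((vQ ::= val vO ;; vX ::= val vV) ;; mem_prog ;;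
        IfPos (val vF) Skip (vT ::= Const 0 ;; WhilePos (Sub (val vM) (val vT)) try_prog) ;;
        incr vV))"

text \<open>The search for the best set destroys the tape cell and leaves behind only the name of
  the winner, a start vertex and a guess. Hence the tape is saved in \<open>vMW\<close>, the winning
  set is rebuilt by a second search, and just its vertex at the guessed position is kept as the new
  start vertex.\<close>

definition round_prog :: com where
  "round_prog = (vMW ::= val vW ;; search_prog ;;
     IfPos (Add (val vBG) (Const 1))
       ((start_prog (val vBV) ;; vW ::= val vBT) ;; bfs_prog ;; vW ::= val vMW ;; unary_prog ;;
        (IfPos (Sub (val vS) (val vK)) Skip (vK ::= Const 0) ;;
         start_prog (Cell (slot (Add (val vO) (val vK))))) ;;
        bfs_prog ;; unary_prog ;; vS ::= val vK)
       (vQ ::= val vO ;; vS ::= Const 0 ;; vW ::= Const 0))"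

definition simulate_prog :: com where
  "simulate_prog = ((vQ ::= Const 0 ;; vW ::= val vWW) ;; unary_prog ;; vS ::= val vK ;;
     WhilePos (val vS) round_prog ;; gain_prog ;;
     IfPos (Sub (val vQ) (val 4)) Skip
       (IfPos (Sub (Sub (val 4) (val 2)) (val vG)) Skip (vA ::= Const 1)) ;; incr vWW)"

text \<open>The encoded instance does not contain \<open>\<Delta>\<close>; the program determines
  the maximum degree itself, as the string length depends on it.\<close>

definition degree_prog :: com where
  "degree_prog = (vV ::= Const 0 ;;
     WhilePos (Sub (val 0) (val vV))
       ((vC ::= Const 0 ;; vJ ::= Const 0) ;;
        WhilePos (Sub (val 1) (val vJ))
          (if_eq arc_tail (val vV) (incr vC) ;; if_eq arc_head (val vV) (incr vC) ;; incr vJ) ;;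
        IfPos (Sub (val vC) (val vD)) (vD ::= val vC) Skip ;; incr vV))"

text \<open>Three doublings inside a double loop produce \<open>2 ^ (3 * (D + 1) * p)\<close> on a
  machine without multiplication.\<close>

definition power_prog :: com where
  "power_prog = ((vM ::= Const 1 ;; vI ::= Const 0) ;;
     WhilePos (Sub (val 4) (val vI))
       (vJ ::= Const 0 ;;
        WhilePos (Sub (Add (val vD) (Const 1)) (val vJ))
          (vM ::= Add (val vM) (val vM) ;; vM ::= Add (val vM) (val vM) ;;
           vM ::= Add (val vM) (val vM) ;; incr vJ) ;;
        incr vI))"

definition main_prog :: com where
  "main_prog = (degree_prog ;; power_prog ;;
     WhilePos (Sub (val vM) (val vWW)) simulate_prog ;;
     IfPos (Sub (val 4) (val 0)) (Store (Const 0) (Const 0)) (Store (Const 0) (val vA)))"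

text \<open>Addresses from \<open>-100\<close> downwards are left unconstrained.\<close>

definition same :: "int set \<Rightarrow> memory \<Rightarrow> memory \<Rightarrow> bool" where
  "same X s s' \<longleftrightarrow> (\<forall>a. -100 < a \<longrightarrow> a \<notin> X \<longrightarrow> s' a = s a)"

lemma same_refl [simp]: "same X s s"
  by (simp add: same_def)

lemma same_trans: "same X s s1 \<Longrightarrow> same Y s1 s2 \<Longrightarrow> X \<subseteq> Z \<Longrightarrow> Y \<subseteq> Z \<Longrightarrow> same Z s s2"
  unfolding same_def by (metis subsetD)

lemma same_mono: "same X s s' \<Longrightarrow> X \<subseteq> Y \<Longrightarrow> same Y s s'"
  by (auto simp: same_def)

lemma same_upd: "same X s s1 \<Longrightarrow> a \<in> X \<or> a \<le> -100 \<Longrightarrow> same X s (s1(a := v))"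
  by (auto simp: same_def)

lemma same_get: "same X s s' \<Longrightarrow> -100 < a \<Longrightarrow> a \<notin> X \<Longrightarrow> s' a = s a"
  by (simp add: same_def)

text \<open>Kept apart from \<open>queue\<close>, because the stored prefix outlives changes of the
  length cell and writes beyond its end.\<close>

definition array :: "memory \<Rightarrow> nat list \<Rightarrow> bool" where
  "array s Q \<longleftrightarrow> (\<forall>r<length Q. s (-100 - int r) = int (Q ! r))"

definition queue :: "memory \<Rightarrow> nat list \<Rightarrow> bool" where
  "queue s Q \<longleftrightarrow> s vQ = int (length Q) \<and> array s Q"

lemma array_upd [simp]: "-100 < a \<Longrightarrow> array (s(a := v)) Q = array s Q"
  by (auto simp: array_def)

lemma queue_upd [simp]: "-100 < a \<Longrightarrow> a \<noteq> vQ \<Longrightarrow> queue (s(a := v)) Q = queue s Q"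
  by (auto simp: queue_def)

lemma array_append: "array s (Q @ E) \<Longrightarrow> array s Q"
  by (auto simp: array_def nth_append)

lemma array_snoc: "array s Q \<Longrightarrow> array (s(-100 - int (length Q) := int x)) (Q @ [x])"
  by (auto simp: array_def nth_append less_Suc_eq)

section \<open>The tape as a binary fraction\<close>

fun code :: "nat \<Rightarrow> bool list \<Rightarrow> int" where
  "code N [] = 0"
| "code N (b # bs) = (if b then 2 ^ (N - 1) else 0) + code (N - 1) bs"

text \<open>At most \<open>N\<close> bits leave the last of \<open>N + 1\<close> places empty, so a
  shift by one place is a doubling.\<close>

lemma code_double: "length bs \<le> N \<Longrightarrow> code (Suc N) bs = 2 * code N bs"
proof (induction bs arbitrary: N)
  case (Cons b bs)
  then obtain N' where N': "N = Suc N'" by (cases N) auto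
  then show ?case using Cons.IH[of N'] Cons.prems by simp
qed simp

lemma code_bounds: "length bs \<le> N \<Longrightarrow> 0 \<le> code N bs \<and> code N bs < 2 ^ N"
proof (induction bs arbitrary: N)
  case (Cons b bs)
  then obtain N' where N': "N = Suc N'" by (cases N) auto
  then show ?case using Cons.IH[of N'] Cons.prems by auto
qed simp

lemma code_bits: "w < 2 ^ N \<Longrightarrow> code N (bits N w) = int w"
proof (induction N arbitrary: w)
  case (Suc N)
  show ?case
  proof (cases "2 ^ N \<le> w")
    case True
    then have "code N (bits N (w - 2 ^ N)) = int w - int (2 ^ N)"
      using Suc.IH[of "w - 2 ^ N"] Suc.prems by (simp only: of_nat_diff) simp
    then show ?thesis using True by simp
  qed (use Suc.IH[of w] in simp)
qed simp

definition tape :: "nat \<Rightarrow> memory \<Rightarrow> bool list \<Rightarrow> bool" where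
  "tape N s bs \<longleftrightarrow> length bs \<le> N \<and> s vW = code N bs"

lemma tape_upd [simp]: "a \<noteq> vW \<Longrightarrow> tape N (s(a := v)) bs = tape N s bs"
  by (auto simp: tape_def)

lemma straight_read [simp]: "straight read_prog" by (simp add: read_prog_def)
lemma cost_read [simp]: "cost read_prog = 28" by (simp add: read_prog_def)

lemma effect_read:
  assumes "tape N s bs" "s vM = 2 ^ N"
  shows "effect read_prog s = s(vW := code N (tl bs), vB := of_bool (bs \<noteq> [] \<and> hd bs))"
proof (cases bs)
  case Nil
  moreover have "\<not> (2::int) ^ N < 1" by (simp add: not_less)
  ultimately show ?thesis using assms by (auto simp: read_prog_def tape_def)
next
  case (Cons b bs')
  then obtain N' where N': "N = Suc N'" using assms by (cases N) (auto simp: tape_def)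
  \<comment> \<open>Doubling raises the weight of the leading bit to \<open>2 ^ N\<close>, while the
    other bits together stay below that value. Comparing with \<open>vM\<close> thus reveals the
    bit, and subtracting removes it.\<close>
  have "code N bs' = 2 * code N' bs'" using Cons assms N' by (auto simp: tape_def intro!: code_double)
  moreover have "0 \<le> code N' bs'" "code N' bs' < 2 ^ N'" using code_bounds[of bs' N'] Cons assms N'
    by (auto simp: tape_def)
  moreover have "s vW + s vW = (if b then 2 ^ N else 0) + 2 * code N' bs'"
    using Cons assms N' by (simp add: tape_def)
  ultimately have sum: "s vW + s vW = (if b then 2 ^ N else 0) + code N bs'"
    and "0 < s vW + s vW - 2 ^ N + 1 \<longleftrightarrow> b"
    using N' by auto
  then have "effect read_prog s = s(vW := code N bs', vB := of_bool b)"
    using assms(2) by (cases b) (simp_all add: read_prog_def)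
  then show ?thesis using Cons by simp
qed

lemma runs_unary:
  assumes "tape N s bs" "s vM = 2 ^ N"
  shows "runs unary_prog s (60 * (N + 2)) (\<lambda>s'. s' vK = int (fst (unary bs)) \<and> tape N s' (snd (unary bs)) \<and>
    (\<forall>a. a \<notin> {vK, vW, vB} \<longrightarrow> s' a = s a))"
proof -
  define s1 where "s1 = s(vK := 0)"
  define s2 where "s2 = s1(vW := code N (tl bs), vB := of_bool (bs \<noteq> [] \<and> hd bs))"
  have rd: "effect read_prog s1 = s2"
    unfolding s2_def by (rule effect_read) (use assms in \<open>auto simp: s1_def\<close>)
  \<comment> \<open>The loop tests a bit that has already been taken off the tape. The invariant
    puts it back in front of the remaining ones.\<close>
  define I where "I f s' \<longleftrightarrow> (\<exists>b bs'. s' vB = of_bool b \<and> tape N s' bs' \<and>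
    s' vK + int (fst (unary (b # bs'))) = int (fst (unary bs)) \<and> snd (unary (b # bs')) = snd (unary bs) \<and>
    length bs' + (if b then 1 else 0) \<le> f \<and> (\<forall>a. a \<notin> {vK, vW, vB} \<longrightarrow> s' a = s a))" for f s'
  show ?thesis unfolding unary_prog_def
  proof (rule runs_straight_Seq, simp, rule runs_straight_Seq, simp,
      rule runs_While[where I=I and f="length bs" and B=40])
    show "I (length bs) (effect read_prog (effect (vK ::= Const 0) s))"
      unfolding I_def
      by (rule exI[of _ "bs \<noteq> [] \<and> hd bs"], rule exI[of _ "tl bs"])
        (use assms rd in \<open>cases bs; auto simp: s1_def s2_def tape_def\<close>)
  next
    fix f s' assume I: "I f s'" and pos: "0 < aval (val vB) s'"
    then obtain bs' where *: "s' vB = 1" "tape N s' bs'"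
      "s' vK + int (fst (unary (True # bs'))) = int (fst (unary bs))" "snd (unary (True # bs')) = snd (unary bs)"
      "length bs' + 1 \<le> f" "\<forall>a. a \<notin> {vK, vW, vB} \<longrightarrow> s' a = s a"
      by (auto simp: I_def of_bool_def split: if_splits)
    let ?s = "s'(vK := s' vK + 1)"
    have rd: "effect read_prog ?s = ?s(vW := code N (tl bs'), vB := of_bool (bs' \<noteq> [] \<and> hd bs'))"
      by (rule effect_read) (use * assms in auto)
    have "runs (incr vK ;; read_prog) s' 40 (I (f - 1))"
      by (rule runs_straight, simp, simp, unfold I_def, rule exI[of _ "bs' \<noteq> [] \<and> hd bs'"], rule exI[of _ "tl bs'"])
        (use * rd in \<open>cases bs'; auto simp: tape_def\<close>)
    then show "0 < f \<and> runs (incr vK ;; read_prog) s' 40 (I (f - 1))" using * by simp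
  next
    fix f s' assume I: "I f s'" and pos: "\<not> 0 < aval (val vB) s'"
    then show "s' vK = int (fst (unary bs)) \<and> tape N s' (snd (unary bs)) \<and> (\<forall>a. a \<notin> {vK, vW, vB} \<longrightarrow> s' a = s a)"
      by (auto simp: I_def of_bool_def split: if_splits)
  next
    show "(length bs + 1) * (1 + acost (val vB) + 40) \<le> 43 * (N + 1)"
      using assms(1) by (auto simp: tape_def)
  qed auto
qed

definition "mem_cost L = 60 * (L + 1 :: nat)"

text \<open>The scan continues after a hit, so its outcome is a fixed update of two cells and can be
  stated as an equation between memories.\<close>

lemma runs_mem:
  assumes "queue s Q" "s vX = int x" "length Q \<le> L"
  shows "runs mem_prog s (mem_cost L) (\<lambda>s'. s' = s(vF := of_bool (x \<in> set Q), vR := int (length Q)))"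
  unfolding mem_prog_def
proof (rule runs_straight_Seq, simp, rule runs_straight_Seq, simp,
    rule runs_for[where I="\<lambda>i s'. s' = s(vF := of_bool (x \<in> set (take i Q)), vR := int i)"
      and n="length Q" and B=30])
  fix i s' assume i: "i < length Q" and s': "s' = s(vF := of_bool (x \<in> set (take i Q)), vR := int i)"
  have "s (-100 - int i) = int (Q ! i)" using assms(1) i by (simp add: queue_def array_def)
  moreover have "-100 - int i \<noteq> vF" "-100 - int i \<noteq> vR" by auto
  moreover have "set (take (Suc i) Q) = insert (Q ! i) (set (take i Q))"
    using i by (simp add: take_Suc_conv_app_nth)
  moreover have "s vQ = int (length Q)" using assms(1) by (simp add: queue_def)
  ultimately have "0 < aval (Sub (val vQ) (val vR)) s'"
    and eff: "effect (if_eq (Cell (slot (val vR))) (val vX) (vF ::= Const 1) ;; incr vR) s' =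
      s(vF := of_bool (x \<in> set (take (Suc i) Q)), vR := int (Suc i))"
    using assms(2) i by (auto simp: s' fun_upd_twist)
  then show "0 < aval (Sub (val vQ) (val vR)) s' \<and>
    runs (if_eq (Cell (slot (val vR))) (val vX) (vF ::= Const 1) ;; incr vR) s' 30
     (\<lambda>s'. s' = s(vF := of_bool (x \<in> set (take (Suc i) Q)), vR := int (Suc i)))"
    by (intro conjI runs_straight) (simp_all only: eff, simp_all)
qed (use assms in \<open>auto simp: queue_def mem_cost_def\<close>)

section \<open>Correctness of the program\<close>

lemma effect_push:
  "queue s Q \<Longrightarrow> aval e s = int x \<Longrightarrow>
    effect (push_prog e) s = s(-100 - int (length Q) := int x, vQ := int (length Q) + 1)"
  by (simp add: push_prog_def queue_def)

lemma straight_push [simp]: "straight (push_prog e)" "cost (push_prog e) = 11 + acost e"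
  by (simp_all add: push_prog_def)

lemma queue_push: "array s Q \<Longrightarrow> queue (s(-100 - int (length Q) := int x, vQ := int (length Q) + 1)) (Q @ [x])"
  by (simp add: queue_def array_snoc)

lemma runs_offer:
  assumes "queue s (fst st)" "tape N s (snd st)" "s vM = 2 ^ N" "s vX = int x" "length (fst st) \<le> L"
  shows "runs offer_prog s (mem_cost L + 60) (\<lambda>s'. same {vF, vR, vW, vB, vQ} s s' \<and>
    queue s' (fst (offer x st)) \<and> tape N s' (snd (offer x st)))"
  unfolding offer_prog_def
proof (rule runs_Seq[OF runs_mem[OF assms(1,4,5)]])
  obtain Q bs where st: "st = (Q, bs)" by (cases st)
  fix s1 assume s1: "s1 = s(vF := of_bool (x \<in> set (fst st)), vR := int (length (fst st)))"
  have q1: "queue s1 Q" and t1: "tape N s1 bs" and x1: "s1 vX = int x" and "s1 vM = 2 ^ N"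
    and f1: "s1 vF = of_bool (x \<in> set Q)" and sm: "same {vF, vR, vW, vB, vQ} s s1"
    using assms st by (simp_all add: s1 same_upd)
  define s2 where "s2 = s1(vW := code N (tl bs), vB := of_bool (bs \<noteq> [] \<and> hd bs))"
  have rd: "effect read_prog s1 = s2"
    unfolding s2_def using t1 \<open>s1 vM = 2 ^ N\<close> by (rule effect_read)
  have q2: "queue s2 Q" and x2: "s2 vX = int x" and b2: "s2 vB = of_bool (bs \<noteq> [] \<and> hd bs)"
    and sm2: "same {vF, vR, vW, vB, vQ} s s2" and t2: "tape N s2 (tl bs)"
    using q1 x1 sm t1 by (auto simp: s2_def same_upd tape_def)
  let ?s3 = "s2(-100 - int (length Q) := int x, vQ := int (length Q) + 1)"
  have psh: "effect (push_prog (val vX)) s2 = ?s3"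
    using q2 x2 by (intro effect_push) simp_all
  have q3: "queue ?s3 (Q @ [x])" using q2 by (intro queue_push) (simp add: queue_def)
  let ?c = "IfPos (val vF) Skip (read_prog ;; IfPos (val vB) (push_prog (val vX)) Skip)"
  have eff: "effect ?c s1 = (if x \<in> set Q then s1 else if bs \<noteq> [] \<and> hd bs then ?s3 else s2)"
    using f1 b2 by (simp add: rd psh)
  have "same {vF, vR, vW, vB, vQ} s (effect ?c s1) \<and>
    queue (effect ?c s1) (fst (offer x st)) \<and> tape N (effect ?c s1) (snd (offer x st))"
    unfolding eff using q1 q2 q3 sm sm2 t1 t2 by (simp add: st offer_def same_upd)
  then show "runs ?c s1 60 (\<lambda>s'. same {vF, vR, vW, vB, vQ} s s' \<and>
    queue s' (fst (offer x st)) \<and> tape N s' (snd (offer x st)))"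
    by (intro runs_straight) simp_all
qed simp

section \<open>Subroutines on a fixed instance\<close>

locale anchored_core_instance =
  fixes es :: "(nat \<times> nat) list" and n :: nat and b k :: int and p :: nat
  assumes es: "set es \<subseteq> {..<n} \<times> {..<n}" and distinct_es: "distinct es"
begin

definition input :: "memory \<Rightarrow> bool" where
  "input s \<longleftrightarrow> s 0 = int n \<and> s 1 = int (length es) \<and> s 2 = b \<and> s 3 = k \<and> s 4 = int p \<and>
     (\<forall>j<length es. s (5 + (int j + int j)) = int (fst (es ! j)) \<and> s (6 + (int j + int j)) = int (snd (es ! j)))"

text \<open>Variables live at negative addresses and the array lies even lower, so no subroutine
  reaches the input cells.\<close>

lemma input_same: "input s \<Longrightarrow> same X s s' \<Longrightarrow> X \<subseteq> {..<0} \<Longrightarrow> input s'"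
proof -
  assume s: "input s" "same X s s'" "X \<subseteq> {..<0}"
  have "s' a = s a" if "0 \<le> a" for a using s(2,3) that by (intro same_get[of X]) auto
  then show "input s'" using s(1) by (simp add: input_def)
qed

definition ready :: "nat \<Rightarrow> memory \<Rightarrow> bool" where
  "ready N s \<longleftrightarrow> input s \<and> s vM = 2 ^ N"

lemma ready_same: "ready N s \<Longrightarrow> same X s s' \<Longrightarrow> X \<subseteq> {..<0} - {vM} \<Longrightarrow> ready N s'"
  unfolding ready_def using input_same[of s X s'] same_get[of X s s' vM] by auto

abbreviation "explore_vars \<equiv> {vF, vR, vW, vB, vQ, vX, vJ}"
abbreviation "bfs_vars \<equiv> {vF, vR, vW, vB, vQ, vX, vJ, vU, vI}"

definition "arcs_cost L = (length es + 1) * (mem_cost L + 200)"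

text \<open>\<open>L\<close> bounds found vertices and remaining bits together, a sum that no
  \<open>offer\<close> increases. Hence every membership test on the way costs at most
  \<open>mem_cost L\<close>.\<close>

lemma runs_explore:
  assumes "ready N s" "queue s (fst st)" "tape N s (snd st)" "s vU = int u"
    "length (fst st) + length (snd st) \<le> L"
  shows "runs explore_prog s (arcs_cost L + 10) (\<lambda>s'. same explore_vars s s' \<and>
    queue s' (fst (explore es u st)) \<and> tape N s' (snd (explore es u st)))"
proof -
  define state where "state j = explore (take j es) u st" for j
  have len: "length (fst (state j)) \<le> L" for j
    using explore_length[of "take j es" u st] assms(5) by (simp add: state_def)
  define I where "I j s' \<longleftrightarrow> same explore_vars s s' \<and> s' vJ = int j \<and>
    queue s' (fst (state j)) \<and> tape N s' (snd (state j))" for j s'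
  show ?thesis unfolding explore_prog_def
  proof (rule runs_straight_Seq[where U="arcs_cost L"], simp, rule runs_for[where I=I and n="length es" and B="mem_cost L + 160"])
    show "I 0 (effect (vJ ::= Const 0) s)"
      using assms by (simp add: I_def state_def explore_def same_upd)
  next
    fix j s1 assume j: "j < length es" and I: "I j s1"
    then have sm: "same explore_vars s s1" and J: "s1 vJ = int j" and q: "queue s1 (fst (state j))"
      and t: "tape N s1 (snd (state j))" by (simp_all add: I_def)
    have r: "ready N s1" using assms(1) sm by (rule ready_same) simp
    have u1: "s1 vU = int u" using same_get[OF sm, of vU] assms(4) by simp
    let ?e = "es ! j"
    have e: "s1 (5 + (int j + int j)) = int (fst ?e)" "s1 (6 + (int j + int j)) = int (snd ?e)"
      "s1 1 = int (length es)"
      using r j by (simp_all add: ready_def input_def)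
    let ?pre = "vX ::= val vU ;; if_eq arc_tail (val vU) (vX ::= arc_head) ;;
         if_eq arc_head (val vU) (vX ::= arc_tail)"
    let ?s2 = "s1(vX := int (other_end u ?e))"
    have pre: "effect ?pre s1 = ?s2"
      using e u1 J by (simp add: other_end_def)
    have state: "state (Suc j) = offer (other_end u ?e) (state j)"
      using j by (simp add: state_def explore_def take_Suc_conv_app_nth)
    have "runs (?pre ;; offer_prog ;; incr vJ) s1 (mem_cost L + 160) (I (Suc j))"
    proof (rule runs_straight_Seq[where U="mem_cost L + 80"], simp, unfold pre, rule runs_Seq[OF runs_offer[of ?s2 "state j" N "other_end u ?e" L]])
      fix s3 assume s3: "same {vF, vR, vW, vB, vQ} ?s2 s3 \<and>
        queue s3 (fst (offer (other_end u ?e) (state j))) \<and> tape N s3 (snd (offer (other_end u ?e) (state j)))"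
      have "same explore_vars s ?s2" using sm by (rule same_upd) simp
      then have "same explore_vars s s3" by (rule same_trans[OF _ conjunct1[OF s3]]) simp_all
      moreover have "s3 vJ = int j" using same_get[OF conjunct1[OF s3], of vJ] J by simp
      ultimately have "I (Suc j) (s3(vJ := int j + 1))"
        using s3 state by (simp add: I_def same_upd)
      then have "I (Suc j) (effect (incr vJ) s3)" using \<open>s3 vJ = int j\<close> by simp
      then show "runs (incr vJ) s3 10 (I (Suc j))" by (intro runs_straight) simp_all
    qed (use r q t len[of j] in \<open>simp_all add: ready_def\<close>)
    moreover have "0 < aval (Sub (val 1) (val vJ)) s1" using J j e by simp
    ultimately show "0 < aval (Sub (val 1) (val vJ)) s1 \<and>
      runs (?pre ;; offer_prog ;; incr vJ) s1 (mem_cost L + 160) (I (Suc j))" by blast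
  next
    fix s1 assume I: "I (length es) s1"
    then have "ready N s1" using assms(1) by (auto simp: I_def intro: ready_same)
    then show "\<not> 0 < aval (Sub (val 1) (val vJ)) s1" using I by (simp add: I_def ready_def input_def)
    show "same explore_vars s s1 \<and> queue s1 (fst (explore es u st)) \<and> tape N s1 (snd (explore es u st))"
      using I by (simp add: I_def state_def)
  next
    show "(length es + 1) * (1 + acost (Sub (val 1) (val vJ)) + (mem_cost L + 160)) \<le> arcs_cost L"
      unfolding arcs_cost_def by (rule mult_le_mono2) simp
  qed simp_all
qed

definition "bfs_cost L = (L + 1) * (arcs_cost L + 50)"

lemma runs_bfs:
  assumes "ready N s" "queue s (fst st)" "tape N s (snd st)" "s vI = int i"
    "length (fst st) + length (snd st) \<le> L"
  shows "runs bfs_prog s (bfs_cost L) (\<lambda>s'. same bfs_vars s s' \<and>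
    queue s' (fst (bfs es i st)) \<and> tape N s' (snd (bfs es i st)))"
proof -
  \<comment> \<open>The fuel is the termination measure of \<open>bfs\<close>; the remaining search
    always has the same result as the original one.\<close>
  define I where "I f s' \<longleftrightarrow> same bfs_vars s s' \<and> (\<exists>i' st'. s' vI = int i' \<and>
    queue s' (fst st') \<and> tape N s' (snd st') \<and> bfs es i' st' = bfs es i st \<and>
    length (fst st') + length (snd st') \<le> L \<and> length (fst st') + length (snd st') - i' \<le> f)" for f s'
  show ?thesis unfolding bfs_prog_def
  proof (rule runs_While[where I=I and f=L and B="arcs_cost L + 40"])
    show "I L s" unfolding I_def using assms by (intro conjI exI[of _ i] exI[of _ st]) simp_all
  next
    fix f s1 assume I: "I f s1" and pos: "0 < aval (Sub (val vQ) (val vI)) s1"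
    then obtain i' st' where sm: "same bfs_vars s s1" and i': "s1 vI = int i'"
      and q: "queue s1 (fst st')" and t: "tape N s1 (snd st')" and eq: "bfs es i' st' = bfs es i st"
      and len: "length (fst st') + length (snd st') \<le> L" "length (fst st') + length (snd st') - i' \<le> f"
      by (auto simp: I_def)
    have less: "i' < length (fst st')" using pos q i' by (simp add: queue_def)
    let ?u = "fst st' ! i'" and ?pre = "vU ::= Cell (slot (val vI))"
    let ?s2 = "s1(vU := int ?u)" and ?st = "explore es (fst st' ! i') st'"
    have pre: "effect ?pre s1 = ?s2" using q i' less by (simp add: queue_def array_def)
    have r: "ready N s1" using assms(1) sm by (rule ready_same) simp
    have sm2: "same bfs_vars s ?s2" using sm by (rule same_upd) simp
    have r2: "ready N ?s2" using assms(1) sm2 by (rule ready_same) simp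
    have len': "length (fst ?st) + length (snd ?st) \<le> length (fst st') + length (snd st')"
      by (rule explore_length)
    have "runs (?pre ;; explore_prog ;; incr vI) s1 (arcs_cost L + 40) (I (f - 1))"
    proof (rule runs_straight_Seq[where U="arcs_cost L + 20"], simp, unfold pre, rule runs_Seq[OF runs_explore[of N ?s2 st' ?u L]])
      fix s3 assume s3: "same explore_vars ?s2 s3 \<and> queue s3 (fst ?st) \<and> tape N s3 (snd ?st)"
      have "same bfs_vars s s3" using sm2 by (rule same_trans[OF _ conjunct1[OF s3]]) simp_all
      moreover have i3: "s3 vI = int i'" using same_get[OF conjunct1[OF s3], of vI] i' by simp
      moreover have "bfs es (Suc i') ?st = bfs es i st"
        using less eq by (subst (asm) bfs.simps) simp
      moreover have "length (fst ?st) + length (snd ?st) - Suc i' \<le> f - 1" using len' len by linarith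
      ultimately have "I (f - 1) (s3(vI := int i' + 1))"
        unfolding I_def using s3 len' len(1)
        by (intro conjI exI[of _ "Suc i'"] exI[of _ ?st]) (simp_all add: same_upd)
      then have "I (f - 1) (effect (incr vI) s3)" using i3 by simp
      then show "runs (incr vI) s3 10 (I (f - 1))" by (intro runs_straight) simp_all
    qed (use r2 q t len(1) in simp_all)
    moreover have "0 < f" using less len by linarith
    ultimately show "0 < f \<and> runs (?pre ;; explore_prog ;; incr vI) s1 (arcs_cost L + 40) (I (f - 1))" by blast
  next
    fix f s1 assume I: "I f s1" and pos: "\<not> 0 < aval (Sub (val vQ) (val vI)) s1"
    then obtain i' st' where sm: "same bfs_vars s s1" and i': "s1 vI = int i'"
      and q: "queue s1 (fst st')" and t: "tape N s1 (snd st')" and eq: "bfs es i' st' = bfs es i st"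
      by (auto simp: I_def)
    have "\<not> i' < length (fst st')" using pos q i' by (simp add: queue_def)
    then have "bfs es i st = st'" using eq by (subst (asm) bfs.simps) simp
    then show "same bfs_vars s s1 \<and> queue s1 (fst (bfs es i st)) \<and> tape N s1 (snd (bfs es i st))"
      using sm q t by simp
  next
    show "(L + 1) * (1 + acost (Sub (val vQ) (val vI)) + (arcs_cost L + 40)) \<le> bfs_cost L"
      unfolding bfs_cost_def by (rule mult_le_mono2) simp
  qed
qed

abbreviation "gain_vars \<equiv> {vF, vR, vX, vJ, vU, vG, vH, vC}"

text \<open>The program counts entries of the arc list, and these correspond to in-neighbours
  because the list has no repetitions.\<close>

lemma card_in_neighbours:
  "card {a \<in> set Q. (a, v) \<in> set es} = length (filter (\<lambda>e. snd e = v \<and> fst e \<in> set Q) es)"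
proof -
  have "{a \<in> set Q. (a, v) \<in> set es} = fst ` set (filter (\<lambda>e. snd e = v \<and> fst e \<in> set Q) es)"
    by force
  also have "card \<dots> = card (set (filter (\<lambda>e. snd e = v \<and> fst e \<in> set Q) es))"
    by (rule card_image) (auto intro!: inj_onI)
  also have "\<dots> = length (filter (\<lambda>e. snd e = v \<and> fst e \<in> set Q) es)"
    using distinct_es by (intro distinct_card) simp
  finally show ?thesis .
qed

lemma runs_count:
  assumes "input s" "queue s Q" "s vU = int u" "s vC = 0" "s vJ = 0" "length Q \<le> L"
  shows "runs (WhilePos (Sub (val 1) (val vJ))
          (vX ::= arc_tail ;; mem_prog ;;
           if_eq arc_head (val vU) (IfPos (val vF) (incr vC) Skip) ;; incr vJ)) s (arcs_cost L)
     (\<lambda>s'. same {vF, vR, vX, vJ, vC} s s' \<and> queue s' Q \<and>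
       s' vC = int (length (filter (\<lambda>e. snd e = u \<and> fst e \<in> set Q) es)))"
proof -
  define F where "F j = int (length (filter (\<lambda>e. snd e = u \<and> fst e \<in> set Q) (take j es)))" for j
  define I where "I j s' \<longleftrightarrow> same {vF, vR, vX, vJ, vC} s s' \<and> queue s' Q \<and> s' vJ = int j \<and> s' vC = F j"
    for j s'
  show ?thesis
  proof (rule runs_for[where I=I and n="length es" and B="mem_cost L + 100"])
    show "I 0 s" using assms by (simp add: I_def F_def)
  next
    fix j s1 assume j: "j < length es" and I: "I j s1"
    then have sm: "same {vF, vR, vX, vJ, vC} s s1" and q: "queue s1 Q" and J: "s1 vJ = int j"
      and C: "s1 vC = F j" by (simp_all add: I_def)
    have inp: "input s1" using assms(1) sm by (rule input_same) simp
    have u1: "s1 vU = int u" using same_get[OF sm, of vU] assms(3) by simp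
    let ?e = "es ! j"
    have e: "s1 (5 + (int j + int j)) = int (fst ?e)" "s1 (6 + (int j + int j)) = int (snd ?e)"
      "s1 1 = int (length es)"
      using inp j by (simp_all add: input_def)
    have F: "F (Suc j) = F j + (if snd ?e = u \<and> fst ?e \<in> set Q then 1 else 0)"
      using j by (simp add: F_def take_Suc_conv_app_nth)
    let ?s2 = "s1(vX := int (fst ?e))"
    have pre: "effect (vX ::= arc_tail) s1 = ?s2" using e J by simp
    let ?c = "if_eq arc_head (val vU) (IfPos (val vF) (incr vC) Skip) ;; incr vJ"
    have "runs (vX ::= arc_tail ;; mem_prog ;; ?c) s1 (mem_cost L + 100) (I (Suc j))"
    proof (rule runs_straight_Seq[where U="mem_cost L + 60"], simp, unfold pre, rule runs_Seq[OF runs_mem[of ?s2 Q "fst ?e" L]])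
      fix s3 assume s3: "s3 = ?s2(vF := of_bool (fst ?e \<in> set Q), vR := int (length Q))"
      have q3: "queue s3 Q" and J3: "s3 vJ = int j" and C3: "s3 vC = F j" and u3: "s3 vU = int u"
        and f3: "s3 vF = of_bool (fst ?e \<in> set Q)"
        using q J C u1 by (simp_all add: s3)
      have h3: "s3 (6 + (int j + int j)) = int (snd ?e)" using e by (simp add: s3)
      have sm3: "same {vF, vR, vX, vJ, vC} s s3" unfolding s3 using sm by (intro same_upd) simp_all
      have "effect ?c s3 = s3(vC := F (Suc j), vJ := int j + 1)"
        using F C3 u3 f3 h3 J3 by (cases "snd ?e = u"; cases "fst ?e \<in> set Q") (simp_all add: fun_upd_idem)
      moreover have "I (Suc j) (s3(vC := F (Suc j), vJ := int j + 1))"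
        using sm3 q3 by (simp add: I_def same_upd)
      ultimately have "I (Suc j) (effect ?c s3)" by simp
      then show "runs ?c s3 60 (I (Suc j))" by (intro runs_straight) simp_all
    qed (use q assms(6) in simp_all)
    moreover have "0 < aval (Sub (val 1) (val vJ)) s1" using J j e by simp
    ultimately show "0 < aval (Sub (val 1) (val vJ)) s1 \<and>
      runs (vX ::= arc_tail ;; mem_prog ;; ?c) s1 (mem_cost L + 100) (I (Suc j))" by blast
  next
    fix s1 assume I: "I (length es) s1"
    then have "input s1" using assms(1) by (auto simp: I_def intro: input_same)
    then show "\<not> 0 < aval (Sub (val 1) (val vJ)) s1" using I by (simp add: I_def input_def)
    show "same {vF, vR, vX, vJ, vC} s s1 \<and> queue s1 Q \<and>
       s1 vC = int (length (filter (\<lambda>e. snd e = u \<and> fst e \<in> set Q) es))"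
      using I by (simp add: I_def F_def)
  next
    show "(length es + 1) * (1 + acost (Sub (val 1) (val vJ)) + (mem_cost L + 100)) \<le> arcs_cost L"
      unfolding arcs_cost_def by (rule mult_le_mono2) simp
  qed
qed

lemma runs_gain:
  assumes "input s" "queue s Q" "distinct Q" "length Q \<le> L"
  shows "runs gain_prog s (bfs_cost L + 10) (\<lambda>s'. same gain_vars s s' \<and> queue s' Q \<and>
    s' vG = int (gain es k (set Q)))"
proof -
  define sat where "sat v \<longleftrightarrow> k \<le> int (length (filter (\<lambda>e. snd e = v \<and> fst e \<in> set Q) es))" for v
  have gain: "gain es k (set Q) = length (filter sat Q)"
  proof -
    have "satisfied es k (set Q) = set (filter sat Q)"
      by (auto simp: satisfied_def sat_def card_in_neighbours)
    then show ?thesis using assms(3) by (simp add: distinct_card flip: set_filter)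
  qed
  define F where "F h = int (length (filter sat (take h Q)))" for h
  define I where "I h s' \<longleftrightarrow> same gain_vars s s' \<and> queue s' Q \<and> s' vH = int h \<and> s' vG = F h" for h s'
  show ?thesis unfolding gain_prog_def
  proof (rule runs_straight_Seq[where U="bfs_cost L"], simp, rule runs_for[where I=I and n="length Q" and B="arcs_cost L + 40"])
    show "I 0 (effect (vG ::= Const 0 ;; vH ::= Const 0) s)"
      using assms by (simp add: I_def F_def same_upd)
  next
    fix h s1 assume h: "h < length Q" and I: "I h s1"
    then have sm: "same gain_vars s s1" and q: "queue s1 Q" and H: "s1 vH = int h"
      and G: "s1 vG = F h" by (simp_all add: I_def)
    let ?u = "Q ! h"
    let ?s2 = "s1(vU := int ?u, vC := 0, vJ := 0)"
    let ?pre = "vU ::= Cell (slot (val vH)) ;; vC ::= Const 0 ;; vJ ::= Const 0"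
    have pre: "effect ?pre s1 = ?s2" using q H h by (simp add: queue_def array_def)
    have sm2: "same gain_vars s ?s2" using sm by (intro same_upd) simp_all
    have inp2: "input ?s2" using assms(1) sm2 by (rule input_same) simp
    let ?loop = "WhilePos (Sub (val 1) (val vJ))
          (vX ::= arc_tail ;; mem_prog ;;
           if_eq arc_head (val vU) (IfPos (val vF) (incr vC) Skip) ;; incr vJ)"
    let ?c = "IfPos (Add (Sub (val vC) (val 3)) (Const 1)) (incr vG) Skip ;; incr vH"
    have "runs (?pre ;; ?loop ;; ?c) s1 (arcs_cost L + 40) (I (Suc h))"
    proof (rule runs_straight_Seq[where U="arcs_cost L + 25"], simp, unfold pre, rule runs_Seq[OF runs_count[of ?s2 Q ?u L]])
      fix s3 assume s3: "same {vF, vR, vX, vJ, vC} ?s2 s3 \<and> queue s3 Q \<and>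
        s3 vC = int (length (filter (\<lambda>e. snd e = ?u \<and> fst e \<in> set Q) es))"
      have sm3: "same gain_vars s s3" using sm2 by (rule same_trans[OF _ conjunct1[OF s3]]) simp_all
      have H3: "s3 vH = int h" and G3: "s3 vG = F h"
        using same_get[OF conjunct1[OF s3], of vH] same_get[OF conjunct1[OF s3], of vG] H G by simp_all
      have F: "F (Suc h) = F h + (if sat ?u then 1 else 0)"
        using h by (simp add: F_def take_Suc_conv_app_nth)
      have "s3 3 = k" using input_same[OF assms(1) sm3] by (simp add: input_def)
      then have "0 < s3 vC - s3 3 + 1 \<longleftrightarrow> sat ?u" using s3 by (auto simp: sat_def)
      then have "effect ?c s3 = s3(vG := F (Suc h), vH := int h + 1)"
        using H3 G3 F by (cases "sat ?u") (simp_all add: fun_upd_idem)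
      moreover have "I (Suc h) (s3(vG := F (Suc h), vH := int h + 1))"
        using sm3 s3 by (simp add: I_def same_upd)
      ultimately have "I (Suc h) (effect ?c s3)" by simp
      then show "runs ?c s3 25 (I (Suc h))" by (intro runs_straight) simp_all
    qed (use q assms(4) inp2 in simp_all)
    moreover have "0 < aval (Sub (val vQ) (val vH)) s1" using H h q by (simp add: queue_def)
    ultimately show "0 < aval (Sub (val vQ) (val vH)) s1 \<and>
      runs (?pre ;; ?loop ;; ?c) s1 (arcs_cost L + 40) (I (Suc h))" by blast
  next
    fix s1 assume I: "I (length Q) s1"
    then show "\<not> 0 < aval (Sub (val vQ) (val vH)) s1" by (simp add: I_def queue_def)
    show "same gain_vars s s1 \<and> queue s1 Q \<and> s1 vG = int (gain es k (set Q))"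
      using I by (simp add: I_def F_def gain)
  next
    have "(length Q + 1) * (1 + acost (Sub (val vQ) (val vH)) + (arcs_cost L + 40)) \<le>
        bfs_cost L"
      unfolding bfs_cost_def by (rule mult_le_mono) (use assms(4) in simp_all)
    then show "(length Q + 1) * (1 + acost (Sub (val vQ) (val vH)) + (arcs_cost L + 40)) \<le> bfs_cost L" .
  qed simp_all
qed

end

lemma tape_same: "tape N s bs \<Longrightarrow> same X s s' \<Longrightarrow> vW \<notin> X \<Longrightarrow> tape N s' bs"
  by (simp add: tape_def same_def)

lemma queue_prefix: "queue s (Q @ E) \<Longrightarrow> array s Q"
  using array_append[of s Q E] by (simp add: queue_def)

lemma straight_start [simp]: "straight (start_prog e)" "cost (start_prog e) = 19 + acost e"
  by (simp_all add: start_prog_def)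

lemma effect_start:
  assumes "array s Q" "s vO = int (length Q)" "aval e (s(vQ := int (length Q))) = int x"
  shows "queue (effect (start_prog e) s) (Q @ [x])" "effect (start_prog e) s vI = int (length Q)"
    "same {vQ, vI} s (effect (start_prog e) s)"
proof -
  let ?s1 = "s(vQ := int (length Q))"
  let ?s2 = "?s1(-100 - int (length Q) := int x, vQ := int (length Q) + 1)"
  have push: "effect (push_prog e) ?s1 = ?s2"
    by (rule effect_push) (use assms in \<open>simp_all add: queue_def\<close>)
  have "?s2 vO = int (length Q)" using assms(2) by simp
  then have eff: "effect (start_prog e) s = ?s2(vI := int (length Q))"
    unfolding start_prog_def effect.simps aval.simps assms(2) push by (rule arg_cong)
  have "queue ?s2 (Q @ [x])" by (rule queue_push) (use assms(1) in simp)
  then show "queue (effect (start_prog e) s) (Q @ [x])" unfolding eff by simp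
  show "effect (start_prog e) s vI = int (length Q)" unfolding eff by simp
  show "same {vQ, vI} s (effect (start_prog e) s)" unfolding eff by (intro same_upd same_refl) simp_all
qed

lemma runs_if_eq:
  assumes "aval e1 s = aval e2 s \<Longrightarrow> runs c s T' P" "aval e1 s \<noteq> aval e2 s \<Longrightarrow> P s"
    "5 + 2 * acost e1 + 2 * acost e2 + T' \<le> T"
  shows "runs (if_eq e1 e2 c) s T P"
proof (rule runs_If[where T'="3 + acost e1 + acost e2 + T'"])
  assume "0 < aval (Sub e1 e2) s"
  then show "runs Skip s (3 + acost e1 + acost e2 + T') P"
    using assms(2) by (intro runs_straight) simp_all
next
  assume *: "\<not> 0 < aval (Sub e1 e2) s"
  show "runs (IfPos (Sub e2 e1) Skip c) s (3 + acost e1 + acost e2 + T') P"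
  proof (rule runs_If[where T'="T' + 1"])
    assume "0 < aval (Sub e2 e1) s"
    then show "runs Skip s (T' + 1) P" using assms(2) by (intro runs_straight) simp_all
  next
    assume "\<not> 0 < aval (Sub e2 e1) s"
    then have "aval e1 s = aval e2 s" using * by simp
    then show "runs c s (T' + 1) P" by (intro runs_mono[OF assms(1)]) simp_all
  qed simp
qed (use assms(3) in simp)

section \<open>Search for the best extension on the machine\<close>

definition holds :: "memory \<Rightarrow> int \<times> nat \<times> nat \<Rightarrow> bool" where
  "holds s acc \<longleftrightarrow> s vBG = fst acc \<and> s vBV = int (fst (snd acc)) \<and> s vBT = int (snd (snd acc))"

lemma candidates_Suc:
  "candidates N Q (Suc v) = candidates N Q v @ (if v \<in> set Q then [] else map (Pair v) [0..<2 ^ N])"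
  by (simp add: candidates_def)

context anchored_core_instance
begin

abbreviation "try_vars \<equiv> {vF, vR, vW, vB, vQ, vX, vJ, vU, vI, vG, vH, vC, vBG, vBV, vBT, vT}"
abbreviation "search_vars \<equiv> {vF, vR, vW, vB, vQ, vX, vJ, vU, vI, vG, vH, vC, vBG, vBV, vBT, vT, vV, vO}"
abbreviation "round_vars \<equiv> {vF, vR, vW, vB, vQ, vX, vJ, vU, vI, vG, vH, vC, vBG, vBV, vBT, vT, vV, vO, vMW, vK, vS}"

text \<open>The budget covers one guided search and one computation of the gain, both bounded by
  \<open>bfs_cost\<close>.\<close>

lemma runs_try:
  assumes "ready N s" "array s Q" "s vO = int (length Q)" "s vS = int sz" "s vV = int v" "s vT = int w"
    "w < 2 ^ N" "holds s acc" "distinct Q" "v \<notin> set Q" "set Q \<subseteq> {..<n}" "v < n" "length Q + 1 + N \<le> L"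
  shows "runs try_prog s (2 * bfs_cost L + 150) (\<lambda>s'. same try_vars s s' \<and> array s' Q \<and>
    s' vT = int w + 1 \<and> holds s' (improve es k N Q sz (v, w) acc))"
proof -
  define R where "R = decode es N Q v w"
  define st where "st = bfs es (length Q) (Q @ [v], bits N w)"
  have R: "fst st = R" by (simp add: st_def R_def decode_def)
  have "distinct R \<and> set R \<subseteq> {..<n} \<and> (\<exists>E. R = (Q @ [v]) @ E)"
    using bfs_invariant[of "(Q @ [v], bits N w)" "{..<n}" es "length Q"] assms(9-12) es
    by (simp add: R_def decode_def)
  then obtain E where E: "R = Q @ (v # E)" "distinct R" by auto
  have lenR: "length R \<le> L" using bfs_length[of es "length Q" "(Q @ [v], bits N w)"] assms(13) R
    by (simp add: st_def)
  let ?pre = "start_prog (val vV) ;; vW ::= val vT"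
  let ?s0 = "effect (start_prog (val vV)) s"
  define s1 where "s1 = effect ?pre s"
  have 0: "queue ?s0 (Q @ [v])" "?s0 vI = int (length Q)" "same {vQ, vI} s ?s0"
    by (rule effect_start, use assms in simp_all)+
  have "?s0 vT = int w" using same_get[OF 0(3), of vT] assms(6) by simp
  then have s1: "s1 = ?s0(vW := int w)" by (simp add: s1_def)
  have q1: "queue s1 (Q @ [v])" and i1: "s1 vI = int (length Q)" unfolding s1 using 0 by simp_all
  have smb: "same bfs_vars s s1" unfolding s1
    by (intro same_upd same_mono[OF 0(3)]) simp_all
  then have sm1: "same try_vars s s1" by (rule same_mono) simp
  have t1: "tape N s1 (bits N w)" unfolding s1 by (simp add: tape_def code_bits assms(7))
  have r1: "ready N s1" using assms(1) sm1 by (rule ready_same) simp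
  have main: "runs (if_eq (val vQ) (Add (val vO) (val vS))
       (gain_prog ;; IfPos (Sub (val vG) (val vBG))
          (vBG ::= val vG ;; vBV ::= val vV ;; vBT ::= val vT) Skip) ;; incr vT) s2 (bfs_cost L + 80)
     (\<lambda>s'. same try_vars s s' \<and> array s' Q \<and>
    s' vT = int w + 1 \<and> holds s' (improve es k N Q sz (v, w) acc))"
    if s2: "same bfs_vars s1 s2" "queue s2 R" for s2
  proof -
    have sm2: "same try_vars s s2" using sm1 s2(1) by (rule same_trans) simp_all
    have r2: "ready N s2" using assms(1) sm2 by (rule ready_same) simp
    have sm02: "same bfs_vars s s2" using smb s2(1) by (rule same_trans) simp_all
    have v2: "s2 vO = int (length Q)" "s2 vS = int sz" "s2 vV = int v" "s2 vT = int w" "holds s2 acc"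
      using same_get[OF sm02] assms(3-6,8) by (simp_all add: holds_def)
    have a2: "array s2 Q" using s2(2) unfolding E(1) by (rule queue_prefix)
    have vQ2: "s2 vQ = int (length R)" using s2(2) by (simp add: queue_def)
    show ?thesis
    proof (rule runs_Seq[where M="\<lambda>s'. same try_vars s s' \<and> array s' Q \<and>
        s' vT = int w \<and> holds s' (improve es k N Q sz (v, w) acc)" and U=10 and S="bfs_cost L + 70"])
      show "runs (if_eq (val vQ) (Add (val vO) (val vS))
       (gain_prog ;; IfPos (Sub (val vG) (val vBG))
          (vBG ::= val vG ;; vBV ::= val vV ;; vBT ::= val vT) Skip)) s2 (bfs_cost L + 70)
          (\<lambda>s'. same try_vars s s' \<and> array s' Q \<and> s' vT = int w \<and> holds s' (improve es k N Q sz (v, w) acc))"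
      proof (rule runs_if_eq[where T'="bfs_cost L + 45"])
        assume "aval (val vQ) s2 = aval (Add (val vO) (val vS)) s2"
        then have len: "length R = length Q + sz" using vQ2 v2 by simp
        show "runs (gain_prog ;; IfPos (Sub (val vG) (val vBG))
          (vBG ::= val vG ;; vBV ::= val vV ;; vBT ::= val vT) Skip) s2 (bfs_cost L + 45)
           (\<lambda>s'. same try_vars s s' \<and> array s' Q \<and> s' vT = int w \<and> holds s' (improve es k N Q sz (v, w) acc))"
        proof (rule runs_Seq[OF runs_gain[of s2 R L]])
          fix s3 assume "same gain_vars s2 s3 \<and> queue s3 R \<and> s3 vG = int (gain es k (set R))"
          then have s3: "same gain_vars s2 s3" "queue s3 R" "s3 vG = int (gain es k (set R))" by simp_all
          have sm3: "same try_vars s s3" using sm2 s3(1) by (rule same_trans) simp_all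
          have v3: "s3 vV = int v" "s3 vT = int w" "holds s3 acc"
            using same_get[OF s3(1)] v2 by (simp_all add: holds_def)
          have a3: "array s3 Q" using s3(2) unfolding E(1) by (rule queue_prefix)
          let ?c = "IfPos (Sub (val vG) (val vBG)) (vBG ::= val vG ;; vBV ::= val vV ;; vBT ::= val vT) Skip"
          have imp: "improve es k N Q sz (v, w) acc =
              (if fst acc < int (gain es k (set R)) then (int (gain es k (set R)), v, w) else acc)"
            using len by (simp add: improve_def R_def)
          have eff: "effect ?c s3 = (if fst acc < int (gain es k (set R))
              then s3(vBG := int (gain es k (set R)), vBV := int v, vBT := int w) else s3)"
            using v3 s3(3) by (simp add: holds_def)
          have "same try_vars s (effect ?c s3) \<and> array (effect ?c s3) Q \<and> effect ?c s3 vT = int w \<and>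
              holds (effect ?c s3) (improve es k N Q sz (v, w) acc)"
            unfolding eff imp using sm3 a3 v3 by (simp add: same_upd holds_def)
          then show "runs ?c s3 35 (\<lambda>s'. same try_vars s s' \<and> array s' Q \<and> s' vT = int w \<and>
              holds s' (improve es k N Q sz (v, w) acc))"
            by (intro runs_straight) simp_all
        qed (use r2 s2 E lenR in \<open>simp_all add: ready_def\<close>)
      next
        assume "aval (val vQ) s2 \<noteq> aval (Add (val vO) (val vS)) s2"
        then have "length R \<noteq> length Q + sz" using vQ2 v2 by simp
        then have "improve es k N Q sz (v, w) acc = acc" by (simp add: improve_def R_def)
        then show "same try_vars s s2 \<and> array s2 Q \<and> s2 vT = int w \<and> holds s2 (improve es k N Q sz (v, w) acc)"
          using sm2 v2 a2 by simp
      qed simp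
    next
      fix s3 assume "same try_vars s s3 \<and> array s3 Q \<and> s3 vT = int w \<and> holds s3 (improve es k N Q sz (v, w) acc)"
      then show "runs (incr vT) s3 10 (\<lambda>s'. same try_vars s s' \<and> array s' Q \<and>
          s' vT = int w + 1 \<and> holds s' (improve es k N Q sz (v, w) acc))"
        by (intro runs_straight) (simp_all add: same_upd holds_def)
    qed simp
  qed
  show ?thesis unfolding try_prog_def
  proof (rule runs_straight_Seq[where U="2 * bfs_cost L + 80"], simp, fold s1_def,
      rule runs_Seq[OF runs_bfs[of N s1 "(Q @ [v], bits N w)" "length Q" L]])
    fix s2 assume "same bfs_vars s1 s2 \<and> queue s2 (fst (bfs es (length Q) (Q @ [v], bits N w))) \<and>
      tape N s2 (snd (bfs es (length Q) (Q @ [v], bits N w)))"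
    then show "runs (if_eq (val vQ) (Add (val vO) (val vS))
       (gain_prog ;; IfPos (Sub (val vG) (val vBG))
          (vBG ::= val vG ;; vBV ::= val vV ;; vBT ::= val vT) Skip) ;; incr vT) s2 (bfs_cost L + 80)
     (\<lambda>s'. same try_vars s s' \<and> array s' Q \<and>
    s' vT = int w + 1 \<and> holds s' (improve es k N Q sz (v, w) acc))"
      by (intro main) (simp_all add: R_def decode_def)
  qed (use r1 q1 t1 i1 assms(13) in simp_all)
qed

definition "try_loop_cost N L = (2 ^ N + 1) * (2 * bfs_cost L + 160)"
definition "search_cost N L = (n + 1) * (try_loop_cost N L + mem_cost L + 50)"

lemma runs_try_loop:
  assumes "ready N s" "array s Q" "s vO = int (length Q)" "s vS = int sz" "s vV = int v" "s vT = 0"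
    "holds s acc" "distinct Q" "v \<notin> set Q" "set Q \<subseteq> {..<n}" "v < n" "length Q + 1 + N \<le> L"
  shows "runs (WhilePos (Sub (val vM) (val vT)) try_prog) s (try_loop_cost N L) (\<lambda>s'. same try_vars s s' \<and>
    array s' Q \<and> holds s' (fold (improve es k N Q sz) (map (Pair v) [0..<2 ^ N]) acc))"
proof -
  define I where "I w s' \<longleftrightarrow> same try_vars s s' \<and> array s' Q \<and> s' vT = int w \<and>
    holds s' (fold (improve es k N Q sz) (map (Pair v) [0..<w]) acc)" for w s'
  have vM: "s' vM = 2 ^ N" if "same try_vars s s'" for s'
    using assms(1) same_get[OF that, of vM] by (simp add: ready_def)
  show ?thesis
  proof (rule runs_for[where I=I and n="2 ^ N" and B="2 * bfs_cost L + 150"])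
    show "I 0 s" using assms by (simp add: I_def)
  next
    fix w s1 assume w: "w < 2 ^ N" and I: "I w s1"
    then have sm: "same try_vars s s1" and a: "array s1 Q" and T: "s1 vT = int w" and
      h: "holds s1 (fold (improve es k N Q sz) (map (Pair v) [0..<w]) acc)" by (simp_all add: I_def)
    have r: "ready N s1" using assms(1) sm by (rule ready_same) simp
    have "int w < 2 ^ N" using w by simp
    then have pos: "0 < aval (Sub (val vM) (val vT)) s1" using vM[OF sm] T by simp
    have "runs try_prog s1 (2 * bfs_cost L + 150) (I (Suc w))"
    proof (rule runs_mono[OF runs_try[of N s1 Q sz v w _ L]])
      fix s2 assume "same try_vars s1 s2 \<and> array s2 Q \<and> s2 vT = int w + 1 \<and>
        holds s2 (improve es k N Q sz (v, w) (fold (improve es k N Q sz) (map (Pair v) [0..<w]) acc))"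
      then show "I (Suc w) s2" using same_trans[OF sm, of try_vars s2 try_vars] by (simp add: I_def)
    next
      show "s1 vO = int (length Q)" "s1 vS = int sz" "s1 vV = int v"
        using same_get[OF sm] assms(3-5) by simp_all
    qed (use r a T h w assms(8-12) in simp_all)
    with pos show "0 < aval (Sub (val vM) (val vT)) s1 \<and> runs try_prog s1 (2 * bfs_cost L + 150) (I (Suc w))"
      by blast
  next
    fix s1 assume I: "I (2 ^ N) s1"
    then have "s1 vM = 2 ^ N" "s1 vT = 2 ^ N" using vM[of s1] by (simp_all add: I_def)
    then show "\<not> 0 < aval (Sub (val vM) (val vT)) s1" by simp
    show "same try_vars s s1 \<and> array s1 Q \<and>
      holds s1 (fold (improve es k N Q sz) (map (Pair v) [0..<2 ^ N]) acc)"
      using I by (simp add: I_def)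
  next
    show "(2 ^ N + 1) * (1 + acost (Sub (val vM) (val vT)) + (2 * bfs_cost L + 150)) \<le> try_loop_cost N L"
      unfolding try_loop_cost_def by (rule mult_le_mono2) simp
  qed
qed

lemma runs_search:
  assumes "ready N s" "queue s Q" "s vS = int sz" "distinct Q" "set Q \<subseteq> {..<n}" "length Q + 1 + N \<le> L"
  shows "runs search_prog s (search_cost N L + 30) (\<lambda>s'. same search_vars s s' \<and>
    array s' Q \<and> s' vO = int (length Q) \<and> holds s' (best es k N n Q sz))"
proof -
  define acc where "acc v = fold (improve es k N Q sz) (candidates N Q v) (-1, 0, 0)" for v
  define I where "I v s' \<longleftrightarrow> same search_vars s s' \<and> array s' Q \<and> s' vV = int v \<and>
    s' vO = int (length Q) \<and> holds s' (acc v)" for v s'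
  let ?body = "(vQ ::= val vO ;; vX ::= val vV) ;; mem_prog ;;
        IfPos (val vF) Skip (vT ::= Const 0 ;; WhilePos (Sub (val vM) (val vT)) try_prog) ;;
        incr vV"
  show ?thesis unfolding search_prog_def
  proof (rule runs_straight_Seq[where U="search_cost N L"], simp,
      rule runs_for[where I=I and n=n and B="try_loop_cost N L + mem_cost L + 40"])
    let ?pre = "vBG ::= Const (-1) ;; vBV ::= Const 0 ;; vBT ::= Const 0 ;; vV ::= Const 0 ;; vO ::= val vQ"
    show "I 0 (effect ?pre s)"
      using assms by (simp add: I_def acc_def candidates_def holds_def queue_def same_upd)
  next
    fix v s1 assume v: "v < n" and I: "I v s1"
    then have sm: "same search_vars s s1" and a: "array s1 Q" and V: "s1 vV = int v"
      and O: "s1 vO = int (length Q)" and h: "holds s1 (acc v)" by (simp_all add: I_def)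
    have r: "ready N s1" using assms(1) sm by (rule ready_same) simp
    then have pos: "0 < aval (Sub (val 0) (val vV)) s1" using V v by (simp add: ready_def input_def)
    let ?s2 = "s1(vQ := int (length Q), vX := int v)"
    have pre: "effect (vQ ::= val vO ;; vX ::= val vV) s1 = ?s2" using O V by simp
    have "runs ?body s1 (try_loop_cost N L + mem_cost L + 40) (I (Suc v))"
    proof (rule runs_straight_Seq[where U="try_loop_cost N L + mem_cost L + 25"], simp, unfold pre,
        rule runs_Seq[OF runs_mem[of ?s2 Q v L]])
      fix s3 assume s3: "s3 = ?s2(vF := of_bool (v \<in> set Q), vR := int (length Q))"
      have sm3: "same search_vars s s3" unfolding s3 using sm by (intro same_upd) simp_all
      have r3: "ready N s3" using assms(1) sm3 by (rule ready_same) simp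
      have v3: "array s3 Q" "s3 vV = int v" "s3 vO = int (length Q)" "holds s3 (acc v)"
        "s3 vF = of_bool (v \<in> set Q)"
        using a V O h by (simp_all add: s3 holds_def)
      have S3: "s3 vS = int sz" using same_get[OF sm3, of vS] assms(3) by simp
      let ?if = "IfPos (val vF) Skip (vT ::= Const 0 ;; WhilePos (Sub (val vM) (val vT)) try_prog)"
      show "runs (?if ;; incr vV) s3 (try_loop_cost N L + 25) (I (Suc v))"
      proof (rule runs_Seq[where M="\<lambda>s'. same search_vars s s' \<and> array s' Q \<and> s' vV = int v \<and>
          s' vO = int (length Q) \<and> holds s' (acc (Suc v))" and S="try_loop_cost N L + 15" and U=10])
        show "runs ?if s3 (try_loop_cost N L + 15) (\<lambda>s'. same search_vars s s' \<and> array s' Q \<and> s' vV = int v \<and>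
          s' vO = int (length Q) \<and> holds s' (acc (Suc v)))"
        proof (rule runs_If[where T'="try_loop_cost N L + 5"])
          assume "0 < aval (val vF) s3"
          then have "v \<in> set Q" using v3 by (cases "v \<in> set Q") simp_all
          then have "acc (Suc v) = acc v" by (simp add: acc_def candidates_Suc)
          then show "runs Skip s3 (try_loop_cost N L + 5) (\<lambda>s'. same search_vars s s' \<and> array s' Q \<and>
              s' vV = int v \<and> s' vO = int (length Q) \<and> holds s' (acc (Suc v)))"
            using sm3 v3 by (intro runs_straight) simp_all
        next
          assume "\<not> 0 < aval (val vF) s3"
          then have vQ: "v \<notin> set Q" using v3 by (cases "v \<in> set Q") simp_all
          then have acc: "acc (Suc v) = fold (improve es k N Q sz) (map (Pair v) [0..<2 ^ N]) (acc v)"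
            by (simp add: acc_def candidates_Suc)
          let ?s4 = "s3(vT := 0)"
          have sm4: "same search_vars s ?s4" using sm3 by (intro same_upd) simp_all
          have r4: "ready N ?s4" using assms(1) sm4 by (rule ready_same) simp
          have "effect (vT ::= Const 0) s3 = ?s4" by simp
          show "runs (vT ::= Const 0 ;; WhilePos (Sub (val vM) (val vT)) try_prog) s3 (try_loop_cost N L + 5)
              (\<lambda>s'. same search_vars s s' \<and> array s' Q \<and>
              s' vV = int v \<and> s' vO = int (length Q) \<and> holds s' (acc (Suc v)))"
          proof (rule runs_straight_Seq[where U="try_loop_cost N L"], simp, unfold \<open>effect (vT ::= Const 0) s3 = ?s4\<close>,
              rule runs_mono[OF runs_try_loop[of N ?s4 Q sz v "acc v" L]])
            fix s5 assume "same try_vars ?s4 s5 \<and> array s5 Q \<and>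
              holds s5 (fold (improve es k N Q sz) (map (Pair v) [0..<2 ^ N]) (acc v))"
            then have s5: "same try_vars ?s4 s5" "array s5 Q" "holds s5 (acc (Suc v))"
              using acc by simp_all
            show "same search_vars s s5 \<and> array s5 Q \<and> s5 vV = int v \<and> s5 vO = int (length Q) \<and> holds s5 (acc (Suc v))"
              using same_trans[OF sm4 s5(1), of search_vars] s5 same_get[OF s5(1)] v3 by simp
          qed (use r4 v3 S3 vQ v assms in \<open>simp_all add: holds_def\<close>)
        qed simp
      next
        fix s4 assume s4: "same search_vars s s4 \<and> array s4 Q \<and> s4 vV = int v \<and>
          s4 vO = int (length Q) \<and> holds s4 (acc (Suc v))"
        then have "I (Suc v) (s4(vV := int v + 1))" by (simp add: I_def same_upd holds_def)
        then have "I (Suc v) (effect (incr vV) s4)" using s4 by simp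
        then show "runs (incr vV) s4 10 (I (Suc v))" by (intro runs_straight) simp_all
      qed simp
    qed (use a assms(6) in \<open>simp_all add: queue_def\<close>)
    with pos show "0 < aval (Sub (val 0) (val vV)) s1 \<and>
      runs ?body s1 (try_loop_cost N L + mem_cost L + 40) (I (Suc v))" by blast
  next
    fix s1 assume I: "I n s1"
    then have "ready N s1" using assms(1) by (auto simp: I_def intro: ready_same)
    then show "\<not> 0 < aval (Sub (val 0) (val vV)) s1" using I by (simp add: I_def ready_def input_def)
    show "same search_vars s s1 \<and> array s1 Q \<and> s1 vO = int (length Q) \<and> holds s1 (best es k N n Q sz)"
      using I by (simp add: I_def acc_def best_def)
  next
    show "(n + 1) * (1 + acost (Sub (val 0) (val vV)) + (try_loop_cost N L + mem_cost L + 40)) \<le> search_cost N L"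
      unfolding search_cost_def by (rule mult_le_mono2) simp
  qed simp
qed

end

lemma queue_agree: "queue s Q \<Longrightarrow> (\<And>a. a \<le> -100 \<or> a = vQ \<Longrightarrow> s' a = s a) \<Longrightarrow> queue s' Q"
  by (simp add: queue_def array_def)

lemma runs_unary_queue:
  assumes "tape N s bs" "s vM = 2 ^ N" "queue s Q"
  shows "runs unary_prog s (60 * (N + 2)) (\<lambda>s'. same {vK, vW, vB} s s' \<and> queue s' Q \<and>
    s' vK = int (fst (unary bs)) \<and> tape N s' (snd (unary bs)))"
proof (rule runs_mono[OF runs_unary[OF assms(1,2)] order_refl])
  fix s' assume *: "s' vK = int (fst (unary bs)) \<and> tape N s' (snd (unary bs)) \<and>
    (\<forall>a. a \<notin> {vK, vW, vB} \<longrightarrow> s' a = s a)"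
  then have "same {vK, vW, vB} s s'" unfolding same_def by blast
  moreover have "queue s' Q" by (rule queue_agree[OF assms(3)]) (use * in auto)
  ultimately show "same {vK, vW, vB} s s' \<and> queue s' Q \<and>
    s' vK = int (fst (unary bs)) \<and> tape N s' (snd (unary bs))"
    using * by blast
qed

context anchored_core_instance
begin

text \<open>
  Every vertex found is charged to a 1-bit read before; the summand for \<open>sz > 0\<close> is the bit that
  pays for the start vertex of the next round.
\<close>

definition round_state :: "nat \<Rightarrow> nat list \<Rightarrow> nat \<Rightarrow> memory \<Rightarrow> bool" where
  "round_state N R f s \<longleftrightarrow> (\<exists>sz Q bs. s vS = int sz \<and> queue s Q \<and> tape N s bs \<and>
     distinct Q \<and> set Q \<subseteq> {..<n} \<and> rounds es k N n sz (Q, bs) = R \<and>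
     length Q + length bs + (if sz = 0 then 0 else 1) \<le> N \<and>
     (if sz = 0 then 0 else Suc (length bs)) \<le> f)"

text \<open>One search for the best set, two guided searches, of which the first rebuilds that set
  and the second collects the component, and two unary readings.\<close>

definition "round_cost N L = search_cost N L + 2 * bfs_cost L + 120 * (N + 2) + 300"

text \<open>The bound \<open>2 * N + 1\<close> leaves room for fewer than \<open>N\<close> vertices
  in \<open>Q\<close>, one start vertex, and the fresh tape of \<open>N\<close> bits of a
  trial.\<close>

lemma runs_round:
  assumes "ready N s" "round_state N R f s" "0 < s vS" "2 * N + 1 \<le> L"
  shows "runs round_prog s (round_cost N L) (\<lambda>s'. same round_vars s s' \<and> round_state N R (f - 1) s') \<and> 0 < f"
proof -
  obtain sz Q bs where S: "s vS = int sz" and q: "queue s Q" and t: "tape N s bs"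
    and Q: "distinct Q" "set Q \<subseteq> {..<n}" and R: "rounds es k N n sz (Q, bs) = R"
    and len: "length Q + length bs + 1 \<le> N" "length bs < f" and sz: "0 < sz"
    using assms(2,3) by (auto simp: round_state_def split: if_splits)
  obtain g v w where best: "best es k N n Q sz = (g, v, w)" by (cases "best es k N n Q sz")
  obtain i bs1 where u1: "unary bs = (i, bs1)" by (cases "unary bs")
  define x where "x = next_vertex es N Q sz v w i"
  obtain Q' bs2 where b2: "bfs es (length Q) (Q @ [x], bs1) = (Q', bs2)"
    by (cases "bfs es (length Q) (Q @ [x], bs1)")
  obtain sz' bs3 where u2: "unary bs2 = (sz', bs3)" by (cases "unary bs2")
  have R1: "R = Q" if "g < 0"
    using R best that by (simp add: rounds.simps)
  have R2: "R = rounds es k N n sz' (Q', bs3)" if "\<not> g < 0"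
    using R best that sz u1 u2 b2 by (subst (asm) rounds.simps) (simp add: x_def)
  let ?s1 = "s(vMW := s vW)"
  let ?P = "\<lambda>s'. same round_vars s s' \<and> round_state N R (f - 1) s'"
  let ?then = "(start_prog (val vBV) ;; vW ::= val vBT) ;; bfs_prog ;; vW ::= val vMW ;; unary_prog ;;
        (IfPos (Sub (val vS) (val vK)) Skip (vK ::= Const 0) ;;
         start_prog (Cell (slot (Add (val vO) (val vK))))) ;;
        bfs_prog ;; unary_prog ;; vS ::= val vK"
  let ?else = "vQ ::= val vO ;; vS ::= Const 0 ;; vW ::= Const 0"
  have sm1: "same round_vars s ?s1" by (intro same_upd same_refl) simp
  have sel: "runs (IfPos (Add (val vBG) (Const 1)) ?then ?else) s2 (2 * bfs_cost L + 120 * (N + 2) + 250) ?P"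
    if s2: "same search_vars ?s1 s2" "array s2 Q" "s2 vO = int (length Q)" "holds s2 (g, v, w)" for s2
  proof (rule runs_If[where T'="2 * bfs_cost L + 120 * (N + 2) + 200"])
    have sm2: "same round_vars s s2" using sm1 s2(1) by (rule same_trans) simp_all
    have S2: "s2 vS = int sz" "s2 vMW = code N bs"
      using same_get[OF s2(1), of vS] same_get[OF s2(1), of vMW] S t by (simp_all add: tape_def)
    {
      assume "\<not> 0 < aval (Add (val vBG) (Const 1)) s2"
      then have "g < 0" using s2(4) by (simp add: holds_def)
      let ?s3 = "s2(vQ := int (length Q), vS := 0, vW := 0)"
      have "effect ?else s2 = ?s3" using s2(3) by simp
      moreover have "same round_vars s ?s3" using sm2 by (intro same_upd) simp_all
      moreover have "rounds es k N n 0 (Q, []) = Q"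
        by (cases "best es k N n Q 0") (simp add: rounds.simps)
      then have "round_state N R (f - 1) ?s3"
        unfolding round_state_def using Q R1[OF \<open>g < 0\<close>] len s2(2)
        by (intro exI[of _ 0] exI[of _ Q] exI[of _ "[]"]) (simp add: queue_def tape_def)
      ultimately have "?P (effect ?else s2)" by simp
      then show "runs ?else s2 (2 * bfs_cost L + 120 * (N + 2) + 200) ?P"
        by (intro runs_straight) simp_all
    }
    assume "0 < aval (Add (val vBG) (Const 1)) s2"
    then have g: "\<not> g < 0" "0 \<le> g" using s2(4) by (simp_all add: holds_def)
    obtain C where C: "decode es N Q v w = Q @ C" "length C = sz" "distinct (Q @ C)" "set C \<subseteq> {..<n}"
      "\<And>i. next_vertex es N Q sz v w i = C ! (if i < sz then i else 0)" "w < 2 ^ N"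
      using decode_best[OF best g(2) es Q sz] by metis
    have x: "x = C ! (if i < sz then i else 0)" using C(5) by (simp add: x_def)
    then have "x \<in> set C" using C(2) sz by simp
    then have xQ: "x \<notin> set Q" "x < n" using C(3,4) by auto
    let ?pre1 = "start_prog (val vBV) ;; vW ::= val vBT"
    let ?s20 = "effect (start_prog (val vBV)) s2"
    define s3 where "s3 = effect ?pre1 s2"
    have 0: "queue ?s20 (Q @ [v])" "?s20 vI = int (length Q)" "same {vQ, vI} s2 ?s20"
      by (rule effect_start, use s2 in \<open>simp_all add: holds_def\<close>)+
    have "?s20 vBT = int w" using same_get[OF 0(3), of vBT] s2(4) by (simp add: holds_def)
    then have s3: "s3 = ?s20(vW := int w)" by (simp add: s3_def)
    have q3: "queue s3 (Q @ [v])" and i3: "s3 vI = int (length Q)" unfolding s3 using 0 by simp_all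
    have t3: "tape N s3 (bits N w)" unfolding s3 using C(6) by (simp add: tape_def code_bits)
    have sm23: "same bfs_vars s2 s3" unfolding s3 by (intro same_upd same_mono[OF 0(3)]) simp_all
    have sm3: "same round_vars s s3" using sm2 sm23 by (rule same_trans) simp_all
    have r3: "ready N s3" using assms(1) sm3 by (rule ready_same) simp
    show "runs ?then s2 (2 * bfs_cost L + 120 * (N + 2) + 200) ?P"
    proof (rule runs_straight_Seq[where U="2 * bfs_cost L + 120 * (N + 2) + 150"], simp, fold s3_def,
        rule runs_Seq[OF runs_bfs[of N s3 "(Q @ [v], bits N w)" "length Q" L],
          where U="bfs_cost L + 120 * (N + 2) + 150"])
      fix s4 assume "same bfs_vars s3 s4 \<and> queue s4 (fst (bfs es (length Q) (Q @ [v], bits N w))) \<and>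
        tape N s4 (snd (bfs es (length Q) (Q @ [v], bits N w)))"
      then have s4: "same bfs_vars s3 s4" "queue s4 (Q @ C)"
        using C(1) by (simp_all add: decode_def)
      let ?s5 = "s4(vW := code N bs)"
      have sm4: "same bfs_vars s2 s4" using sm23 s4(1) by (rule same_trans) simp_all
      then have sm25: "same bfs_vars s2 ?s5" by (rule same_upd) simp
      have "s4 vMW = code N bs" using same_get[OF sm4, of vMW] S2 by simp
      then have eff5: "effect (vW ::= val vMW) s4 = ?s5" by simp
      have sm5: "same round_vars s ?s5" using sm2 sm25 by (rule same_trans) simp_all
      have r5: "ready N ?s5" using assms(1) sm5 by (rule ready_same) simp
      have t5: "tape N ?s5 bs" using t by (simp add: tape_def)
      let ?pre2 = "IfPos (Sub (val vS) (val vK)) Skip (vK ::= Const 0) ;;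
         start_prog (Cell (slot (Add (val vO) (val vK))))"
      let ?rest = "?pre2 ;; bfs_prog ;; unary_prog ;; vS ::= val vK"
      show "runs (vW ::= val vMW ;; unary_prog ;; ?rest) s4 (bfs_cost L + 120 * (N + 2) + 150) ?P"
      proof (rule runs_straight_Seq[where U="bfs_cost L + 120 * (N + 2) + 130"], simp, unfold eff5,
          rule runs_Seq[OF runs_unary_queue[of N ?s5 bs "Q @ C"], where U="bfs_cost L + 60 * (N + 2) + 130"])
        fix s6 assume "same {vK, vW, vB} ?s5 s6 \<and> queue s6 (Q @ C) \<and>
          s6 vK = int (fst (unary bs)) \<and> tape N s6 (snd (unary bs))"
        then have s6: "same {vK, vW, vB} ?s5 s6" "queue s6 (Q @ C)" "s6 vK = int i" "tape N s6 bs1"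
          using u1 by simp_all
        let ?i = "if i < sz then i else 0"
        let ?s7 = "s6(vK := int ?i)"
        have sm26: "same (insert vK bfs_vars) s2 s6" using sm25 s6(1) by (rule same_trans) simp_all
        have S6: "s6 vS = int sz" "s6 vO = int (length Q)"
          using same_get[OF sm26, of vS] same_get[OF sm26, of vO] S2 s2(3) by simp_all
        have eff7: "effect (IfPos (Sub (val vS) (val vK)) Skip (vK ::= Const 0)) s6 = ?s7"
          using S6 s6(3) by (cases "i < sz") (simp_all add: fun_upd_idem)
        have a7: "array ?s7 Q" using queue_prefix[OF s6(2)] by simp
        \<comment> \<open>The vertex is fetched from \<open>C\<close>, which still stands behind
          \<open>Q\<close> in the array, before the push overwrites the first slot after
          \<open>Q\<close>.\<close>
        have "?i < length C" using C(2) sz by simp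
        then have slot: "s6 (-100 - int (length Q + ?i)) = int x"
          using s6(2) x unfolding queue_def array_def by (metis length_append nat_add_left_cancel_less nth_append_length_plus)
        let ?e = "Cell (slot (Add (val vO) (val vK)))"
        have "aval ?e (?s7(vQ := int (length Q))) = s6 (-100 - int (length Q + ?i))"
          using S6 by simp
        then have ev: "aval ?e (?s7(vQ := int (length Q))) = int x" using slot by simp
        define s8 where "s8 = effect ?pre2 s6"
        have s8: "s8 = effect (start_prog ?e) ?s7" unfolding s8_def by (simp only: effect.simps(3) eff7)
        have "?s7 vO = int (length Q)" using S6 by simp
        note start = effect_start[OF a7 this ev, folded s8]
        have sm8: "same round_vars s s8"
        proof -
          have "same round_vars s s6" using sm5 s6(1) by (rule same_trans) simp_all
          then have "same round_vars s ?s7" by (rule same_upd) simp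
          then show ?thesis using start(3) by (rule same_trans) simp_all
        qed
        have r8: "ready N s8" using assms(1) sm8 by (rule ready_same) simp
        have t8: "tape N s8 bs1" by (rule tape_same[OF _ start(3)]) (use s6(4) in simp_all)
        have lbs1: "length bs1 \<le> length bs" using unary_length[of bs] u1 by simp
        have lens: "length Q' + length bs2 \<le> Suc (length Q) + length bs1"
          using bfs_length[of es "length Q" "(Q @ [x], bs1)"] b2 by simp
        have lbs2: "length bs2 \<le> length bs1" using bfs_tape[of es "length Q" "(Q @ [x], bs1)"] b2 by simp
        have lbs3: "sz' + length bs3 \<le> length bs2" using unary_length[of bs2] u2 by simp
        show "runs ?rest s6 (bfs_cost L + 60 * (N + 2) + 130) ?P"
        proof (rule runs_straight_Seq[where U="bfs_cost L + 60 * (N + 2) + 70"], simp, fold s8_def,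
            rule runs_Seq[OF runs_bfs[of N s8 "(Q @ [x], bs1)" "length Q" L], where U="60 * (N + 2) + 10"])
          fix s9 assume "same bfs_vars s8 s9 \<and> queue s9 (fst (bfs es (length Q) (Q @ [x], bs1))) \<and>
            tape N s9 (snd (bfs es (length Q) (Q @ [x], bs1)))"
          then have s9: "same bfs_vars s8 s9" "queue s9 Q'" "tape N s9 bs2" using b2 by simp_all
          have sm9: "same round_vars s s9" using sm8 s9(1) by (rule same_trans) simp_all
          have r9: "ready N s9" using assms(1) sm9 by (rule ready_same) simp
          show "runs (unary_prog ;; vS ::= val vK) s9 (60 * (N + 2) + 10) ?P"
          proof (rule runs_Seq[OF runs_unary_queue[OF s9(3) _ s9(2)], where U=10])
            fix s10 assume "same {vK, vW, vB} s9 s10 \<and> queue s10 Q' \<and>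
              s10 vK = int (fst (unary bs2)) \<and> tape N s10 (snd (unary bs2))"
            then have s10: "same {vK, vW, vB} s9 s10" "queue s10 Q'" "s10 vK = int sz'" "tape N s10 bs3"
              using u2 by simp_all
            let ?s11 = "s10(vS := int sz')"
            have sm10: "same round_vars s s10" using sm9 s10(1) by (rule same_trans) simp_all
            then have sm11: "same round_vars s ?s11" by (rule same_upd) simp
            have Q': "distinct Q'" "set Q' \<subseteq> {..<n}"
              using bfs_invariant[of "(Q @ [x], bs1)" "{..<n}" es "length Q"] Q xQ es b2 by simp_all
            \<comment> \<open>The start vertex is paid for by the 1 set aside in
              \<open>len(1)\<close>. If \<open>sz'\<close> is positive, the bits consumed in reading
              it set the next 1 aside.\<close>
            have "length Q' + length bs3 + (if sz' = 0 then 0 else 1) \<le> N"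
              using lens lbs1 lbs2 lbs3 len(1) by (cases "sz' = 0") simp_all
            moreover have "(if sz' = 0 then 0 else Suc (length bs3)) \<le> f - 1"
              using lbs1 lbs2 lbs3 len(2) by (cases "sz' = 0") simp_all
            ultimately have "round_state N R (f - 1) ?s11"
              unfolding round_state_def using s10 Q' R2[OF g(1)]
              by (intro exI[of _ sz'] exI[of _ Q'] exI[of _ bs3]) simp
            then have "?P (effect (vS ::= val vK) s10)" using sm11 s10(3) by simp
            then show "runs (vS ::= val vK) s10 10 ?P" by (intro runs_straight) simp_all
          qed (use r9 in \<open>simp_all add: ready_def\<close>)
        next
          show "length (fst (Q @ [x], bs1)) + length (snd (Q @ [x], bs1)) \<le> L"
            using lbs1 len(1) assms(4) by simp
        qed (use r8 start t8 in simp_all)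
      qed (use r5 t5 s4(2) in \<open>simp_all add: ready_def\<close>)
    next
      show "length (fst (Q @ [v], bits N w)) + length (snd (Q @ [v], bits N w)) \<le> L"
        using len(1) assms(4) by simp
    qed (use r3 q3 t3 i3 in simp_all)
  qed simp
  have r1: "ready N ?s1" using assms(1) sm1 by (rule ready_same) simp
  have eff1: "effect (vMW ::= val vW) s = ?s1" by simp
  have "runs round_prog s (round_cost N L) ?P" unfolding round_prog_def
  proof (rule runs_straight_Seq[where U="search_cost N L + 2 * bfs_cost L + 120 * (N + 2) + 280"], simp,
      unfold eff1, rule runs_Seq[OF runs_search[of N ?s1 Q sz L], where U="2 * bfs_cost L + 120 * (N + 2) + 250"])
    fix s2 assume "same search_vars ?s1 s2 \<and> array s2 Q \<and> s2 vO = int (length Q) \<and>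
      holds s2 (best es k N n Q sz)"
    then show "runs (IfPos (Add (val vBG) (Const 1)) ?then ?else) s2 (2 * bfs_cost L + 120 * (N + 2) + 250) ?P"
      using best by (intro sel) simp_all
  qed (use r1 q S Q len assms(4) in \<open>simp_all add: round_cost_def\<close>)
  then show ?thesis using len(2) by simp
qed

section \<open>Simulating one guess string\<close>

definition simulation :: "nat \<Rightarrow> nat \<Rightarrow> nat list" where
  "simulation N W = (case unary (bits N W) of (sz, bs) \<Rightarrow> rounds es k N n sz ([], bs))"

definition accepts :: "nat \<Rightarrow> nat \<Rightarrow> bool" where
  "accepts N W \<longleftrightarrow> length (simulation N W) \<le> p \<and> int p - b \<le> int (gain es k (set (simulation N W)))"

abbreviation "simulate_vars \<equiv> {vF, vR, vW, vB, vQ, vX, vJ, vU, vI, vG, vH, vC, vBG, vBV, vBT, vT, vV, vO, vMW, vK, vS, vA, vWW}"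

definition "simulate_cost N L = (N + 1) * (round_cost N L + 10) + bfs_cost L + 60 * (N + 2) + 100"

lemma runs_simulate:
  assumes "ready N s" "s vWW = int W" "W < 2 ^ N" "2 * N + 1 \<le> L"
  shows "runs simulate_prog s (simulate_cost N L) (\<lambda>s'. same simulate_vars s s' \<and>
    s' vWW = int W + 1 \<and> s' vA = (if accepts N W then 1 else s vA))"
proof -
  define R where "R = simulation N W"
  obtain sz bs where u: "unary (bits N W) = (sz, bs)" by (cases "unary (bits N W)")
  have R: "rounds es k N n sz ([], bs) = R" using u by (simp add: R_def simulation_def)
  have Rs: "distinct R \<and> set R \<subseteq> {..<n}"
    using rounds_sound[of es n "([], bs)" k N sz] es R by simp
  let ?s1 = "s(vQ := 0, vW := int W)"
  have eff1: "effect (vQ ::= Const 0 ;; vW ::= val vWW) s = ?s1" using assms(2) by simp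
  have sm1: "same round_vars s ?s1" by (intro same_upd same_refl) simp_all
  have r1: "ready N ?s1" using assms(1) sm1 by (rule ready_same) simp
  have q1: "queue ?s1 []" by (simp add: queue_def array_def)
  have t1: "tape N ?s1 (bits N W)" using assms(3) by (simp add: tape_def code_bits)
  let ?P = "\<lambda>s'. same simulate_vars s s' \<and> s' vWW = int W + 1 \<and> s' vA = (if accepts N W then 1 else s vA)"
  let ?check = "IfPos (Sub (val vQ) (val 4)) Skip
       (IfPos (Sub (Sub (val 4) (val 2)) (val vG)) Skip (vA ::= Const 1)) ;; incr vWW"
  define I where "I f s' \<longleftrightarrow> same round_vars s s' \<and> round_state N R f s'" for f s'
  show ?thesis unfolding simulate_prog_def
  proof (rule runs_straight_Seq[where U="(N + 1) * (round_cost N L + 10) + bfs_cost L + 60 * (N + 2) + 90"],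
      simp, unfold eff1, rule runs_Seq[OF runs_unary_queue[OF t1 _ q1],
        where U="(N + 1) * (round_cost N L + 10) + bfs_cost L + 90"])
    fix s2 assume "same {vK, vW, vB} ?s1 s2 \<and> queue s2 [] \<and> s2 vK = int (fst (unary (bits N W))) \<and>
      tape N s2 (snd (unary (bits N W)))"
    then have s2: "same {vK, vW, vB} ?s1 s2" "queue s2 []" "s2 vK = int sz" "tape N s2 bs"
      using u by simp_all
    let ?s3 = "s2(vS := int sz)"
    have eff3: "effect (vS ::= val vK) s2 = ?s3" using s2(3) by simp
    have "same round_vars s s2" using sm1 s2(1) by (rule same_trans) simp_all
    then have sm3: "same round_vars s ?s3" by (rule same_upd) simp
    \<comment> \<open>A positive first size has consumed at least one bit, which pays for the first
      start vertex and makes fuel \<open>N\<close> sufficient.\<close>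
    have "sz + length bs \<le> N" using unary_length[of "bits N W"] u by simp
    then have "round_state N R N ?s3"
      unfolding round_state_def using s2 R
      by (intro exI[of _ sz] exI[of _ "[]"] exI[of _ bs]) simp
    then have I3: "I N ?s3" using sm3 by (simp add: I_def)
    show "runs (vS ::= val vK ;; WhilePos (val vS) round_prog ;; gain_prog ;; ?check) s2
        ((N + 1) * (round_cost N L + 10) + bfs_cost L + 90) ?P"
    proof (rule runs_straight_Seq[where U="(N + 1) * (round_cost N L + 10) + bfs_cost L + 80"], simp, unfold eff3,
        rule runs_Seq[where M="\<lambda>s'. same round_vars s s' \<and> queue s' R \<and> length R \<le> N"
          and S="(N + 1) * (round_cost N L + 10)" and U="bfs_cost L + 80"])
      show "runs (WhilePos (val vS) round_prog) ?s3 ((N + 1) * (round_cost N L + 10))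
        (\<lambda>s'. same round_vars s s' \<and> queue s' R \<and> length R \<le> N)"
      proof (rule runs_While[where I=I and f=N and B="round_cost N L", OF I3])
        fix f s4 assume I: "I f s4" and pos: "0 < aval (val vS) s4"
        then have sm4: "same round_vars s s4" and st4: "round_state N R f s4" by (simp_all add: I_def)
        have r4: "ready N s4" using assms(1) sm4 by (rule ready_same) simp
        have *: "runs round_prog s4 (round_cost N L) (\<lambda>s'. same round_vars s4 s' \<and> round_state N R (f - 1) s') \<and> 0 < f"
          using r4 st4 pos assms(4) by (intro runs_round) simp_all
        then have "runs round_prog s4 (round_cost N L) (I (f - 1))"
          unfolding I_def using same_trans[OF sm4, of round_vars _ round_vars]
          by (intro runs_mono[OF conjunct1[OF *] order_refl]) simp
        then show "0 < f \<and> runs round_prog s4 (round_cost N L) (I (f - 1))" using * by simp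
      next
        fix f s4 assume I: "I f s4" and pos: "\<not> 0 < aval (val vS) s4"
        then obtain Q bs' where "queue s4 Q" "rounds es k N n 0 (Q, bs') = R" "length Q \<le> N"
          unfolding I_def round_state_def by auto
        moreover have "rounds es k N n 0 (Q, bs') = Q"
          by (cases "best es k N n Q 0") (simp add: rounds.simps)
        ultimately show "same round_vars s s4 \<and> queue s4 R \<and> length R \<le> N" using I by (simp add: I_def)
      next
        show "(N + 1) * (1 + acost (val vS) + round_cost N L) \<le> (N + 1) * (round_cost N L + 10)"
          by (rule mult_le_mono2) simp
      qed
    next
      fix s4 assume "same round_vars s s4 \<and> queue s4 R \<and> length R \<le> N"
      then have s4: "same round_vars s s4" "queue s4 R" "length R \<le> N" by simp_all
      have r4: "ready N s4" using assms(1) s4(1) by (rule ready_same) simp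
      show "runs (gain_prog ;; ?check) s4 (bfs_cost L + 80) ?P"
      proof (rule runs_Seq[OF runs_gain[of s4 R L], where U=70])
        fix s5 assume s5: "same gain_vars s4 s5 \<and> queue s5 R \<and> s5 vG = int (gain es k (set R))"
        have sm5: "same round_vars s s5" using s4(1) conjunct1[OF s5] by (rule same_trans) simp_all
        have inp5: "input s5" using assms(1) input_same[OF _ sm5] by (simp add: ready_def)
        have v5: "s5 vWW = int W" "s5 vA = s vA"
          using same_get[OF sm5, of vWW] same_get[OF sm5, of vA] assms(2) by simp_all
        have c5: "s5 vQ = int (length R)" "s5 4 = int p" "s5 2 = b" "s5 vG = int (gain es k (set R))"
          using s5 inp5 by (simp_all add: queue_def input_def)
        have acc: "accepts N W \<longleftrightarrow> \<not> 0 < s5 vQ - s5 4 \<and> \<not> 0 < s5 4 - s5 2 - s5 vG"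
          unfolding accepts_def c5 R_def by auto
        let ?s6 = "s5(vA := (if accepts N W then 1 else s vA), vWW := int W + 1)"
        have eff6: "effect ?check s5 = ?s6"
          using acc v5 by (cases "0 < s5 vQ - s5 4"; cases "0 < s5 4 - s5 2 - s5 vG") (simp_all add: fun_upd_idem)
        have "same simulate_vars s ?s6" by (intro same_upd same_mono[OF sm5]) simp_all
        then have "?P ?s6" by simp
        then have "?P (effect ?check s5)" unfolding eff6 .
        then show "runs ?check s5 70 ?P" by (rule runs_straight[rotated 2]) simp_all
      qed (use r4 s4 Rs assms(4) in \<open>simp_all add: ready_def\<close>)
    qed simp_all
  qed (use r1 in \<open>simp_all add: ready_def simulate_cost_def\<close>)
qed

section \<open>The maximum degree and the power of two\<close>

lemma incidences_outside: "n \<le> u \<Longrightarrow> incidences es u = 0"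
  using es by (auto simp: incidences_def count_list_0_iff)

definition "degree_cost = (n + 1) * ((length es + 1) * 110 + 100)"

text \<open>An upper bound on all degrees makes the search complete. The last conjunct keeps that
  bound from exceeding the true maximum degree, which controls the exponent of the running
  time.\<close>

lemma runs_degree:
  assumes "input s" "s vD = 0"
  shows "runs degree_prog s (degree_cost + 10) (\<lambda>s'. same {vV, vC, vJ, vD} s s' \<and>
    (\<exists>D. s' vD = int D \<and> (\<forall>u. incidences es u \<le> D) \<and> (D = 0 \<or> (\<exists>u. D = incidences es u))))"
proof -
  define I where "I v s' \<longleftrightarrow> same {vV, vC, vJ, vD} s s' \<and> s' vV = int v \<and>
    (\<exists>D. s' vD = int D \<and> (\<forall>u<v. incidences es u \<le> D) \<and> (D = 0 \<or> (\<exists>u. D = incidences es u)))" for v s'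
  let ?inner = "if_eq arc_tail (val vV) (incr vC) ;; if_eq arc_head (val vV) (incr vC) ;; incr vJ"
  let ?post = "IfPos (Sub (val vC) (val vD)) (vD ::= val vC) Skip ;; incr vV"
  let ?body = "(vC ::= Const 0 ;; vJ ::= Const 0) ;; WhilePos (Sub (val 1) (val vJ)) ?inner ;; ?post"
  show ?thesis unfolding degree_prog_def
  proof (rule runs_straight_Seq[where U="degree_cost"], simp,
      rule runs_for[where I=I and n=n and B="(length es + 1) * 110 + 60"])
    show "I 0 (effect (vV ::= Const 0) s)" using assms by (simp add: I_def same_upd)
  next
    fix v s1 assume v: "v < n" and I: "I v s1"
    then obtain D where sm: "same {vV, vC, vJ, vD} s s1" and V: "s1 vV = int v" and D: "s1 vD = int D"
      "\<forall>u<v. incidences es u \<le> D" "D = 0 \<or> (\<exists>u. D = incidences es u)" by (auto simp: I_def)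
    have inp: "input s1" using assms(1) sm by (rule input_same) simp
    have pos: "0 < aval (Sub (val 0) (val vV)) s1" using V v inp by (simp add: input_def)
    let ?s2 = "s1(vC := 0, vJ := 0)"
    define J where "J j s' \<longleftrightarrow> same {vC, vJ} s1 s' \<and> s' vJ = int j \<and> s' vC = int (incidences (take j es) v)" for j s'
    have pre: "effect (vC ::= Const 0 ;; vJ ::= Const 0) s1 = ?s2" by simp
    have "runs ?body s1 ((length es + 1) * 110 + 60) (I (Suc v))"
    proof (rule runs_straight_Seq[where U="(length es + 1) * 110 + 40"], simp, unfold pre,
        rule runs_Seq[where M="J (length es)" and S="(length es + 1) * 110" and U=40])
      show "runs (WhilePos (Sub (val 1) (val vJ)) ?inner) ?s2 ((length es + 1) * 110) (J (length es))"
      proof (rule runs_for[where I=J and n="length es" and B=100])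
        show "J 0 ?s2" by (simp add: J_def incidences_def same_upd)
      next
        fix j s3 assume j: "j < length es" and J: "J j s3"
        then have sm3: "same {vC, vJ} s1 s3" and J3: "s3 vJ = int j" "s3 vC = int (incidences (take j es) v)"
          by (simp_all add: J_def)
        have inp3: "input s3" using inp sm3 by (rule input_same) simp
        have V3: "s3 vV = int v" using same_get[OF sm3, of vV] V by simp
        let ?e = "es ! j"
        have e: "s3 (5 + (int j + int j)) = int (fst ?e)" "s3 (6 + (int j + int j)) = int (snd ?e)"
          "s3 1 = int (length es)"
          using inp3 j by (simp_all add: input_def)
        let ?s4 = "s3(vC := int (incidences (take (Suc j) es) v), vJ := int j + 1)"
        have inc: "incidences (take (Suc j) es) v = incidences (take j es) v +
            (if fst ?e = v then 1 else 0) + (if snd ?e = v then 1 else 0)"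
          using j by (simp add: incidences_def take_Suc_conv_app_nth)
        have eff: "effect ?inner s3 = ?s4"
          using e J3 V3 inc by (cases "fst ?e = v"; cases "snd ?e = v") (simp_all add: fun_upd_idem add.commute)
        have "J (Suc j) ?s4" unfolding J_def using sm3 by (simp add: same_upd)
        then have "runs ?inner s3 100 (J (Suc j))"
          by (intro runs_straight) (simp_all only: eff, simp_all)
        moreover have "0 < aval (Sub (val 1) (val vJ)) s3" using J3 j e by simp
        ultimately show "0 < aval (Sub (val 1) (val vJ)) s3 \<and> runs ?inner s3 100 (J (Suc j))" by blast
      next
        fix s3 assume J: "J (length es) s3"
        then have "input s3" using inp by (auto simp: J_def intro: input_same)
        then show "\<not> 0 < aval (Sub (val 1) (val vJ)) s3" using J by (simp add: J_def input_def)
      qed simp_all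
    next
      fix s3 assume J: "J (length es) s3"
      then have sm3: "same {vC, vJ} s1 s3" and C3: "s3 vC = int (incidences es v)" by (simp_all add: J_def)
      have v3: "s3 vD = int D" "s3 vV = int v" using same_get[OF sm3, of vD] same_get[OF sm3, of vV] D V by simp_all
      let ?D = "max D (incidences es v)"
      let ?s4 = "s3(vD := int ?D, vV := int v + 1)"
      have eff: "effect ?post s3 = ?s4"
        using v3 C3 by (cases "D < incidences es v") (simp_all add: fun_upd_idem)
      have "same {vV, vC, vJ, vD} s s3" using sm sm3 by (rule same_trans) simp_all
      then have "same {vV, vC, vJ, vD} s ?s4" by (intro same_upd) simp_all
      moreover have "\<forall>u<Suc v. incidences es u \<le> ?D" using D(2) by (auto simp: less_Suc_eq max.coboundedI1)
      moreover have "?D = 0 \<or> (\<exists>u. ?D = incidences es u)" using D(3) by (auto simp: max_def)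
      ultimately have "I (Suc v) ?s4" unfolding I_def by (intro conjI exI[of _ ?D]) simp_all
      then show "runs ?post s3 40 (I (Suc v))"
        by (intro runs_straight) (simp_all only: eff, simp_all)
    qed simp_all
    with pos show "0 < aval (Sub (val 0) (val vV)) s1 \<and> runs ?body s1 ((length es + 1) * 110 + 60) (I (Suc v))" by blast
  next
    fix s1 assume I: "I n s1"
    then have "input s1" using assms(1) by (auto simp: I_def intro: input_same)
    then show "\<not> 0 < aval (Sub (val 0) (val vV)) s1" using I by (simp add: I_def input_def)
    have "incidences es u \<le> D" if "\<forall>u<n. incidences es u \<le> D" for u D
      using that incidences_outside[of u] by (cases "u < n") simp_all
    then show "same {vV, vC, vJ, vD} s s1 \<and>
        (\<exists>D. s1 vD = int D \<and> (\<forall>u. incidences es u \<le> D) \<and> (D = 0 \<or> (\<exists>u. D = incidences es u)))"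
      using I unfolding I_def by blast
  next
    show "(n + 1) * (1 + acost (Sub (val 0) (val vV)) + ((length es + 1) * 110 + 60)) \<le> degree_cost"
      unfolding degree_cost_def by (rule mult_le_mono2) simp
  qed simp
qed

definition "power_cost D = (p + 1) * ((D + 2) * 50 + 40)"

lemma runs_power:
  assumes "input s" "s vD = int D"
  shows "runs power_prog s (power_cost D + 10) (\<lambda>s'. same {vM, vI, vJ} s s' \<and> s' vM = 2 ^ (3 * (D + 1) * p))"
proof -
  define I where "I i s' \<longleftrightarrow> same {vM, vI, vJ} s s' \<and> s' vI = int i \<and> s' vM = 2 ^ (3 * (D + 1) * i)" for i s'
  let ?inner = "vM ::= Add (val vM) (val vM) ;; vM ::= Add (val vM) (val vM) ;;
           vM ::= Add (val vM) (val vM) ;; incr vJ"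
  let ?body = "vJ ::= Const 0 ;; WhilePos (Sub (Add (val vD) (Const 1)) (val vJ)) ?inner ;; incr vI"
  have get: "s' vD = int D \<and> s' 4 = int p" if "same {vM, vI, vJ} s s'" for s'
    using assms same_get[OF that, of vD] same_get[OF that, of 4] by (simp add: input_def)
  show ?thesis unfolding power_prog_def
  proof (rule runs_straight_Seq[where U="power_cost D"], simp,
      rule runs_for[where I=I and n=p and B="(D + 2) * 50 + 30"])
    show "I 0 (effect (vM ::= Const 1 ;; vI ::= Const 0) s)" by (simp add: I_def same_upd)
  next
    fix i s1 assume i: "i < p" and I: "I i s1"
    then have sm: "same {vM, vI, vJ} s s1" and i1: "s1 vI = int i" and M: "s1 vM = 2 ^ (3 * (D + 1) * i)"
      by (simp_all add: I_def)
    define J where "J j s' \<longleftrightarrow> same {vM, vI, vJ} s s' \<and> s' vI = int i \<and> s' vJ = int j \<and>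
      s' vM = 2 ^ (3 * (D + 1) * i + 3 * j)" for j s'
    have pre: "effect (vJ ::= Const 0) s1 = s1(vJ := 0)" by simp
    have "runs ?body s1 ((D + 2) * 50 + 30) (I (Suc i))"
    proof (rule runs_straight_Seq[where U="(D + 2) * 50 + 10"], simp, unfold pre,
        rule runs_Seq[where M="J (D + 1)" and S="(D + 2) * 50" and U=10])
      show "runs (WhilePos (Sub (Add (val vD) (Const 1)) (val vJ)) ?inner) (s1(vJ := 0)) ((D + 2) * 50) (J (D + 1))"
      proof (rule runs_for[where I=J and n="D + 1" and B=40])
        show "J 0 (s1(vJ := 0))" unfolding J_def using sm i1 M by (simp add: same_upd)
      next
        fix j s2 assume j: "j < D + 1" and J: "J j s2"
        then have sm2: "same {vM, vI, vJ} s s2" and J2: "s2 vI = int i" "s2 vJ = int j"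
          "s2 vM = 2 ^ (3 * (D + 1) * i + 3 * j)" by (simp_all add: J_def)
        have "3 * (D + 1) * i + 3 * Suc j = Suc (Suc (Suc (3 * (D + 1) * i + 3 * j)))" by simp
        then have pow: "(2::int) ^ (3 * (D + 1) * i + 3 * Suc j) = 8 * 2 ^ (3 * (D + 1) * i + 3 * j)"
          by (simp only: power_Suc)
        let ?s3 = "s2(vM := 2 ^ (3 * (D + 1) * i + 3 * Suc j), vJ := int j + 1)"
        have eff: "effect ?inner s2 = ?s3" unfolding pow using J2 by simp
        have "J (Suc j) ?s3" unfolding J_def using sm2 J2 by (simp add: same_upd)
        then have "runs ?inner s2 40 (J (Suc j))" by (intro runs_straight) (simp_all only: eff, simp_all)
        moreover have "0 < aval (Sub (Add (val vD) (Const 1)) (val vJ)) s2" using get[OF sm2] J2 j by simp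
        ultimately show "0 < aval (Sub (Add (val vD) (Const 1)) (val vJ)) s2 \<and> runs ?inner s2 40 (J (Suc j))" by blast
      next
        fix s2 assume J: "J (D + 1) s2"
        then show "\<not> 0 < aval (Sub (Add (val vD) (Const 1)) (val vJ)) s2" using get[of s2] by (simp add: J_def)
      qed simp_all
    next
      fix s2 assume J: "J (D + 1) s2"
      have "3 * (D + 1) * i + 3 * (D + 1) = 3 * (D + 1) * Suc i" by simp
      then have "I (Suc i) (s2(vI := int i + 1))" using J unfolding I_def J_def by (simp only:) (simp add: same_upd)
      then have "I (Suc i) (effect (incr vI) s2)" using J by (simp add: J_def)
      then show "runs (incr vI) s2 10 (I (Suc i))" by (intro runs_straight) simp_all
    qed simp_all
    moreover have "0 < aval (Sub (val 4) (val vI)) s1" using get[OF sm] i1 i by simp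
    ultimately show "0 < aval (Sub (val 4) (val vI)) s1 \<and> runs ?body s1 ((D + 2) * 50 + 30) (I (Suc i))" by blast
  next
    fix s1 assume I: "I p s1"
    then show "\<not> 0 < aval (Sub (val 4) (val vI)) s1" using get[of s1] by (simp add: I_def)
    show "same {vM, vI, vJ} s s1 \<and> s1 vM = 2 ^ (3 * (D + 1) * p)" using I by (simp add: I_def)
  next
    show "(p + 1) * (1 + acost (Sub (val 4) (val vI)) + ((D + 2) * 50 + 30)) \<le> power_cost D"
      unfolding power_cost_def by (rule mult_le_mono2) simp
  qed simp
qed

definition "main_cost D = degree_cost + power_cost D +
  (let N = 3 * (D + 1) * p in (2 ^ N + 1) * (simulate_cost N (2 * N + 1) + 10)) + 50"

lemma runs_main:
  assumes "input s" "s vD = 0" "s vA = 0" "s vWW = 0"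
  obtains D where "\<And>u. incidences es u \<le> D" "D = 0 \<or> (\<exists>u. D = incidences es u)"
    "runs main_prog s (main_cost D)
      (\<lambda>s'. s' 0 = of_bool (p \<le> n \<and> (\<exists>W<2 ^ (3 * (D + 1) * p). accepts (3 * (D + 1) * p) W)))"
proof -
  \<comment> \<open>The first run is fixed before the main triple is stated, since string length and
    time bound depend on the \<open>D\<close> it computes.\<close>
  obtain t1 s1 D where e1: "exec degree_prog s t1 s1" "t1 \<le> degree_cost + 10" "same {vV, vC, vJ, vD} s s1"
    "s1 vD = int D" and D: "\<forall>u. incidences es u \<le> D" "D = 0 \<or> (\<exists>u. D = incidences es u)"
    using runs_degree[OF assms(1,2)] unfolding runs_def by blast
  have inp1: "input s1" using assms(1) e1(3) by (rule input_same) simp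
  define N where "N = 3 * (D + 1) * p"
  let ?P = "\<lambda>s'. s' 0 = of_bool (p \<le> n \<and> (\<exists>W<2 ^ N. accepts N W))"
  let ?fin = "IfPos (Sub (val 4) (val 0)) (Store (Const 0) (Const 0)) (Store (Const 0) (val vA))"
  have "runs main_prog s (main_cost D) ?P" unfolding main_prog_def
  proof (rule runs_Seq[where M="\<lambda>s'. s' = s1" and S="degree_cost + 10" and
        U="power_cost D + (2 ^ N + 1) * (simulate_cost N (2 * N + 1) + 10) + 40"])
    show "runs degree_prog s (degree_cost + 10) (\<lambda>s'. s' = s1)" using e1 unfolding runs_def by blast
  next
    fix s' assume "s' = s1"
    have "runs (power_prog ;; WhilePos (Sub (val vM) (val vWW)) simulate_prog ;; ?fin) s1
      (power_cost D + (2 ^ N + 1) * (simulate_cost N (2 * N + 1) + 10) + 40) ?P"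
    proof (rule runs_Seq[OF runs_power[OF inp1 e1(4)], where U="(2 ^ N + 1) * (simulate_cost N (2 * N + 1) + 10) + 30"])
      fix s2 assume "same {vM, vI, vJ} s1 s2 \<and> s2 vM = 2 ^ (3 * (D + 1) * p)"
      then have s2: "same {vM, vI, vJ} s1 s2" "s2 vM = 2 ^ N" by (simp_all add: N_def)
      have inp2: "input s2" using inp1 s2(1) by (rule input_same) simp
      have v2: "s2 vA = 0" "s2 vWW = 0"
        using same_get[OF s2(1), of vA] same_get[OF s2(1), of vWW] same_get[OF e1(3), of vA]
          same_get[OF e1(3), of vWW] assms(3,4) by simp_all
      define I where "I W s' \<longleftrightarrow> ready N s' \<and> s' vWW = int W \<and> s' vA = of_bool (\<exists>W'<W. accepts N W')" for W s'
      show "runs (WhilePos (Sub (val vM) (val vWW)) simulate_prog ;; ?fin) s2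
        ((2 ^ N + 1) * (simulate_cost N (2 * N + 1) + 10) + 30) ?P"
      proof (rule runs_Seq[where M="I (2 ^ N)" and S="(2 ^ N + 1) * (simulate_cost N (2 * N + 1) + 10)" and U=30])
        show "runs (WhilePos (Sub (val vM) (val vWW)) simulate_prog) s2
          ((2 ^ N + 1) * (simulate_cost N (2 * N + 1) + 10)) (I (2 ^ N))"
        proof (rule runs_for[where I=I and n="2 ^ N" and B="simulate_cost N (2 * N + 1)"])
          show "I 0 s2" using inp2 s2 v2 by (simp add: I_def ready_def)
        next
          fix W s3 assume W: "W < 2 ^ N" and I: "I W s3"
          then have r3: "ready N s3" and W3: "s3 vWW = int W" and A3: "s3 vA = of_bool (\<exists>W'<W. accepts N W')"
            by (simp_all add: I_def)
          have M3: "s3 vM = 2 ^ N" using r3 by (simp add: ready_def)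
          have "runs simulate_prog s3 (simulate_cost N (2 * N + 1)) (I (Suc W))"
          proof (rule runs_mono[OF runs_simulate[OF r3 W3 W, of "2 * N + 1"]])
            fix s4 assume s4: "same simulate_vars s3 s4 \<and> s4 vWW = int W + 1 \<and>
              s4 vA = (if accepts N W then 1 else s3 vA)"
            have "ready N s4" using r3 conjunct1[OF s4] by (rule ready_same) simp
            moreover have "(\<exists>W'<Suc W. accepts N W') \<longleftrightarrow> accepts N W \<or> (\<exists>W'<W. accepts N W')"
              by (auto simp: less_Suc_eq)
            ultimately show "I (Suc W) s4" using s4 A3 by (simp add: I_def)
          qed simp_all
          moreover have "int W < 2 ^ N" using W by simp
          ultimately show "0 < aval (Sub (val vM) (val vWW)) s3 \<and>
              runs simulate_prog s3 (simulate_cost N (2 * N + 1)) (I (Suc W))"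
            using W3 M3 by simp
        next
          fix s3 assume "I (2 ^ N) s3"
          then have "s3 vM = 2 ^ N" "s3 vWW = 2 ^ N" by (simp_all add: I_def ready_def)
          then show "\<not> 0 < aval (Sub (val vM) (val vWW)) s3" by simp
        next
          show "(2 ^ N + 1) * (1 + acost (Sub (val vM) (val vWW)) + simulate_cost N (2 * N + 1))
            \<le> (2 ^ N + 1) * (simulate_cost N (2 * N + 1) + 10)"
            by (rule mult_le_mono2) simp
        qed
      next
        fix s3 assume I: "I (2 ^ N) s3"
        then have "s3 4 = int p" "s3 0 = int n" "s3 vA = of_bool (\<exists>W'<2 ^ N. accepts N W')"
          by (simp_all add: I_def ready_def input_def)
        then have "?P (effect ?fin s3)" by (cases "p \<le> n") simp_all
        then show "runs ?fin s3 30 ?P" by (intro runs_straight) simp_all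
      qed simp
    qed simp
    then show "runs (power_prog ;; WhilePos (Sub (val vM) (val vWW)) simulate_prog ;; ?fin) s'
      (power_cost D + (2 ^ N + 1) * (simulate_cost N (2 * N + 1) + 10) + 40) ?P" using \<open>s' = s1\<close> by simp
  next
    show "degree_cost + 10 + (power_cost D + (2 ^ N + 1) * (simulate_cost N (2 * N + 1) + 10) + 40) \<le> main_cost D"
      by (simp add: main_cost_def Let_def N_def)
  qed
  then show ?thesis using that D unfolding N_def by blast
qed

end

section \<open>The anchored core problem\<close>

context anchored_core_instance
begin

lemma accepts_iff:
  assumes "\<And>u. incidences es u \<le> D"
  shows "(\<exists>W<2 ^ (3 * (D + 1) * p). accepts (3 * (D + 1) * p) W) \<longleftrightarrow>
    (\<exists>H\<subseteq>{..<n}. card H \<le> p \<and> int p - b \<le> int (gain es k H))"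
proof -
  define N where "N = 3 * (D + 1) * p"
  have "\<exists>W<2 ^ N. accepts N W" if H: "H \<subseteq> {..<n}" "card H \<le> p" "int p - b \<le> int (gain es k H)" for H
  proof -
    obtain bs where bs: "length bs \<le> (D + 3) * card H"
      "\<And>r s bs'. unary (bs @ replicate r False) = (s, bs') \<Longrightarrow>
        gain es k H \<le> gain es k (set (rounds es k N n s ([], bs'))) \<and>
        length (rounds es k N n s ([], bs')) \<le> card H"
      using rounds_complete[OF es assms, where p=p and N=N and Q="[]" and H=H and k=k] H(1,2)
      by (auto simp: N_def)
    have "(D + 3) * card H \<le> (D + 3) * p" using H(2) by simp
    \<comment> \<open>From \<open>D + 3 \<le> 3 * (D + 1)\<close>; this is where the string length
      comes from.\<close>
    also have "\<dots> \<le> N" unfolding N_def by (rule mult_le_mono1) simp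
    finally have "length bs \<le> N" using bs(1) by linarith
    then obtain W where W: "W < 2 ^ N" "bits N W = bs @ replicate (N - length bs) False"
      by (rule bits_prefix)
    have "gain es k H \<le> gain es k (set (simulation N W)) \<and> length (simulation N W) \<le> card H"
      using bs(2)[of "N - length bs"] W(2) by (auto simp: simulation_def split: prod.split)
    then show ?thesis using W(1) H by (intro exI[of _ W]) (auto simp: accepts_def)
  qed
  moreover have "\<exists>H\<subseteq>{..<n}. card H \<le> p \<and> int p - b \<le> int (gain es k H)" if "accepts N W" for W
  proof -
    obtain sz bs where u: "unary (bits N W) = (sz, bs)" by (cases "unary (bits N W)")
    have "distinct (simulation N W) \<and> set (simulation N W) \<subseteq> {..<n}"
      using rounds_sound[of es n "([], bs)" k N sz] es u by (simp add: simulation_def)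
    then show ?thesis using that by (intro exI[of _ "set (simulation N W)"]) (auto simp: accepts_def distinct_card)
  qed
  ultimately show ?thesis unfolding N_def by blast
qed

text \<open>Each arc is counted at its tail. A pass over the arc list is therefore linear in
  \<open>n\<close> for bounded degree.\<close>

lemma length_es_le:
  assumes "\<And>u. incidences es u \<le> D"
  shows "length es \<le> n * D"
proof -
  have "set (map fst es) \<subseteq> {..<n}" using es by auto
  then have "length es = (\<Sum>v<n. count_list (map fst es) v)"
    using sum_count_set[of "map fst es" "{..<n}"] by simp
  also have "\<dots> \<le> (\<Sum>v<n. D)"
  proof (rule sum_mono)
    show "count_list (map fst es) v \<le> D" for v using assms[of v] by (simp add: incidences_def)
  qed
  finally show ?thesis by simp
qed

text \<open>All costs are measured in \<open>X = 2 ^ N\<close> and \<open>Y = n + 1\<close>. As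
  \<open>N\<close> is at least \<open>3 * D + 3\<close> and \<open>3 * p\<close>, one factor
  \<open>X\<close> absorbs each of \<open>N\<close>, \<open>D\<close> and \<open>p\<close>. In the
  search, one \<open>Y\<close> comes from the arc list and one from the loop over start vertices.
  Numerical constants are carried along and traded at the end for powers of \<open>X\<close>, which
  is at least 8.\<close>

lemma main_cost_le:
  assumes "\<And>u. incidences es u \<le> D" "1 \<le> p"
  shows "main_cost D \<le> (2 ^ (3 * (D + 1) * p)) ^ 11 * (n + 1) ^ 2"
proof -
  define N where "N = 3 * (D + 1) * p"
  define L where "L = 2 * N + 1"
  define X :: nat where "X = 2 ^ N"
  define Y where "Y = n + 1"
  have "3 * (D + 1) * 1 \<le> N" unfolding N_def by (rule mult_le_mono2) (rule assms(2))
  then have DN: "3 * D + 3 \<le> N" by simp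
  have "3 * 1 * p \<le> N" unfolding N_def by (intro mult_le_mono) simp_all
  then have pN: "3 * p \<le> N" by simp
  have NX: "N + 1 \<le> X" unfolding X_def using less_exp[of N] by (simp add: Suc_le_eq)
  have "(2::nat) ^ 3 \<le> X" unfolding X_def by (rule power_increasing) (use DN in simp_all)
  then have X8: "8 \<le> X" by simp
  have Y1: "1 \<le> Y" by (simp add: Y_def)
  have mono: "X ^ a * Y ^ c \<le> X ^ a' * Y ^ c'" if "a \<le> a'" "c \<le> c'" for a a' c c'
    using that X8 Y1 by (intro mult_le_mono power_increasing) simp_all
  have one: "1 \<le> X ^ a * Y ^ c" for a c using X8 Y1 by simp
  have X_le: "X \<le> X ^ a * Y ^ c" if "1 \<le> a" for a c using mono[of 1 a 0 c] that by simp
  have m: "length es + 1 \<le> X * Y"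
  proof -
    have "length es \<le> n * D" using assms(1) by (rule length_es_le)
    also have "\<dots> \<le> n * X" using DN NX by (intro mult_le_mono2) simp
    finally show ?thesis using X8 by (simp add: Y_def algebra_simps)
  qed
  have mem: "mem_cost L \<le> 120 * X" using NX by (simp add: mem_cost_def L_def)
  have arcs: "arcs_cost L \<le> 320 * (X ^ 2 * Y)"
  proof -
    have "arcs_cost L \<le> (X * Y) * (320 * X)" unfolding arcs_cost_def
      by (rule mult_le_mono[OF m]) (use mem X8 in simp)
    then show ?thesis by (simp add: power2_eq_square algebra_simps)
  qed
  have bfs: "bfs_cost L \<le> 740 * (X ^ 3 * Y)"
  proof -
    have "bfs_cost L \<le> (2 * X) * (370 * (X ^ 2 * Y))" unfolding bfs_cost_def
      by (rule mult_le_mono) (use NX arcs one[of 2 1, unfolded power_one_right] L_def in linarith)+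
    then show ?thesis by (simp add: power2_eq_square power3_eq_cube algebra_simps)
  qed
  have tr: "try_loop_cost N L \<le> 3280 * (X ^ 4 * Y)"
  proof -
    have "try_loop_cost N L \<le> (2 * X) * (1640 * (X ^ 3 * Y))"
      unfolding try_loop_cost_def X_def[symmetric]
      by (rule mult_le_mono) (use X8 bfs one[of 3 1, unfolded power_one_right] in linarith)+
    then show ?thesis by (simp add: power3_eq_cube power4_eq_xxxx algebra_simps)
  qed
  have se: "search_cost N L \<le> 3450 * (X ^ 4 * Y ^ 2)"
  proof -
    have "search_cost N L \<le> Y * (3450 * (X ^ 4 * Y))"
      unfolding search_cost_def Y_def[symmetric]
      by (rule mult_le_mono2) (use tr mem X_le[of 4 1, unfolded power_one_right] one[of 4 1, unfolded power_one_right] in linarith)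
    then show ?thesis by (simp add: power2_eq_square algebra_simps)
  qed
  have up: "X ^ 3 * Y \<le> X ^ 4 * Y ^ 2" "X ^ 3 * Y \<le> X ^ 5 * Y ^ 2"
    by (rule mono[of 3 _ 1 2, unfolded power_one_right]; simp)+
  have up': "X \<le> X ^ 4 * Y ^ 2" "X \<le> X ^ 5 * Y ^ 2" by (rule X_le; simp)+
  have X_Suc: "X ^ 5 = X * X ^ 4" "X ^ 6 = X * X ^ 5" "X ^ 11 = X ^ 5 * X ^ 6"
    using power_Suc[of X 4] power_Suc[of X 5] power_add[of X 5 6] by simp_all
  have ro: "round_cost N L \<le> 5470 * (X ^ 4 * Y ^ 2)"
  proof -
    have "r + 2 * q + 120 * (N + 2) + 300 \<le> 5470 * z"
      if "r \<le> 3450 * z" "q \<le> 740 * y" "y \<le> z" "X \<le> z" "1 \<le> z" for q r y z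
    proof -
      have "2 * q \<le> 1480 * z" "120 * (N + 2) \<le> 240 * z" using that NX by simp_all
      then show ?thesis using that(1,5) by linarith
    qed
    from this[OF se bfs up(1) up'(1) one] show ?thesis unfolding round_cost_def .
  qed
  have si: "simulate_cost N L \<le> 6440 * (X ^ 5 * Y ^ 2)"
  proof -
    have "(N + 1) * (round_cost N L + 10) \<le> X * (5480 * (X ^ 4 * Y ^ 2))"
      by (rule mult_le_mono[OF NX]) (use ro one[of 4 2] in linarith)
    also have "\<dots> = 5480 * (X ^ 5 * Y ^ 2)" unfolding X_Suc(1) by (simp only: ac_simps)
    finally have loop: "(N + 1) * (round_cost N L + 10) \<le> 5480 * (X ^ 5 * Y ^ 2)" .
    have "r + q + 60 * (N + 2) + 100 \<le> 6440 * z"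
      if "r \<le> 5480 * z" "q \<le> 740 * y" "y \<le> z" "X \<le> z" "1 \<le> z" for q r y z
    proof -
      have "q \<le> 740 * z" "60 * (N + 2) \<le> 120 * z" using that NX by simp_all
      then show ?thesis using that(1,5) by linarith
    qed
    from this[OF loop bfs up(2) up'(2) one] show ?thesis unfolding simulate_cost_def .
  qed
  have de: "degree_cost \<le> 210 * (X ^ 1 * Y ^ 2)"
  proof -
    have "degree_cost \<le> Y * (210 * (X * Y))"
      unfolding degree_cost_def Y_def[symmetric]
    proof (rule mult_le_mono2)
      have "(length es + 1) * 110 + 100 \<le> 210 * (length es + 1)" by simp
      also have "\<dots> \<le> 210 * (X * Y)" using m by (rule mult_le_mono2)
      finally show "(length es + 1) * 110 + 100 \<le> 210 * (X * Y)" .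
    qed
    then show ?thesis by (simp add: power2_eq_square algebra_simps)
  qed
  have po: "power_cost D \<le> 100 * (X ^ 2 * Y ^ 0)"
  proof -
    have "power_cost D \<le> X * (100 * X)"
      unfolding power_cost_def
    proof (rule mult_le_mono)
      show "p + 1 \<le> X" using NX pN by linarith
      show "(D + 2) * 50 + 40 \<le> 100 * X" using NX DN X8 by (simp add: algebra_simps)
    qed
    then show ?thesis by (simp add: power2_eq_square)
  qed
  have loop: "(2 ^ N + 1) * (simulate_cost N L + 10) \<le> 12900 * (X ^ 6 * Y ^ 2)"
  proof -
    have "(2 ^ N + 1) * (simulate_cost N L + 10) \<le> (2 * X) * (6450 * (X ^ 5 * Y ^ 2))"
      unfolding X_def[symmetric] by (rule mult_le_mono) (use X8 si one[of 5 2] in linarith)+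
    then show ?thesis unfolding X_Suc(2) by (simp add: ac_simps)
  qed
  have "main_cost D = degree_cost + power_cost D + (2 ^ N + 1) * (simulate_cost N L + 10) + 50"
    by (simp add: main_cost_def N_def L_def Let_def)
  also have "\<dots> \<le> 32768 * (X ^ 6 * Y ^ 2)"
  proof -
    have "d + q + l + 50 \<le> 32768 * z"
      if "d \<le> 210 * x" "q \<le> 100 * y" "l \<le> 12900 * z" "x \<le> z" "y \<le> z" "1 \<le> z" for d q l x y z :: nat
      using that by linarith
    from this[OF de po loop mono mono one] show ?thesis by simp
  qed
  \<comment> \<open>\<open>32768 = 8 ^ 5\<close>, and \<open>8 \<le> X\<close>.\<close>
  also have "\<dots> \<le> X ^ 5 * (X ^ 6 * Y ^ 2)"
    using power_mono[OF X8, of 5] by (intro mult_le_mono1) simp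
  also have "\<dots> = X ^ 11 * Y ^ 2" unfolding X_Suc(3) by (simp only: mult.assoc)
  finally show ?thesis unfolding X_def Y_def N_def .
qed

end

section \<open>The encoded instance in the initial memory\<close>

lemma nth_concat_pairs:
  "j < length es \<Longrightarrow> concat (map (\<lambda>(u, v). [int u, int v]) es) ! (2 * j) = int (fst (es ! j)) \<and>
    concat (map (\<lambda>(u, v). [int u, int v]) es) ! Suc (2 * j) = int (snd (es ! j))"
proof (induction es arbitrary: j)
  case (Cons e es)
  then show ?case by (cases j; cases e) auto
qed simp

lemma length_concat_pairs: "length (concat (map (\<lambda>(u, v). [int u, int v]) es)) = 2 * length es"
  by (induction es) auto

context anchored_core_instance
begin

lemma input_initial_memory: "input (initial_memory (encode_instance n es b k (int p)))"
proof -
  let ?c = "concat (map (\<lambda>(u, v). [int u, int v]) es)"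
  let ?xs = "encode_instance n es b k (int p)"
  have xs: "?xs = int n # int (length es) # b # k # int p # ?c" by (simp add: encode_instance_def)
  have len: "length ?xs = 5 + 2 * length es" unfolding xs using length_concat_pairs[of es] by simp
  have nth: "initial_memory ?xs (int i) = ?xs ! i" if "i < 5 + 2 * length es" for i
    using that len by (simp add: initial_memory_def)
  have "initial_memory ?xs (5 + (int j + int j)) = int (fst (es ! j)) \<and>
      initial_memory ?xs (6 + (int j + int j)) = int (snd (es ! j))" if j: "j < length es" for j
  proof -
    have "5 + (int j + int j) = int (5 + 2 * j)" "6 + (int j + int j) = int (6 + 2 * j)" by simp_all
    moreover have "?xs ! (5 + 2 * j) = ?c ! (2 * j)" "?xs ! (6 + 2 * j) = ?c ! Suc (2 * j)"
      unfolding xs by (simp_all add: eval_nat_numeral)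
    ultimately show ?thesis using nth[of "5 + 2 * j"] nth[of "6 + 2 * j"] nth_concat_pairs[OF j] j
      by (simp only:)
  qed
  moreover have "initial_memory ?xs 0 = int n" "initial_memory ?xs 1 = int (length es)"
    "initial_memory ?xs 2 = b" "initial_memory ?xs 3 = k" "initial_memory ?xs 4 = int p"
    using nth[of 0] nth[of 1] nth[of 2] nth[of 3] nth[of 4] by (simp_all add: xs)
  ultimately show ?thesis by (simp add: input_def)
qed

end

section \<open>From anchored cores to sets of large gain\<close>

lemma acyclic_dag:
  assumes "dag (with_proj G)"
  shows "acyclic (parcs G)"
proof -
  interpret digraph "with_proj G" using assms by (simp add: dag_def)
  show ?thesis unfolding acyclic_def
  proof
    fix x show "(x, x) \<notin> (parcs G)\<^sup>+"
    proof
      assume "(x, x) \<in> (parcs G)\<^sup>+"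
      then obtain c where "awalk x c x" "c \<noteq> []" using reachable1_awalk[of x x] by auto
      then have "closed_w c" by (auto simp: closed_w_def)
      then show False using closed_w_imp_cycle assms by (auto simp: dag_def)
    qed
  qed
qed

text \<open>Sinks are removed one after another. The conclusion is restricted to \<open>H'\<close>
  because a removed sink may itself have been satisfied.\<close>

lemma trim_to_card:
  assumes "acyclic (set es)" "finite H" "q \<le> card H"
  shows "\<exists>H'\<subseteq>H. card H' = q \<and> satisfied es k H \<inter> H' \<subseteq> satisfied es k H'"
  using assms(2,3)
proof (induction "card H - q" arbitrary: H)
  case 0
  then show ?case by (intro exI[of _ H]) auto
next
  case (Suc d)
  \<comment> \<open>A minimal element of \<open>H\<close> for the converse arc relation is a vertex
    without out-neighbours in \<open>H\<close>.\<close>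
  have "wf ((set es)\<inverse>)" using assms(1) by (intro finite_acyclic_wf_converse) simp_all
  moreover obtain x0 where "x0 \<in> H" using Suc.hyps(2) by (cases "H = {}") auto
  ultimately obtain x where x: "x \<in> H" "\<And>y. (y, x) \<in> (set es)\<inverse> \<Longrightarrow> y \<notin> H"
    by (rule wfE_min) blast
  have card: "card (H - {x}) = card H - 1" using x(1) Suc.prems(1) by simp
  obtain H' where H': "H' \<subseteq> H - {x}" "card H' = q" "satisfied es k (H - {x}) \<inter> H' \<subseteq> satisfied es k H'"
  proof -
    have "d = card (H - {x}) - q" "finite (H - {x})" "q \<le> card (H - {x})"
      using Suc.hyps(2) Suc.prems card by simp_all
    from Suc.hyps(1)[OF this] show ?thesis using that by blast
  qed
  have "satisfied es k H \<inter> H' \<subseteq> satisfied es k (H - {x})"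
  proof
    fix v assume v: "v \<in> satisfied es k H \<inter> H'"
    then have "v \<in> H - {x}" using H'(1) by auto
    moreover have "{u \<in> H - {x}. (u, v) \<in> set es} = {u \<in> H. (u, v) \<in> set es}"
      using x(2)[of v] \<open>v \<in> H - {x}\<close> by auto
    ultimately show "v \<in> satisfied es k (H - {x})" using v by (simp add: satisfied_def)
  qed
  then show ?case using H' by (intro exI[of _ H']) auto
qed

lemma in_degree_induced:
  assumes "v \<in> H"
  shows "in_degree (with_proj G \<restriction> H) v = card {u \<in> H. (u, v) \<in> parcs G}"
proof -
  have "in_arcs (with_proj G \<restriction> H) v = (\<lambda>u. (u, v)) ` {u \<in> H. (u, v) \<in> parcs G}"
    using assms by (auto simp: in_arcs_def)
  then show ?thesis by (simp add: in_degree_def card_image inj_on_def)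
qed

text \<open>For a set of exactly \<open>p\<close> vertices the cheapest anchor set consists of the
  unsatisfied ones, so \<open>b\<close> anchors suffice precisely if the gain is at least
  \<open>p - b\<close>. Trimming leads from larger sets down to size \<open>p\<close>, monotonicity
  of the gain from smaller sets up to it.\<close>

lemma directed_anchored_k_core_iff:
  assumes "dag (with_proj G)" "graph_listing G n es"
  shows "directed_anchored_k_core (with_proj G) b k (int p) \<longleftrightarrow>
    p \<le> n \<and> (\<exists>H\<subseteq>{..<n}. card H \<le> p \<and> int p - b \<le> int (gain es k H))"
proof
  have V: "pverts G = {..<n}" and E: "parcs G = set es" using assms(2) by (simp_all add: graph_listing_def)
  have sat: "satisfied es k H = {v \<in> H. k \<le> int (in_degree (with_proj G \<restriction> H) v)}" for H
    by (auto simp: satisfied_def in_degree_induced E)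
  {
    assume "directed_anchored_k_core (with_proj G) b k (int p)"
    then obtain A H where AH: "A \<subseteq> H" "H \<subseteq> {..<n}" "int (card A) \<le> b" "p \<le> card H"
      "\<forall>v\<in>H - A. k \<le> int (in_degree (with_proj G \<restriction> H) v)"
      by (auto simp: directed_anchored_k_core_def V)
    have finH: "finite H" using AH(2) finite_subset by blast
    have "acyclic (set es)" using acyclic_dag[OF assms(1)] E by simp
    from trim_to_card[OF this finH AH(4), of k] obtain H' where
      H': "H' \<subseteq> H" "card H' = p" "satisfied es k H \<inter> H' \<subseteq> satisfied es k H'" by blast
    have finH': "finite H'" using H'(1) finH finite_subset by blast
    have "H - A \<subseteq> satisfied es k H" using AH(5) by (auto simp: sat)
    then have "H' - A \<subseteq> satisfied es k H'" using H'(1,3) by auto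
    then have "card (H' - A) \<le> gain es k H'" using finH' by (intro card_mono finite_satisfied)
    moreover have "card H' - card A \<le> card (H' - A)"
      using AH(1) finH by (intro diff_card_le_card_Diff) (rule finite_subset)
    ultimately have "int p - b \<le> int (gain es k H')" using H'(2) AH(3) by linarith
    moreover have "p \<le> n" using AH(4) card_mono[OF _ AH(2)] by simp
    ultimately show "p \<le> n \<and> (\<exists>H\<subseteq>{..<n}. card H \<le> p \<and> int p - b \<le> int (gain es k H))"
      using H' AH(2) by blast
  }
  assume "p \<le> n \<and> (\<exists>H\<subseteq>{..<n}. card H \<le> p \<and> int p - b \<le> int (gain es k H))"
  then obtain H where H: "p \<le> n" "H \<subseteq> {..<n}" "card H \<le> p" "int p - b \<le> int (gain es k H)" by blast
  \<comment> \<open>A set that is too small is filled up with arbitrary vertices, for which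
    \<open>p \<le> n\<close> provides the room.\<close>
  obtain H' where H': "H \<subseteq> H'" "H' \<subseteq> {..<n}" "card H' = p"
    using exists_subset_between[of H p "{..<n}"] H by auto
  have finH': "finite H'" using H'(2) finite_subset by blast
  have "gain es k H \<le> gain es k H'"
    using finH' H'(1) by (intro card_mono finite_satisfied satisfied_mono)
  moreover have "card (H' - satisfied es k H') = p - gain es k H'" and "gain es k H' \<le> p"
  proof -
    have sub: "satisfied es k H' \<subseteq> H'" by (auto simp: satisfied_def)
    then show "card (H' - satisfied es k H') = p - gain es k H'"
      using finH' H'(3) by (simp add: card_Diff_subset finite_satisfied)
    show "gain es k H' \<le> p" using card_mono[OF finH' sub] H'(3) by simp
  qed
  ultimately have "int (card (H' - satisfied es k H')) \<le> b" using H(4) by linarith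
  then show "directed_anchored_k_core (with_proj G) b k (int p)"
    unfolding directed_anchored_k_core_def
    by (intro exI[of _ "H' - satisfied es k H'"] exI[of _ H']) (use H' in \<open>auto simp: V sat\<close>)
qed

lemma incidences_le_max_degree:
  assumes "graph_listing G n es" "u < n"
  shows "incidences es u \<le> max_degree (with_proj G)"
proof -
  have V: "pverts G = {..<n}" and E: "parcs G = set es" and d: "distinct es"
    using assms(1) by (simp_all add: graph_listing_def)
  have count: "count_list (map f es) u = card {e \<in> set es. f e = u}" for f :: "nat \<times> nat \<Rightarrow> nat"
  proof -
    have "count_list (map f es) u = length (filter (\<lambda>e. f e = u) es)"
      by (induction es) auto
    then show ?thesis using distinct_card[of "filter (\<lambda>e. f e = u) es"] d by simp
  qed
  have "incidences es u = Defs.degree (with_proj G) u"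
    by (simp add: incidences_def count Defs.degree_def in_degree_def out_degree_def in_arcs_def out_arcs_def E)
  also have "\<dots> \<le> max_degree (with_proj G)"
    unfolding max_degree_def using V assms(2) by (intro Max_ge) simp_all
  finally show ?thesis .
qed

text \<open>From \<open>n = 2\<close> on the logarithm is at least 1 and
  \<open>n + 1 \<le> 2 * n\<close>. For smaller \<open>n\<close> the product with the logarithm
  vanishes, and \<open>max 1\<close> takes over.\<close>

lemma square_Suc_le_n2_log: "(real n + 1) ^ 2 \<le> 4 * max 1 (real n ^ 2 * log 2 (real n))"
proof (cases "n \<le> 1")
  case True
  then have "(real n + 1) ^ 2 \<le> 2 ^ 2" by (intro power_mono) simp_all
  also have "\<dots> \<le> 4 * max 1 (real n ^ 2 * log 2 (real n))" by simp
  finally show ?thesis .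
next
  case False
  then have n: "2 \<le> real n" by simp
  then have "1 \<le> log 2 (real n)" by simp
  then have "real n ^ 2 * 1 \<le> real n ^ 2 * log 2 (real n)" by (intro mult_left_mono) simp_all
  moreover have "(real n + 1) ^ 2 \<le> (2 * real n) ^ 2" using n by (intro power_mono) simp_all
  ultimately show ?thesis by (simp add: power_mult_distrib)
qed

lemma initial_memory_negative: "a < 0 \<Longrightarrow> initial_memory xs a = 0"
  by (simp add: initial_memory_def)

theorem theorem6:
  "\<exists>(prog :: com) (c :: nat).
     \<forall>(p :: nat) (\<Delta> :: nat) (G :: nat pair_pre_digraph) (n :: nat) (es :: (nat \<times> nat) list)
        (b :: int) (k :: int).
       p \<ge> 1 \<longrightarrow> \<Delta> \<ge> 1 \<longrightarrow>
       dag (with_proj G) \<longrightarrow> max_degree (with_proj G) \<le> \<Delta> \<longrightarrow> graph_listing G n es \<longrightarrow>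
       decides_within prog (encode_instance n es b k (int p))
         (directed_anchored_k_core (with_proj G) b k (int p))
         (2 ^ (c * \<Delta> * p) * max 1 (real n ^ 2 * log 2 (real n)))"
proof (intro exI[of _ main_prog] exI[of _ 72] allI impI)
  fix p \<Delta> :: nat and G :: "nat pair_pre_digraph" and n :: nat and es :: "(nat \<times> nat) list" and b k :: int
  assume p: "1 \<le> p" and \<Delta>: "1 \<le> \<Delta>" and dag: "dag (with_proj G)" and deg: "max_degree (with_proj G) \<le> \<Delta>"
    and G: "graph_listing G n es"
  interpret digraph "with_proj G" using dag by (simp add: dag_def)
  interpret anchored_core_instance es n b k p
  proof
    show "set es \<subseteq> {..<n} \<times> {..<n}"
      using G tail_in_verts head_in_verts by (force simp: graph_listing_def)
    show "distinct es" using G by (simp add: graph_listing_def)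
  qed
  let ?s = "initial_memory (encode_instance n es b k (int p))"
  obtain D where D: "\<And>u. incidences es u \<le> D" "D = 0 \<or> (\<exists>u. D = incidences es u)"
    and run: "runs main_prog ?s (main_cost D)
      (\<lambda>s'. s' 0 = of_bool (p \<le> n \<and> (\<exists>W<2 ^ (3 * (D + 1) * p). accepts (3 * (D + 1) * p) W)))"
    using runs_main[of ?s] input_initial_memory by (auto simp: initial_memory_negative)
  have "D \<le> \<Delta>"
    using D(2) incidences_le_max_degree[OF G] incidences_outside deg by (metis le_trans linorder_not_le zero_le)
  let ?e = "3 * (D + 1) * p" and ?M = "max 1 (real n ^ 2 * log 2 (real n))"
  \<comment> \<open>The 12 is made up of the eleven powers of \<open>2 ^ ?e\<close> in the cost
    bound and one more for the factor 4 in front of the maximum. The 72 is \<open>3 * 12\<close>,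
    doubled because \<open>D + 1 \<le> 2 * \<Delta>\<close>.\<close>
  have "?e * 12 \<le> 72 * \<Delta> * p"
  proof -
    have "?e * 12 = (36 * (D + 1)) * p" by simp
    also have "\<dots> \<le> (72 * \<Delta>) * p" using \<open>D \<le> \<Delta>\<close> \<Delta> by (intro mult_le_mono1) simp
    finally show ?thesis .
  qed
  have "?e \<noteq> 0" using p by simp
  then have "2 \<le> ?e" using p by (cases p) simp_all
  have "real (main_cost D) \<le> real ((2 ^ ?e) ^ 11 * (n + 1) ^ 2)"
    using main_cost_le[OF D(1) p] by (simp only: of_nat_le_iff)
  also have "\<dots> = (2 ^ ?e) ^ 11 * (real n + 1) ^ 2" by (simp add: add.commute)
  \<comment> \<open>The additional power absorbs the factor 4, since \<open>?e\<close> is at least 2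
    by positivity of \<open>p\<close>.\<close>
  also have "\<dots> \<le> (2 ^ ?e) ^ 11 * (2 ^ ?e * ?M)"
  proof (rule mult_left_mono)
    have "(2::real) ^ 2 \<le> 2 ^ ?e" using \<open>2 \<le> ?e\<close> by (rule power_increasing) simp
    then have "4 * ?M \<le> 2 ^ ?e * ?M" by (intro mult_right_mono) simp_all
    then show "(real n + 1) ^ 2 \<le> 2 ^ ?e * ?M" using square_Suc_le_n2_log[of n] by linarith
  qed simp
  also have "\<dots> = 2 ^ (?e * 12) * ?M" by (simp flip: power_mult power_add)
  also have "\<dots> \<le> 2 ^ (72 * \<Delta> * p) * ?M"
    using \<open>?e * 12 \<le> 72 * \<Delta> * p\<close> by (intro mult_right_mono power_increasing) simp_all
  finally have time: "real (main_cost D) \<le> 2 ^ (72 * \<Delta> * p) * ?M" .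
  have answer: "directed_anchored_k_core (with_proj G) b k (int p) \<longleftrightarrow>
      p \<le> n \<and> (\<exists>W<2 ^ ?e. accepts ?e W)"
    using directed_anchored_k_core_iff[OF dag G] accepts_iff[OF D(1)] by simp
  obtain t s' where "exec main_prog ?s t s'" "t \<le> main_cost D"
    "s' 0 = of_bool (p \<le> n \<and> (\<exists>W<2 ^ ?e. accepts ?e W))"
    using run unfolding runs_def by blast
  moreover from this have "real t \<le> 2 ^ (72 * \<Delta> * p) * ?M" using time by linarith
  ultimately show "decides_within main_prog (encode_instance n es b k (int p))
      (directed_anchored_k_core (with_proj G) b k (int p)) (2 ^ (72 * \<Delta> * p) * ?M)"
    unfolding decides_within_def answer of_bool_def by blast
qed

end
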